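(* Let $n\ge 2$ and fix an arbitrary norm $|\cdot|$ on $\mathbb{R}^n$. For every lattice $\Lambda\in X_n$, the orbit $A\Lambda$ intersects both $\mathrm{ST}_n$ and $\mathrm{WR}_n$ (the latter defined with respect to $|\cdot|$); that is, there exist $a_1,a_2\in A$ with $a_1\Lambda\in \mathrm{ST}_n$ and $a_2\Lambda\in\mathrm{WR}_n$.
   Context: $X_n:=\mathrm{SL}_n(\mathbb{R})/\mathrm{SL}_n(\mathbb{Z})$ is identified with the space of lattices in $\mathbb{R}^n$ of covolume $1$. $A\subseteq \mathrm{SL}_n(\mathbb{R})$ is the group of diagonal matrices with positive diagonal entries (and determinant $1$), acting on $X_n$ by left multiplication. For a lattice $\Lambda$, its successive minima with respect to $|\cdot|$ are $\lambda_i(\Lambda):=\inf\{r>0:\dim\mathrm{span}\{v\in\Lambda:|v|<r\}\ge i\}$, $i=1,\dots,n$; $\mathrm{WR}_n$ is the set of $\Lambda\in X_n$ with $\lambda_1(\Lambda)=\dots=\lambda_n(\Lambda)$. For a discrete subgroup $\Gamma<\mathbb{R}^n$, $\mathrm{cov}\,\Gamma$ denotes the Euclidean volume of $\mathrm{span}(\Gamma)/\Gamma$, with $\mathrm{cov}\{0\}:=1$. $\mathrm{ST}_n$ (stable lattices) is the set of $\Lambda\in X_n$ such that $\mathrm{cov}\,\Gamma\ge 1$ for every subgroup $\Gamma\le\Lambda$. *)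

theory Defs
  imports "HOL-Analysis.Analysis"
begin

definition is_norm :: "(real^'n \<Rightarrow> real) \<Rightarrow> bool" where
  "is_norm N \<longleftrightarrow> (\<forall>x. N x \<ge> 0) \<and> (\<forall>x. N x = 0 \<longleftrightarrow> x = 0)
     \<and> (\<forall>c x. N (c *\<^sub>R x) = \<bar>c\<bar> * N x) \<and> (\<forall>x y. N (x + y) \<le> N x + N y)"

definition int_vectors :: "(real^'n) set" where
  "int_vectors = {x. \<forall>i. x $ i \<in> \<int>}"

definition lattices_X :: "(real^'n) set set" where
  "lattices_X = {L. \<exists>g :: real^'n^'n. det g = 1 \<and> L = (\<lambda>z. g *v z) ` int_vectors}"

definition diagA :: "(real^'n^'n) set" where
  "diagA = {a. (\<forall>i j. i \<noteq> j \<longrightarrow> a $ i $ j = 0) \<and> (\<forall>i. a $ i $ i > 0) \<and> det a = 1}"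

definition act :: "real^'n^'n \<Rightarrow> (real^'n) set \<Rightarrow> (real^'n) set" where
  "act a L = (\<lambda>v. a *v v) ` L"

definition succ_min :: "(real^'n \<Rightarrow> real) \<Rightarrow> (real^'n) set \<Rightarrow> nat \<Rightarrow> real" where
  "succ_min N L i = Inf {r. r > 0 \<and> dim (span {v \<in> L. N v < r}) \<ge> i}"

definition WR :: "(real^'n \<Rightarrow> real) \<Rightarrow> (real^'n) set set" where
  "WR N = {L \<in> lattices_X. \<forall>i\<in>{1..CARD('n)}. \<forall>j\<in>{1..CARD('n)}. succ_min N L i = succ_min N L j}"

definition is_subgroup :: "(real^'n) set \<Rightarrow> (real^'n) set \<Rightarrow> bool" where
  "is_subgroup G L \<longleftrightarrow> G \<subseteq> L \<and> 0 \<in> G \<and> (\<forall>x\<in>G. \<forall>y\<in>G. x - y \<in> G)"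

definition is_Zbasis :: "(real^'n) set \<Rightarrow> (real^'n) list \<Rightarrow> bool" where
  "is_Zbasis G vs \<longleftrightarrow> distinct vs \<and> independent (set vs) \<and>
     G = {(\<Sum>i<length vs. of_int (c i) *\<^sub>R (vs ! i)) | c :: nat \<Rightarrow> int. True}"

definition gram_det :: "(real^'n) list \<Rightarrow> real" where
  "gram_det vs = (\<Sum>p | p permutes {..<length vs}.
      of_int (sign p) * (\<Prod>i<length vs. (vs ! i) \<bullet> (vs ! (p i))))"

text \<open>Covolume: volume of span(G)/G = sqrt of Gram determinant of a Z-basis (cov {0} = 1).\<close>
definition cov :: "(real^'n) set \<Rightarrow> real" where
  "cov G = sqrt (gram_det (SOME vs. is_Zbasis G vs))"

definition ST :: "(real^'n) set set" where
  "ST = {L \<in> lattices_X. \<forall>G. is_subgroup G L \<longrightarrow> cov G \<ge> 1}"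

end

theory Submission
  imports Defs "Jordan_Normal_Form.Determinant"
begin

text \<open>
  For a rational subspace \<open>V\<close> let \<open>f\<^sub>V t\<close> be the normalised logarithm of the covolume of
  \<open>exp t (\<Lambda> \<inter> V)\<close>.  It is convex in \<open>t\<close>, and its gradient is the centred diagonal of the
  orthogonal projection onto \<open>exp t V\<close>.  If the diagonal orbit misses the stable (or the
  well-rounded) lattices, then every \<open>t\<close> destabilises a flag of proper rational subspaces on which
  \<open>f\<^sub>V t\<close> is bounded above, with continuous weights \<open>w\<^sub>V t\<close>.

  Fix a base point \<open>s\<close>.  By Brouwer's theorem the perturbed equation
  \<open>\<Sum> w\<^sub>V t (\<nabla> f\<^sub>V s) = \<epsilon> (\<Sum> w\<^sub>V t) (t - s)\<close> has a solution \<open>t\<close>: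
  by convexity the corresponding vector field points outwards on large spheres.  Pairing the equation
  with \<open>t - s\<close> shows that the weights of the \<open>V\<close> with large \<open>f\<^sub>V s\<close> are small,
  and only finitely many \<open>f\<^sub>V s\<close> lie below a given bound.  Hence, as \<open>\<epsilon>\<close>
  tends to \<open>0\<close>, one finds a flag for which \<open>0\<close> is a convex combination of the gradients
  \<open>\<nabla> f\<^sub>V s\<close>.

  This is impossible for generic \<open>s\<close>.  Along \<open>s = - \<rho> ln y\<close>, where \<open>\<rho>\<close> orders the
  coordinates, the gradients of a fixed flag are rational functions of \<open>y\<close>, and at \<open>y = 0\<close> they
  become those of a flag of coordinate subspaces, which are linearly independent.  So each of the
  countably many flags excludes only finitely many \<open>y\<close>.
\<close>

no_notation Matrix.vec_index (infixl \<open>$\<close> 100)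
no_notation Matrix.scalar_prod (infix \<open>\<bullet>\<close> 70)

section \<open>Determinants indexed by natural numbers\<close>

text \<open>The obstacle is that infinitely many \<open>V\<close> compete while \<open>t\<close>
  ranges over a noncompact space. Two uniform facts stand in for compactness. An upper bound
  \<open>lnvol L V t \<le> c\<close> wherever \<open>V\<close> is active turns convexity into
  \<open>lnvol L V s - c \<le> lnvol_grad V s \<bullet> (s - t)\<close>, which involves
  \<open>V\<close> only through data at the fixed \<open>s\<close>, however far away
  \<open>t\<close> is. And only finitely many \<open>V\<close> keep the left side below a given
  bound. That upper bound is where the two problems differ. For stable lattices it is 0, since
  active subspaces have negative \<open>lnvol\<close>. For well-rounded lattices an active
  \<open>V\<close> is spanned by vectors of bounded length, the length scale being a Minkowski bound
  uniform in \<open>t\<close>. Flags are essential: the gradients of the coordinate axes at 0, for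
  instance, sum to zero, whereas along a flag in generic position one functional is positive on all
  gradients. The normalisation of \<open>lnvol\<close> ignores constant vectors, so Brouwer's
  theorem can be used on all of R^n and determinant 1 is restored at the end by
  \<open>center\<close>.\<close>

definition ndet :: "nat \<Rightarrow> (nat \<Rightarrow> nat \<Rightarrow> 'a::comm_ring_1) \<Rightarrow> 'a" where
  "ndet k m = (\<Sum>p | p permutes {..<k}. of_int (sign p) * (\<Prod>i<k. m i (p i)))"

text \<open>Gram matrices of lists vary in size, so they are indexed by \<open>nat\<close> with the
  size as a parameter; this identification gives access to the determinant theory of matrices of
  variable size.\<close>

lemma ndet_eq_det: "ndet k m = Determinant.det (Matrix.mat k k (\<lambda>(i,j). m i j))"
proof -
  have "(\<Prod>i = 0..<k. Matrix.mat k k (\<lambda>(i,j). m i j) $$ (i, p i)) = (\<Prod>i<k. m i (p i))"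
    if "p permutes {..<k}" for p
    using that by (auto simp: atLeast0LessThan permutes_in_image intro!: prod.cong)
  then show ?thesis
    unfolding ndet_def Determinant.det_def by (auto simp: atLeast0LessThan intro!: sum.cong)
qed

lemma ndet_cong: "(\<And>i j. i < k \<Longrightarrow> j < k \<Longrightarrow> m i j = m' i j) \<Longrightarrow> ndet k m = ndet k m'"
  unfolding ndet_eq_det by (intro arg_cong[where f=Determinant.det] eq_matI) auto

lemma ndet_mult: "ndet k (\<lambda>i j. \<Sum>l<k. a i l * b l j) = ndet k a * ndet k b"
proof -
  have "Matrix.mat k k (\<lambda>(i,j). \<Sum>l<k. a i l * b l j)
      = Matrix.mat k k (\<lambda>(i,j). a i j) * Matrix.mat k k (\<lambda>(i,j). b i j)"
    by (rule eq_matI) (auto simp: Matrix.scalar_prod_def atLeast0LessThan intro!: sum.cong)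
  then show ?thesis
    unfolding ndet_eq_det by (simp only:) (rule det_mult[where n=k]; simp)
qed

lemma ndet_transpose: "ndet k (\<lambda>i j. m j i) = ndet k m"
proof -
  have "Matrix.mat k k (\<lambda>(i,j). m j i) = transpose_mat (Matrix.mat k k (\<lambda>(i,j). m i j))"
    by (rule eq_matI) auto
  then show ?thesis unfolding ndet_eq_det by (simp add: Determinant.det_transpose[where n=k])
qed

lemma ndet_lower_triangular:
  assumes "\<And>i j. i < j \<Longrightarrow> j < k \<Longrightarrow> m i j = 0"
  shows "ndet k m = (\<Prod>i<k. m i i)"
proof -
  have "diag_mat (Matrix.mat k k (\<lambda>(i,j). m i j)) = map (\<lambda>i. m i i) [0..<k]"
    by (auto simp: diag_mat_def)
  moreover have "prod_list (map (\<lambda>i. m i i) [0..<k]) = (\<Prod>i<k. m i i)"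
    by (induction k) (auto simp: lessThan_Suc mult.commute)
  ultimately show ?thesis
    unfolding ndet_eq_det using assms
    by (subst det_lower_triangular[where n=k]) simp_all
qed

lemma ndet_of_int: "ndet k (\<lambda>i j. of_int (m i j)) = of_int (ndet k m)"
  unfolding ndet_def by simp

text \<open>Cramer's rule over a commutative ring. It is applied to integer Gram matrices, whose
  inverse need not be integral while the adjugate is.\<close>

lemma ndet_adjugate:
  obtains adj where "\<And>i j. i < k \<Longrightarrow> j < k \<Longrightarrow>
    (\<Sum>l<k. adj i l * m l j) = (if i = j then ndet k m else 0)"
proof
  let ?M = "Matrix.mat k k (\<lambda>(i,j). m i j)"
  fix i j assume ij: "i < k" "j < k"
  have M: "?M \<in> carrier_mat k k" by simp
  have "(adj_mat ?M * ?M) $$ (i,j) = (\<Sum>l<k. adj_mat ?M $$ (i,l) * m l j)"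
    using ij adj_mat(1)[OF M] by (auto simp: Matrix.scalar_prod_def atLeast0LessThan intro!: sum.cong)
  then show "(\<Sum>l<k. adj_mat ?M $$ (i,l) * m l j) = (if i = j then ndet k m else 0)"
    using ij by (auto simp: adj_mat(3)[OF M] ndet_eq_det)
qed

section \<open>Gram--Schmidt and Gram determinants\<close>

lemma gram_det_eq_ndet: "gram_det vs = ndet (length vs) (\<lambda>i j. (vs ! i) \<bullet> (vs ! j))"
  unfolding gram_det_def ndet_def ..

text \<open>The Gram matrix of \<open>us\<close> is m G m^T, where G is that of
  \<open>vs\<close>.\<close>

lemma gram_det_lincomb:
  assumes "length us = k" "length vs = k"
    and us: "\<And>i. i < k \<Longrightarrow> us ! i = (\<Sum>j<k. m i j *\<^sub>R vs ! j)"
  shows "gram_det us = (ndet k m)\<^sup>2 * gram_det vs"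
proof -
  let ?G = "\<lambda>i j. vs ! i \<bullet> vs ! j" and ?T = "\<lambda>i j. m j i"
  let ?A = "\<lambda>i a. \<Sum>b<k. m i b * ?G b a"
  have "us ! i \<bullet> us ! j = (\<Sum>a<k. ?A i a * ?T a j)" if "i < k" "j < k" for i j
  proof -
    have "us ! i \<bullet> us ! j = (\<Sum>a<k. (us ! i \<bullet> vs ! a) * m j a)"
      by (subst us[OF that(2)]) (simp add: inner_sum_right mult.commute)
    moreover have "us ! i \<bullet> vs ! a = ?A i a" for a
      by (subst us[OF that(1)]) (simp add: inner_sum_left)
    ultimately show ?thesis by (simp only:)
  qed
  then have 1: "gram_det us = ndet k (\<lambda>i j. \<Sum>a<k. ?A i a * ?T a j)"
    unfolding gram_det_eq_ndet assms(1) by (rule ndet_cong[of k "\<lambda>i j. us ! i \<bullet> us ! j"])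
  have 2: "ndet k (\<lambda>i j. \<Sum>a<k. ?A i a * ?T a j) = ndet k ?A * ndet k ?T"
    by (rule ndet_mult[of k ?A ?T])
  have 3: "ndet k ?A = ndet k m * gram_det vs"
    unfolding gram_det_eq_ndet assms(2) by (rule ndet_mult[of k m ?G])
  have 4: "ndet k ?T = ndet k m" by (rule ndet_transpose[of k m])
  show ?thesis by (simp only: 1 2 3 4 power2_eq_square mult.assoc) (simp only: mult.commute)
qed

lemma gram_det_orthogonal:
  assumes "\<And>i j. i < j \<Longrightarrow> j < length vs \<Longrightarrow> vs ! i \<bullet> vs ! j = 0"
  shows "gram_det vs = (\<Prod>i<length vs. (norm (vs ! i))\<^sup>2)"
  unfolding gram_det_eq_ndet using assms
  by (subst ndet_lower_triangular) (auto simp: power2_norm_eq_inner)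

text \<open>The vectors stay unnormalised so that their entries are rational in those of
  \<open>C\<close>, which genericity relies on. If \<open>gs C l\<close> is zero, its coefficient is
  a division by zero and hence 0, so orthogonality holds even for dependent families.\<close>

fun gs :: "(nat \<Rightarrow> 'a::real_inner) \<Rightarrow> nat \<Rightarrow> 'a" where
  "gs C i = C i - (\<Sum>l<i. ((C i \<bullet> gs C l) / (gs C l \<bullet> gs C l)) *\<^sub>R gs C l)"

declare gs.simps[simp del]

lemma gs_orthogonal_less: "l < i \<Longrightarrow> gs C i \<bullet> gs C l = 0"
proof (induction i arbitrary: l rule: less_induct)
  case (less i)
  have "(\<Sum>m<i. ((C i \<bullet> gs C m) / (gs C m \<bullet> gs C m)) *\<^sub>R gs C m) \<bullet> gs C l
      = (\<Sum>m<i. if m = l then C i \<bullet> gs C l else 0)"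
    unfolding inner_sum_left
  proof (rule sum.cong[OF refl])
    fix m assume "m \<in> {..<i}"
    then show "((C i \<bullet> gs C m) / (gs C m \<bullet> gs C m)) *\<^sub>R gs C m \<bullet> gs C l
        = (if m = l then C i \<bullet> gs C l else 0)"
      using less.IH[of m l] less.IH[of l m] less.prems
      by (cases "m = l"; cases "m < l") (auto simp: inner_commute)
  qed
  then show ?case using less.prems by (subst gs.simps) (simp add: inner_diff_left)
qed

lemma gs_orthogonal: "l \<noteq> i \<Longrightarrow> gs C i \<bullet> gs C l = 0"
  by (metis gs_orthogonal_less inner_commute linorder_neqE_nat)

lemma gs_span: "span (gs C ` {..<k}) = span (C ` {..<k})"
proof (induction k)
  case (Suc k)
  have "(\<Sum>l<k. ((C k \<bullet> gs C l) / (gs C l \<bullet> gs C l)) *\<^sub>R gs C l) \<in> span (gs C ` {..<k})"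
    by (intro span_sum span_scale span_base) auto
  then have d: "C k - gs C k \<in> span (gs C ` {..<k})"
    by (simp add: gs.simps[of C k])
  have "span (insert (gs C k) (gs C ` {..<k})) = span (insert (C k) (gs C ` {..<k}))"
  proof (intro antisym span_minimal insert_subsetI subspace_span)
    have "C k - (C k - gs C k) \<in> span (insert (C k) (gs C ` {..<k}))"
      by (intro span_diff span_base insertI1 span_mono[THEN subsetD, OF _ d]) auto
    then show "gs C k \<in> span (insert (C k) (gs C ` {..<k}))" by simp
    have "(C k - gs C k) + gs C k \<in> span (insert (gs C k) (gs C ` {..<k}))"
      by (intro span_add span_base insertI1 span_mono[THEN subsetD, OF _ d]) auto
    then show "C k \<in> span (insert (gs C k) (gs C ` {..<k}))" by simp
  qed (auto intro: span_base)
  also have "\<dots> = span (insert (C k) (C ` {..<k}))"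
    by (simp add: span_insert[where S="gs C ` {..<k}"] span_insert[where S="C ` {..<k}"] Suc.IH)
  finally show ?case by (simp add: lessThan_Suc)
qed simp

lemma gs_nonzero:
  assumes "inj_on C {..<n}" "independent (C ` {..<n})" "i < n"
  shows "gs C i \<noteq> 0"
proof
  assume "gs C i = 0"
  then have "C i = (\<Sum>l<i. ((C i \<bullet> gs C l) / (gs C l \<bullet> gs C l)) *\<^sub>R gs C l)"
    by (simp add: gs.simps[of C i])
  also have "\<dots> \<in> span (gs C ` {..<i})" by (intro span_sum span_scale span_base) auto
  finally have "C i \<in> span (C ` {..<i})" by (simp add: gs_span)
  moreover have "C ` {..<i} \<subseteq> C ` {..<n} - {C i}"
    using assms by (auto simp: inj_on_def)
  ultimately show False
    using assms by (meson dependent_def image_eqI lessThan_iff span_mono subsetD)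
qed

text \<open>Since \<open>w\<close> is orthogonal to the span, Pythagoras makes \<open>v - w\<close>
  the point of the span nearest to \<open>v\<close>.\<close>

lemma norm_eq_infdist_span:
  assumes "v - w \<in> span S" "\<And>x. x \<in> S \<Longrightarrow> w \<bullet> x = 0"
  shows "norm w = infdist v (span S)"
proof -
  have ortho: "w \<bullet> x = 0" if "x \<in> span S" for x
    using that by (induction rule: span_induct_alt) (auto simp: inner_add_right assms(2))
  have le: "norm w \<le> dist v x" if "x \<in> span S" for x
  proof -
    have "v - w - x \<in> span S" using assms(1) that by (rule span_diff)
    then have "w \<bullet> (v - w - x) = 0" by (rule ortho)
    then have "(norm (w + (v - w - x)))\<^sup>2 = (norm w)\<^sup>2 + (norm (v - w - x))\<^sup>2"
      by (intro norm_add_Pythagorean) (simp add: real_inner_class.orthogonal_def)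
    moreover have "w + (v - w - x) = v - x" by simp
    ultimately have "(norm w)\<^sup>2 \<le> (norm (v - x))\<^sup>2" by simp
    then show ?thesis by (simp add: dist_norm)
  qed
  have ne: "span S \<noteq> {}" using span_zero by blast
  show ?thesis
  proof (rule antisym)
    show "norm w \<le> infdist v (span S)"
      using ne le by (auto simp: infdist_def intro!: cINF_greatest)
    show "infdist v (span S) \<le> norm w"
      using infdist_le[OF assms(1), of v] by (simp add: dist_norm)
  qed
qed

text \<open>Base times height: the change to Gram-Schmidt vectors is unipotent triangular, and each
  of these vectors measures a height over the preceding span. Positivity, submodularity and
  Hadamard's bound are all read off from these heights.\<close>

lemma gram_det_eq_prod_infdist:
  "gram_det vs = (\<Prod>i<length vs. (infdist (vs ! i) (span (set (take i vs))))\<^sup>2)"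
proof -
  let ?C = "\<lambda>i. vs ! i" and ?k = "length vs"
  define m where "m i j = (if j = i then 1 else if j < i then (?C i \<bullet> gs ?C j) / (gs ?C j \<bullet> gs ?C j) else 0)" for i j
  have set_take: "set (take i vs) = ?C ` {..<i}" if "i < ?k" for i
    using that by (simp add: nth_image[symmetric] atLeast0LessThan)
  have "?C i = (\<Sum>j<?k. m i j *\<^sub>R map (gs ?C) [0..<?k] ! j)" if "i < ?k" for i
  proof -
    have "(\<Sum>j<?k. m i j *\<^sub>R map (gs ?C) [0..<?k] ! j) = (\<Sum>j<?k. m i j *\<^sub>R gs ?C j)" by simp
    also have "\<dots> = (\<Sum>j<Suc i. m i j *\<^sub>R gs ?C j)"
      using that by (intro sum.mono_neutral_right) (auto simp: m_def)
    also have "\<dots> = ?C i" by (simp add: m_def) (simp add: gs.simps[of ?C i])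
    finally show ?thesis by simp
  qed
  then have "gram_det vs = (ndet ?k m)\<^sup>2 * gram_det (map (gs ?C) [0..<?k])"
    by (intro gram_det_lincomb) auto
  moreover have "ndet ?k m = 1" by (subst ndet_lower_triangular) (auto simp: m_def)
  moreover have "gram_det (map (gs ?C) [0..<?k]) = (\<Prod>i<?k. (norm (gs ?C i))\<^sup>2)"
    by (subst gram_det_orthogonal) (auto simp: gs_orthogonal)
  moreover have "norm (gs ?C i) = infdist (?C i) (span (set (take i vs)))" if "i < ?k" for i
    unfolding set_take[OF that] gs_span[of ?C, symmetric]
  proof (rule norm_eq_infdist_span)
    show "?C i - gs ?C i \<in> span (gs ?C ` {..<i})"
      by (subst gs.simps, simp, rule span_sum, rule span_scale, rule span_base) simp
  qed (auto simp: gs_orthogonal_less)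
  ultimately show ?thesis by simp
qed

hide_const (open) Determinant.det Matrix.mat
hide_fact (open) Matrix.vec_eq_iff Determinant.det_transpose Determinant.det_def

section \<open>Diagonal scaling of volumes\<close>

definition onb :: "'a::euclidean_space set \<Rightarrow> 'a list \<Rightarrow> bool" where
  "onb V ps \<longleftrightarrow> span (set ps) = V \<and>
     (\<forall>i<length ps. \<forall>j<length ps. ps ! i \<bullet> ps ! j = (if i = j then 1 else 0))"

lemma onb_inner: "onb V ps \<Longrightarrow> i < length ps \<Longrightarrow> j < length ps \<Longrightarrow>
    ps ! i \<bullet> ps ! j = (if i = j then 1 else 0)"
  unfolding onb_def by blast

lemma onb_norm: "onb V ps \<Longrightarrow> i < length ps \<Longrightarrow> norm (ps ! i) = 1"
  by (simp add: norm_eq_sqrt_inner onb_inner)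

lemma onb_in: "onb V ps \<Longrightarrow> i < length ps \<Longrightarrow> ps ! i \<in> V"
  unfolding onb_def by (metis nth_mem span_base)

lemma onb_distinct: "onb V ps \<Longrightarrow> distinct ps"
  unfolding distinct_conv_nth by (metis onb_inner zero_neq_one)

lemma onb_length:
  assumes "onb V ps"
  shows "length ps = dim V"
proof -
  have "pairwise real_inner_class.orthogonal (set ps)" "0 \<notin> set ps"
    using onb_inner[OF assms]
    by (auto simp: pairwise_def real_inner_class.orthogonal_def in_set_conv_nth)
      (metis inner_zero_left zero_neq_one)
  then have "independent (set ps)" by (rule pairwise_orthogonal_independent)
  then have "dim (span (set ps)) = card (set ps)" by (simp add: dim_eq_card_independent)
  moreover have "span (set ps) = V" using assms by (simp add: onb_def)
  ultimately show ?thesis using onb_distinct[OF assms] by (simp add: distinct_card)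
qed

lemma onb_expansion:
  assumes "onb V ps" "v \<in> V"
  shows "v = (\<Sum>i<length ps. (v \<bullet> ps ! i) *\<^sub>R ps ! i)"
proof -
  have "v \<in> span (set ps)" using assms by (simp add: onb_def)
  then show ?thesis
  proof (induction rule: span_induct_alt)
    case (step c x y)
    then obtain k where k: "k < length ps" "x = ps ! k" by (auto simp: in_set_conv_nth)
    have "(\<Sum>i<length ps. ((c *\<^sub>R x + y) \<bullet> ps ! i) *\<^sub>R ps ! i)
        = c *\<^sub>R (\<Sum>i<length ps. (x \<bullet> ps ! i) *\<^sub>R ps ! i) + (\<Sum>i<length ps. (y \<bullet> ps ! i) *\<^sub>R ps ! i)"
      by (simp add: inner_add_left scaleR_add_left sum.distrib scaleR_sum_right)
    also have "(\<Sum>i<length ps. (x \<bullet> ps ! i) *\<^sub>R ps ! i) = (\<Sum>i<length ps. if i = k then x else 0)"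
      using k onb_inner[OF assms(1)] by (intro sum.cong) auto
    finally show ?case using k step by simp
  qed simp
qed

text \<open>The ratio \<open>(norm (A x) / norm x)\<^sup>2\<close> is stationary at its maximum on \<open>V\<close>, so the
  \<open>A\<close>-images of the maximiser and of its orthogonal complement in \<open>V\<close> are orthogonal.\<close>

lemma simultaneous_diagonalisation:
  fixes A :: "'a::euclidean_space \<Rightarrow> 'b::euclidean_space"
  assumes "subspace V" "linear A"
  obtains ps where "onb V ps"
    "\<And>i j. i < length ps \<Longrightarrow> j < length ps \<Longrightarrow> i \<noteq> j \<Longrightarrow> A (ps ! i) \<bullet> A (ps ! j) = 0"
proof -
  have "\<exists>ps. onb V ps \<and> (\<forall>i<length ps. \<forall>j<length ps. i \<noteq> j \<longrightarrow> A (ps ! i) \<bullet> A (ps ! j) = 0)"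
    using assms(1)
  proof (induction "dim V" arbitrary: V rule: less_induct)
    case less
    show ?case
    proof (cases "V = {0}")
      case True
      then have "onb V []" by (simp add: onb_def)
      then show ?thesis by (intro exI[of _ "[]"]) simp
    next
      case False
      then obtain v where v: "v \<in> V" "v \<noteq> 0" using less.prems subspace_0 by blast
      have "compact (V \<inter> sphere 0 1)"
        using less.prems closed_subspace compact_sphere closed_Int_compact by blast
      moreover have "(1 / norm v) *\<^sub>R v \<in> V \<inter> sphere 0 1"
        using v less.prems by (simp add: subspace_scale)
      moreover have "continuous_on (V \<inter> sphere 0 1) (\<lambda>x. (norm (A x))\<^sup>2)"
        using assms(2) by (intro continuous_intros linear_continuous_on linear_linear[THEN iffD1])
          (simp add: linear_conv_bounded_linear)
      ultimately obtain p where p: "p \<in> V" "norm p = 1"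
        and max: "\<And>x. x \<in> V \<Longrightarrow> norm x = 1 \<Longrightarrow> (norm (A x))\<^sup>2 \<le> (norm (A p))\<^sup>2"
        using continuous_attains_sup[of "V \<inter> sphere 0 1" "\<lambda>x. (norm (A x))\<^sup>2"]
        by (metis (no_types, lifting) IntE IntI dist_0_norm emptyE mem_sphere)
      let ?M = "(norm (A p))\<^sup>2"
      have max': "(norm (A x))\<^sup>2 \<le> ?M * (norm x)\<^sup>2" if "x \<in> V" for x
      proof (cases "x = 0")
        case True
        then show ?thesis using assms(2) by (simp add: linear_0)
      next
        case False
        have "(norm (A ((1 / norm x) *\<^sub>R x)))\<^sup>2 \<le> ?M"
          using False that less.prems by (intro max) (simp_all add: subspace_scale)
        then show ?thesis
          using False by (simp add: linear_scale[OF assms(2)] power_divide divide_le_eq)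
      qed
      have ortho: "A p \<bullet> A w = 0" if w: "w \<in> V" "p \<bullet> w = 0" for w
      proof (rule ccontr)
        assume ne: "A p \<bullet> A w \<noteq> 0"
        have ineq: "2 * c * (A p \<bullet> A w) + c\<^sup>2 * (norm (A w))\<^sup>2 \<le> c\<^sup>2 * (?M * (norm w)\<^sup>2)" for c
        proof -
          have "p + c *\<^sub>R w \<in> V" using p w less.prems by (simp add: subspace_add subspace_scale)
          then have "(norm (A (p + c *\<^sub>R w)))\<^sup>2 \<le> ?M * (norm (p + c *\<^sub>R w))\<^sup>2" by (rule max')
          moreover have "(norm (A (p + c *\<^sub>R w)))\<^sup>2 = ?M + 2 * c * (A p \<bullet> A w) + c\<^sup>2 * (norm (A w))\<^sup>2"
            unfolding power2_norm_eq_inner linear_add[OF assms(2)] linear_scale[OF assms(2)]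
            by (simp add: inner_add_left inner_add_right inner_commute power2_eq_square)
          moreover have "(norm (p + c *\<^sub>R w))\<^sup>2 = 1 + c\<^sup>2 * (norm w)\<^sup>2"
            using p w(2) unfolding power2_norm_eq_inner
            by (simp add: inner_add_left inner_add_right inner_commute power2_eq_square norm_eq_1)
          ultimately show ?thesis by (simp add: algebra_simps)
        qed
        \<comment> \<open>Any positive bound for the quadratic coefficient would do. At the step
          \<open>?a / K\<close> the linear gain outweighs the quadratic loss.\<close>
        define K where "K = ?M * (norm w)\<^sup>2 + 1"
        have K: "K > 0" unfolding K_def by (rule add_nonneg_pos) auto
        let ?a = "A p \<bullet> A w"
        have "2 * (?a / K) * ?a \<le> (?a / K)\<^sup>2 * (?M * (norm w)\<^sup>2)"
          by (rule order_trans[OF _ ineq[of "?a / K"]]) simp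
        also have "\<dots> \<le> (?a / K)\<^sup>2 * K" by (intro mult_left_mono) (auto simp: K_def)
        also have "\<dots> = ?a\<^sup>2 / K" using K by (simp add: power2_eq_square)
        finally have "?a\<^sup>2 / K \<le> 0" using K by (simp add: power2_eq_square field_simps)
        then show False using ne K by (simp add: divide_le_0_iff)
      qed
      define W where "W = {w \<in> V. p \<bullet> w = 0}"
      have W: "subspace W"
        using less.prems unfolding W_def subspace_def by (auto simp: inner_add_right)
      have "p \<notin> W" using p by (simp add: W_def norm_eq_1)
      then have "W \<subset> V" using p unfolding W_def by blast
      then have "dim W < dim V"
        using W less.prems by (metis dim_psubset span_eq_iff)
      then obtain ps where ps: "onb W ps"
        "\<forall>i<length ps. \<forall>j<length ps. i \<noteq> j \<longrightarrow> A (ps ! i) \<bullet> A (ps ! j) = 0"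
        using less.hyps W by blast
      have psW: "ps ! i \<in> V" "p \<bullet> ps ! i = 0" if "i < length ps" for i
        using onb_in[OF ps(1) that] by (auto simp: W_def)
      have "span (set (p # ps)) = V"
      proof
        show "span (set (p # ps)) \<subseteq> V"
          using less.prems p psW(1) by (intro span_minimal) (auto simp: in_set_conv_nth)
        show "V \<subseteq> span (set (p # ps))"
        proof
          fix x assume x: "x \<in> V"
          have "x - (p \<bullet> x) *\<^sub>R p \<in> W"
            using x p less.prems unfolding W_def
            by (auto simp: inner_diff_right norm_eq_1 subspace_diff subspace_scale)
          then have "x - (p \<bullet> x) *\<^sub>R p \<in> span (set ps)" using ps(1) by (simp add: onb_def)
          then show "x \<in> span (set (p # ps))" by (auto simp: span_insert)
        qed
      qed
      then have "onb V (p # ps)"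
        using p psW(2) onb_inner[OF ps(1)]
        by (auto simp: onb_def nth_Cons inner_commute norm_eq_1 split: nat.splits)
      moreover have "A p \<bullet> A (ps ! i) = 0" "A (ps ! i) \<bullet> A p = 0" if "i < length ps" for i
        using ortho[OF psW[OF that]] by (simp_all add: inner_commute)
      then have "A ((p # ps) ! i) \<bullet> A ((p # ps) ! j) = 0"
        if "i < length (p # ps)" "j < length (p # ps)" "i \<noteq> j" for i j
        using that ps(2) by (auto simp: nth_Cons split: nat.splits)
      ultimately show ?thesis by blast
    qed
  qed
  then show thesis using that by blast
qed

lemma onb_exists:
  assumes "subspace V"
  obtains ps where "onb V ps"
  using simultaneous_diagonalisation[OF assms linear_id] by blast

text \<open>\<open>A\<close> maps the orthonormal basis \<open>ps\<close> to an orthogonal frame, so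
  the product is the squared volume factor of \<open>A\<close> on \<open>V\<close>, whatever list
  \<open>vs\<close> is measured.\<close>

lemma gram_det_map_eq:
  assumes A: "linear A" and ps: "onb V ps"
    "\<And>i j. i < length ps \<Longrightarrow> j < length ps \<Longrightarrow> i \<noteq> j \<Longrightarrow> A (ps ! i) \<bullet> A (ps ! j) = 0"
    and vs: "set vs \<subseteq> V" "length vs = length ps"
  shows "gram_det (map A vs) = gram_det vs * (\<Prod>i<length ps. (norm (A (ps ! i)))\<^sup>2)"
proof -
  define m where "m i j = vs ! i \<bullet> ps ! j" for i j
  have vsi: "vs ! i = (\<Sum>j<length ps. m i j *\<^sub>R ps ! j)" if "i < length ps" for i
    unfolding m_def using that vs by (intro onb_expansion[OF ps(1)]) auto
  have "A (vs ! i) = (\<Sum>j<length ps. m i j *\<^sub>R map A ps ! j)" if "i < length ps" for i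
    by (subst vsi[OF that]) (simp add: linear_sum[OF A] linear_scale[OF A])
  then have "gram_det (map A vs) = (ndet (length ps) m)\<^sup>2 * gram_det (map A ps)"
    using vs by (intro gram_det_lincomb) auto
  moreover have "gram_det vs = (ndet (length ps) m)\<^sup>2 * gram_det ps"
    using vs vsi by (intro gram_det_lincomb) auto
  moreover have "gram_det (map A ps) = (\<Prod>i<length ps. (norm (A (ps ! i)))\<^sup>2)"
    by (subst gram_det_orthogonal) (auto simp: ps(2))
  moreover have "gram_det ps = 1"
    by (subst gram_det_orthogonal) (auto simp: onb_inner[OF ps(1)] onb_norm[OF ps(1)])
  ultimately show ?thesis by simp
qed

lemma gram_det_nonneg: "gram_det vs \<ge> 0"
  unfolding gram_det_eq_prod_infdist by (intro prod_nonneg) auto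

lemma gram_det_map_ge:
  assumes A: "linear A" and vs: "length vs = dim (span (set vs))"
    and m: "m \<ge> 0" "\<And>x. m * norm x \<le> norm (A x)"
  shows "gram_det (map A vs) \<ge> gram_det vs * m ^ (2 * length vs)"
proof -
  obtain ps where ps: "onb (span (set vs)) ps"
    "\<And>i j. i < length ps \<Longrightarrow> j < length ps \<Longrightarrow> i \<noteq> j \<Longrightarrow> A (ps ! i) \<bullet> A (ps ! j) = 0"
    using simultaneous_diagonalisation[OF subspace_span A] by blast
  have len: "length vs = length ps" using vs onb_length[OF ps(1)] by simp
  have "m ^ (2 * length vs) = (\<Prod>i<length ps. m\<^sup>2)" by (simp add: len power_mult)
  also have "\<dots> \<le> (\<Prod>i<length ps. (norm (A (ps ! i)))\<^sup>2)"
  proof (intro prod_mono conjI power_mono m(1) zero_le_power)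
    fix i assume "i \<in> {..<length ps}"
    then show "m \<le> norm (A (ps ! i))" using m(2)[of "ps ! i"] onb_norm[OF ps(1), of i] by simp
  qed
  finally have "m ^ (2 * length vs) \<le> (\<Prod>i<length ps. (norm (A (ps ! i)))\<^sup>2)" .
  moreover have "gram_det (map A vs) = gram_det vs * (\<Prod>i<length ps. (norm (A (ps ! i)))\<^sup>2)"
    by (rule gram_det_map_eq[OF A ps span_superset len])
  ultimately show ?thesis by (simp add: mult_left_mono gram_det_nonneg)
qed

text \<open>The matrix P with columns \<open>ps\<close> is orthogonal, and the Gram matrix of g P is
  diagonal; its determinant is both (det g)^2 and the volume factor of
  \<open>gram_det_map_eq\<close>.\<close>

lemma gram_det_matrix_mult:
  fixes g :: "real^'n^'n"
  assumes "length vs = CARD('n)"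
  shows "gram_det (map ((*v) g) vs) = (det g)\<^sup>2 * gram_det vs"
proof -
  have A: "linear ((*v) g)" by simp
  obtain ps where ps: "onb (UNIV :: (real^'n) set) ps"
    "\<And>i j. i < length ps \<Longrightarrow> j < length ps \<Longrightarrow> i \<noteq> j \<Longrightarrow> (g *v (ps ! i)) \<bullet> (g *v (ps ! j)) = 0"
    using simultaneous_diagonalisation[OF subspace_UNIV A] by blast
  have len: "length ps = CARD('n)" using onb_length[OF ps(1)] by simp
  obtain b :: "'n \<Rightarrow> nat" where b: "bij_betw b UNIV {..<CARD('n)}"
    using ex_bij_betw_finite_nat[of "UNIV :: 'n set"] by (auto simp: atLeast0LessThan)
  have bl: "b j < length ps" for j using b len by (auto simp: bij_betw_def)
  have bi: "b i = b j \<longleftrightarrow> i = j" for i j using b by (auto simp: bij_betw_def inj_on_def)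
  define P :: "real^'n^'n" where "P = (\<chi> i j. (ps ! b j) $ i)"
  have col: "column j P = ps ! b j" for j by (simp add: P_def column_def vec_eq_iff)
  have PP: "transpose P ** P = mat 1"
    using bl bi by (simp add: vec_eq_iff Finite_Cartesian_Product.mat_def matrix_mult_transpose_dot_column
        col onb_inner[OF ps(1)])
  then have detP: "(det P)\<^sup>2 = 1"
    by (metis det_I det_mul det_transpose power2_eq_square)
  have "column j (g ** P) = g *v (ps ! b j)" for j
    by (simp add: vec_eq_iff column_def matrix_matrix_mult_def matrix_vector_mult_def P_def)
  then have GP: "transpose (g ** P) ** (g ** P)
      = (\<chi> i j. (g *v (ps ! b i)) \<bullet> (g *v (ps ! b j)))"
    by (simp add: matrix_mult_transpose_dot_column)
  have "(det g)\<^sup>2 = det (transpose (g ** P) ** (g ** P))"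
    using detP by (simp add: det_mul det_transpose power2_eq_square)
  also have "\<dots> = (\<Prod>j\<in>UNIV. (norm (g *v (ps ! b j)))\<^sup>2)"
    unfolding GP using ps(2) bl bi
    by (subst det_diagonal) (auto simp: power2_norm_eq_inner)
  also have "\<dots> = (\<Prod>i<length ps. (norm (g *v (ps ! i)))\<^sup>2)"
    unfolding len by (rule prod.reindex_bij_betw[OF b])
  finally show ?thesis
    using gram_det_map_eq[OF A ps, of vs] assms len by simp
qed

section \<open>Diagonal scaling in logarithmic coordinates\<close>

definition scl :: "real^'n \<Rightarrow> real^'n \<Rightarrow> real^'n" where
  "scl t v = (\<chi> i. exp (t $ i) * v $ i)"

lemma scl_nth [simp]: "scl t v $ i = exp (t $ i) * v $ i"
  by (simp add: scl_def)

lemma linear_scl [simp]: "linear (scl t)"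
  by (intro linearI) (simp_all add: vec_eq_iff algebra_simps)

lemma scl_scl: "scl s (scl t v) = scl (s + t) v"
  by (simp add: vec_eq_iff exp_add)

lemma scl_0 [simp]: "scl 0 v = v"
  by (simp add: vec_eq_iff)

lemma inj_scl: "inj (scl t)"
  by (rule inj_on_inverseI[of _ "scl (- t)"]) (simp add: scl_scl)

text \<open>The diagonal of the matrix of the orthogonal projection onto \<open>V\<close>. The
  choice of basis is removed by \<open>onb_sum_squares_unique\<close>.\<close>

definition diagp :: "(real^'n) set \<Rightarrow> real^'n" where
  "diagp V = (\<chi> j. \<Sum>i<length (SOME ps. onb V ps). (((SOME ps. onb V ps) ! i) $ j)\<^sup>2)"

text \<open>\<open>P rs\<close> is the projection of the j-th unit vector: it lies in
  \<open>V\<close> and represents the j-th coordinate on \<open>V\<close>. Two such vectors have the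
  same j-th coordinate because the inner product is symmetric.\<close>

lemma onb_sum_squares_unique:
  fixes V :: "(real^'n) set"
  assumes "onb V ps" "onb V qs"
  shows "(\<Sum>i<length ps. (ps ! i $ j)\<^sup>2) = (\<Sum>i<length qs. (qs ! i $ j)\<^sup>2)"
proof -
  define P where "P rs = (\<Sum>i<length rs. (axis j 1 \<bullet> rs ! i) *\<^sub>R rs ! i)" for rs :: "(real^'n) list"
  have PV: "P rs \<in> V" if "onb V rs" for rs
    using that unfolding P_def onb_def
    by (auto intro!: span_sum span_scale intro: span_base)
  have inner: "P rs \<bullet> v = v $ j" if rs: "onb V rs" and "v \<in> V" for rs v
  proof -
    have "v $ j = axis j 1 \<bullet> (\<Sum>i<length rs. (v \<bullet> rs ! i) *\<^sub>R rs ! i)"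
      by (subst onb_expansion[OF rs \<open>v \<in> V\<close>, symmetric]) (simp add: inner_axis')
    also have "\<dots> = P rs \<bullet> v" by (simp add: P_def inner_sum_left inner_sum_right inner_commute mult.commute)
    finally show ?thesis by simp
  qed
  have sq: "P rs $ j = (\<Sum>i<length rs. (rs ! i $ j)\<^sup>2)" for rs
    by (simp add: P_def inner_axis' power2_eq_square)
  have "P ps $ j = P qs \<bullet> P ps" "P qs $ j = P ps \<bullet> P qs"
    using inner[OF assms(2) PV[OF assms(1)]] inner[OF assms(1) PV[OF assms(2)]] by simp_all
  then show ?thesis by (simp add: sq[symmetric] inner_commute)
qed

lemma diagp_nth:
  assumes "onb V ps"
  shows "diagp V $ j = (\<Sum>i<length ps. (ps ! i $ j)\<^sup>2)"
  unfolding diagp_def vec_lambda_beta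
  by (rule onb_sum_squares_unique[OF someI[of "onb V", OF assms] assms])

lemma sum_diagp:
  assumes "subspace V"
  shows "(\<Sum>j\<in>UNIV. diagp V $ j) = dim V"
proof -
  obtain ps where ps: "onb V ps" using onb_exists[OF assms] .
  have "(\<Sum>j\<in>UNIV. diagp V $ j) = (\<Sum>i<length ps. ps ! i \<bullet> ps ! i)"
    unfolding diagp_nth[OF ps]
    by (subst sum.swap) (simp add: inner_vec_def power2_eq_square)
  also have "\<dots> = dim V" using onb_inner[OF ps] onb_length[OF ps] by simp
  finally show ?thesis .
qed

lemma diagp_nonneg: "diagp V $ j \<ge> 0"
  unfolding diagp_def by (simp add: sum_nonneg)

lemma diagp_UNIV: "diagp (UNIV :: (real^'n) set) $ j = 1"
proof -
  obtain ps where ps: "onb (UNIV :: (real^'n) set) ps" using onb_exists[OF subspace_UNIV] .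
  have "(axis j 1 :: real^'n) = (\<Sum>i<length ps. (axis j 1 \<bullet> ps ! i) *\<^sub>R ps ! i)"
    by (rule onb_expansion[OF ps]) simp
  from arg_cong[OF this, of "\<lambda>x. x $ j"]
  show ?thesis by (simp add: diagp_nth[OF ps] inner_axis' power2_eq_square)
qed

text \<open>For the projection \<open>v\<close> of the j-th unit vector, the squared norm and the
  j-th coordinate are the same number d, whence d^2 \<le> d.\<close>

lemma diagp_le_1:
  assumes "subspace V"
  shows "diagp V $ j \<le> 1"
proof -
  obtain ps where ps: "onb V ps" using onb_exists[OF assms] .
  define v where "v = (\<Sum>i<length ps. (ps ! i $ j) *\<^sub>R ps ! i)"
  have "v \<bullet> v = (\<Sum>i<length ps. \<Sum>l<length ps. (ps ! i $ j) * ((ps ! l $ j) * (ps ! l \<bullet> ps ! i)))"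
    by (simp add: v_def inner_sum_left inner_sum_right sum_distrib_left)
  also have "\<dots> = (\<Sum>i<length ps. \<Sum>l<length ps. if i = l then (ps ! i $ j)\<^sup>2 else 0)"
    using onb_inner[OF ps] by (intro sum.cong) (auto simp: power2_eq_square)
  also have "\<dots> = diagp V $ j" by (simp add: diagp_nth[OF ps])
  finally have "(norm v)\<^sup>2 = diagp V $ j" by (simp add: power2_norm_eq_inner)
  moreover have "v $ j = diagp V $ j" by (simp add: v_def diagp_nth[OF ps] power2_eq_square)
  ultimately have "(diagp V $ j)\<^sup>2 \<le> diagp V $ j"
    using component_le_norm_cart[of v j] by (metis abs_le_square_iff abs_norm_cancel)
  then show ?thesis using mult_le_cancel_left_pos[of "diagp V $ j" "diagp V $ j" 1]
    by (cases "diagp V $ j > 0") (auto simp: power2_eq_square)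
qed

text \<open>Jensen's inequality for exp with the weights \<open>(p $ j)\<^sup>2\<close>, proved by
  summing the tangent line at the weighted mean \<open>m\<close>.\<close>

lemma exp_inner_squares_le:
  assumes "norm p = 1"
  shows "exp (2 * (\<Sum>j\<in>UNIV. (p $ j)\<^sup>2 * t $ j)) \<le> (norm (scl t p))\<^sup>2"
proof -
  define m where "m = 2 * (\<Sum>j\<in>UNIV. (p $ j)\<^sup>2 * t $ j)"
  have one: "(\<Sum>j\<in>UNIV. (p $ j)\<^sup>2) = 1"
    using assms by (simp add: norm_eq_1 inner_vec_def power2_eq_square)
  have "exp m = (\<Sum>j\<in>UNIV. (p $ j)\<^sup>2 * (exp m * (1 + (2 * t $ j - m))))"
  proof -
    have "(\<Sum>j\<in>UNIV. (p $ j)\<^sup>2 * (exp m * (1 + (2 * t $ j - m))))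
        = exp m * ((1 - m) * (\<Sum>j\<in>UNIV. (p $ j)\<^sup>2) + 2 * (\<Sum>j\<in>UNIV. (p $ j)\<^sup>2 * t $ j))"
      by (simp add: sum_distrib_left sum_distrib_right sum.distrib[symmetric] algebra_simps)
    then show ?thesis by (simp add: one m_def)
  qed
  also have "\<dots> \<le> (\<Sum>j\<in>UNIV. (p $ j)\<^sup>2 * exp (2 * t $ j))"
  proof (intro sum_mono mult_left_mono)
    fix j
    have "exp m * (1 + (2 * t $ j - m)) \<le> exp m * exp (2 * t $ j - m)"
      by (intro mult_left_mono exp_ge_add_one_self) auto
    then show "exp m * (1 + (2 * t $ j - m)) \<le> exp (2 * t $ j)" by (simp add: exp_add[symmetric])
  qed auto
  also have "\<dots> = (norm (scl t p))\<^sup>2"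
    unfolding power2_norm_eq_inner inner_vec_def
  proof (intro sum.cong refl)
    fix j
    have "exp (2 * t $ j) = exp (t $ j) * exp (t $ j)" by (metis exp_add mult_2)
    then show "(p $ j)\<^sup>2 * exp (2 * t $ j) = inner (scl t p $ j) (scl t p $ j)"
      by (simp add: power2_eq_square)
  qed
  finally show ?thesis by (simp add: m_def)
qed

text \<open>On an orthonormal basis whose image stays orthogonal the volume factor splits into
  lengths, Jensen bounds each length, and the exponents add up to \<open>diagp\<close>. This is the
  tangent inequality for the log-volume at the origin.\<close>

lemma gram_det_scl_ge:
  assumes "length vs = dim (span (set vs))"
  shows "gram_det (map (scl t) vs) \<ge> gram_det vs * exp (2 * (diagp (span (set vs)) \<bullet> t))"
proof -
  obtain ps where ps: "onb (span (set vs)) ps"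
    "\<And>i j. i < length ps \<Longrightarrow> j < length ps \<Longrightarrow> i \<noteq> j \<Longrightarrow> scl t (ps ! i) \<bullet> scl t (ps ! j) = 0"
    using simultaneous_diagonalisation[OF subspace_span linear_scl] by blast
  have len: "length vs = length ps" using assms onb_length[OF ps(1)] by simp
  have "diagp (span (set vs)) \<bullet> t = (\<Sum>i<length ps. \<Sum>j\<in>UNIV. (ps ! i $ j)\<^sup>2 * t $ j)"
    by (subst sum.swap) (simp add: inner_vec_def diagp_nth[OF ps(1)] sum_distrib_right)
  then have "exp (2 * (diagp (span (set vs)) \<bullet> t))
      = (\<Prod>i<length ps. exp (2 * (\<Sum>j\<in>UNIV. (ps ! i $ j)\<^sup>2 * t $ j)))"
    by (simp add: exp_sum[symmetric] sum_distrib_left)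
  also have "\<dots> \<le> (\<Prod>i<length ps. (norm (scl t (ps ! i)))\<^sup>2)"
    using onb_norm[OF ps(1)] by (intro prod_mono) (auto intro!: exp_inner_squares_le)
  finally have "exp (2 * (diagp (span (set vs)) \<bullet> t)) \<le> (\<Prod>i<length ps. (norm (scl t (ps ! i)))\<^sup>2)" .
  moreover have "gram_det (map (scl t) vs) = gram_det vs * (\<Prod>i<length ps. (norm (scl t (ps ! i)))\<^sup>2)"
    by (rule gram_det_map_eq[OF linear_scl ps span_superset len])
  ultimately show ?thesis by (simp add: mult_left_mono gram_det_nonneg)
qed

section \<open>Discrete subgroups and integral bases\<close>

definition discrete_subgroup :: "(real^'n) set \<Rightarrow> bool" where
  "discrete_subgroup G \<longleftrightarrow> 0 \<in> G \<and> (\<forall>x\<in>G. \<forall>y\<in>G. x - y \<in> G) \<and> (\<forall>r. finite {x\<in>G. norm x \<le> r})"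

context
  fixes G :: "(real^'n) set"
  assumes G: "discrete_subgroup G"
begin

lemma discrete_subgroup_zero: "0 \<in> G"
  using G by (simp add: discrete_subgroup_def)

lemma discrete_subgroup_diff: "x \<in> G \<Longrightarrow> y \<in> G \<Longrightarrow> x - y \<in> G"
  using G by (simp add: discrete_subgroup_def)

lemma discrete_subgroup_finite: "finite {x\<in>G. norm x \<le> r}"
  using G by (simp add: discrete_subgroup_def)

lemma discrete_subgroup_uminus: "x \<in> G \<Longrightarrow> - x \<in> G"
  using discrete_subgroup_diff[OF discrete_subgroup_zero] by force

lemma discrete_subgroup_add: "x \<in> G \<Longrightarrow> y \<in> G \<Longrightarrow> x + y \<in> G"
  using discrete_subgroup_diff[OF _ discrete_subgroup_uminus] by force

lemma discrete_subgroup_of_nat: "x \<in> G \<Longrightarrow> of_nat k *\<^sub>R x \<in> G"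
  by (induction k) (auto simp: scaleR_add_left discrete_subgroup_zero discrete_subgroup_add)

lemma discrete_subgroup_of_int: "x \<in> G \<Longrightarrow> of_int k *\<^sub>R x \<in> G"
  using discrete_subgroup_of_nat[of x] discrete_subgroup_uminus
  by (cases k rule: int_cases2) (auto simp: scaleR_minus_left)

lemma discrete_subgroup_sum: "(\<And>i. i \<in> A \<Longrightarrow> f i \<in> G) \<Longrightarrow> sum f A \<in> G"
  by (induction A rule: infinite_finite_induct) (auto simp: discrete_subgroup_zero discrete_subgroup_add)

lemma discrete_subgroup_Int_subspace: "subspace V \<Longrightarrow> discrete_subgroup (G \<inter> V)"
  unfolding discrete_subgroup_def
  using discrete_subgroup_zero discrete_subgroup_diff
  by (auto simp: subspace_0 subspace_diff intro: finite_subset[OF _ discrete_subgroup_finite])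

text \<open>Dirichlet: the integral vectors \<open>\<Sum>\<lfloor>m \<alpha>\<^sub>i\<rfloor> v\<^sub>i\<close> are bounded, so two of
  them with distant \<open>m\<close> coincide.\<close>

lemma integral_relation:
  assumes vs: "set vs \<subseteq> G" and rel: "(\<Sum>i<length vs. \<alpha> i *\<^sub>R vs ! i) = 0"
    and j: "j < length vs" "\<alpha> j \<noteq> 0"
  obtains c :: "nat \<Rightarrow> int" where "(\<Sum>i<length vs. of_int (c i) *\<^sub>R vs ! i) = 0" "c j \<noteq> 0"
proof -
  define x where "x m = (\<Sum>i<length vs. of_int \<lfloor>real m * \<alpha> i\<rfloor> *\<^sub>R vs ! i)" for m
  have "x m \<in> {x\<in>G. norm x \<le> (\<Sum>i<length vs. norm (vs ! i))}" for m
  proof -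
    have "x m = (\<Sum>i<length vs. of_int \<lfloor>real m * \<alpha> i\<rfloor> *\<^sub>R vs ! i) - real m *\<^sub>R (\<Sum>i<length vs. \<alpha> i *\<^sub>R vs ! i)"
      unfolding x_def rel by simp
    also have "\<dots> = (\<Sum>i<length vs. - frac (real m * \<alpha> i) *\<^sub>R vs ! i)"
      by (simp add: scaleR_sum_right sum_subtractf[symmetric] scaleR_diff_left[symmetric] frac_def)
    finally have "norm (x m) \<le> (\<Sum>i<length vs. norm (- frac (real m * \<alpha> i) *\<^sub>R vs ! i))"
      using norm_sum by metis
    also have "\<dots> \<le> (\<Sum>i<length vs. norm (vs ! i))"
      by (intro sum_mono) (simp add: frac_ge_0 mult_left_le_one_le less_imp_le[OF frac_lt_1])
    finally show ?thesis
      using vs by (auto simp: x_def intro!: discrete_subgroup_sum discrete_subgroup_of_int)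
  qed
  then have "finite (range x)"
    by (intro finite_subset[OF _ discrete_subgroup_finite[of "\<Sum>i<length vs. norm (vs ! i)"]]) auto
  then obtain m0 where inf: "infinite {m. x m = x m0}"
    using pigeonhole_infinite[of UNIV x] by auto
  \<comment> \<open>This distance makes the j-th real coefficients differ by at least 1, so that
    their floors differ.\<close>
  obtain m where m: "x m = x m0" "m \<ge> m0 + nat \<lceil>1 / \<bar>\<alpha> j\<bar>\<rceil>"
    using inf unfolding infinite_nat_iff_unbounded_le by blast
  define c where "c i = \<lfloor>real m * \<alpha> i\<rfloor> - \<lfloor>real m0 * \<alpha> i\<rfloor>" for i
  have "(\<Sum>i<length vs. of_int (c i) *\<^sub>R vs ! i) = x m - x m0"
    by (simp add: c_def x_def scaleR_diff_left sum_subtractf)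
  moreover have "c j \<noteq> 0"
  proof -
    have "real m - real m0 \<ge> 1 / \<bar>\<alpha> j\<bar>" using m(2) by linarith
    then have "\<bar>real m * \<alpha> j - real m0 * \<alpha> j\<bar> \<ge> 1"
      using j(2) by (simp add: left_diff_distrib[symmetric] abs_mult divide_le_eq abs_if split: if_splits)
    then show ?thesis unfolding c_def by linarith
  qed
  ultimately show thesis using m(1) that by simp
qed

end

section \<open>Integral bases of discrete subgroups\<close>

lemma lincomb_in_span: "(\<Sum>i<length us. b i *\<^sub>R us ! i) \<in> span (set us)"
  by (rule span_sum, rule span_scale, rule span_base) simp

lemma is_Zbasis_span: "is_Zbasis G vs \<Longrightarrow> G \<subseteq> span (set vs)"
proof
  fix x assume "is_Zbasis G vs" "x \<in> G"
  then obtain c :: "nat \<Rightarrow> int" where "x = (\<Sum>i<length vs. of_int (c i) *\<^sub>R vs ! i)"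
    unfolding is_Zbasis_def by blast
  then show "x \<in> span (set vs)" using lincomb_in_span[of "\<lambda>i. of_int (c i)" vs] by simp
qed

lemma is_Zbasis_subset:
  assumes "is_Zbasis G vs"
  shows "set vs \<subseteq> G"
proof
  fix v assume "v \<in> set vs"
  then obtain k where k: "k < length vs" "v = vs ! k" by (auto simp: in_set_conv_nth)
  then have "v = (\<Sum>i<length vs. of_int (if i = k then 1 else 0) *\<^sub>R (vs ! i))"
    by (simp add: if_distrib[of "\<lambda>c. c *\<^sub>R _"] if_distrib[of of_int] cong: if_cong)

  then have "\<exists>c :: nat \<Rightarrow> int. v = (\<Sum>i<length vs. of_int (c i) *\<^sub>R (vs ! i))"
    by (intro exI[of _ "\<lambda>i. if i = k then 1 else 0"])
  then show "v \<in> G" using assms unfolding is_Zbasis_def by blast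
qed

lemma is_Zbasis_span_eq: "is_Zbasis G vs \<Longrightarrow> span (set vs) = span G"
  by (intro antisym span_mono span_minimal is_Zbasis_span is_Zbasis_subset subspace_span)

lemma is_Zbasis_length: "is_Zbasis G vs \<Longrightarrow> length vs = dim (span (set vs))"
  unfolding is_Zbasis_def by (simp add: dim_eq_card_independent distinct_card)

lemma is_Zbasis_Nil: "is_Zbasis {0} []"
  by (simp add: is_Zbasis_def independent_empty)

lemma in_span_list_iff: "x \<in> span (set us) \<longleftrightarrow> (\<exists>b. x = (\<Sum>i<length us. b i *\<^sub>R us ! i))"
proof
  assume "x \<in> span (set us)"
  then show "\<exists>b. x = (\<Sum>i<length us. b i *\<^sub>R us ! i)"
  proof (induction rule: span_induct_alt)
    case base
    show ?case by (intro exI[of _ "\<lambda>_. 0"]) simp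
  next
    case (step c x y)
    then obtain b k where bk: "y = (\<Sum>i<length us. b i *\<^sub>R us ! i)" "k < length us" "x = us ! k"
      by (auto simp: in_set_conv_nth)
    have "c *\<^sub>R x + y = (\<Sum>i<length us. (if i = k then c *\<^sub>R us ! i else 0) + b i *\<^sub>R us ! i)"
      using bk by (simp add: sum.distrib)
    also have "\<dots> = (\<Sum>i<length us. (b(k := b k + c)) i *\<^sub>R us ! i)"
      by (intro sum.cong) (auto simp: scaleR_add_left)
    finally show ?case by blast
  qed
next
  assume "\<exists>b. x = (\<Sum>i<length us. b i *\<^sub>R us ! i)"
  then show "x \<in> span (set us)" using lincomb_in_span by blast
qed

text \<open>\<open>v'\<close> is an element of \<open>G\<close> with least positive coordinate along
  \<open>v\<close> modulo the span of \<open>us\<close>. The minimum exists because subtracting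
  integral combinations of \<open>us\<close> brings every candidate into a ball, where
  \<open>G\<close> is finite. Minimality makes all coordinates along \<open>v'\<close>
  integral.\<close>

lemma is_Zbasis_extend_one:
  assumes G: "discrete_subgroup G" and u: "is_Zbasis (G \<inter> span (set us)) us"
    and v: "v \<in> G" "v \<notin> span (set us)"
  obtains v' where "v' \<notin> span (set us)" "is_Zbasis (G \<inter> span (set (us @ [v']))) (us @ [v'])"
proof -
  note [simp] = discrete_subgroup_zero[OF G]
  define S where "S = span (set us)"
  have S: "subspace S" by (simp add: S_def)
  have vS: "v \<notin> S" using v by (simp add: S_def)
  have uG: "set us \<subseteq> G" using is_Zbasis_subset[OF u] by blast
  have uniq: "\<alpha> = \<beta>" if "\<alpha> *\<^sub>R v + y = \<beta> *\<^sub>R v + z" "y \<in> S" "z \<in> S" for \<alpha> \<beta> y z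
  proof (rule ccontr)
    assume ne: "\<alpha> \<noteq> \<beta>"
    have "(\<alpha> - \<beta>) *\<^sub>R v = z - y" using that(1) by (simp add: algebra_simps)
    then have "(\<alpha> - \<beta>) *\<^sub>R v \<in> S" using that S by (simp add: subspace_diff)
    then have "(1 / (\<alpha> - \<beta>)) *\<^sub>R ((\<alpha> - \<beta>) *\<^sub>R v) \<in> S" using S by (rule subspace_scale[rotated])
    then show False using ne vS by simp
  qed
  define A where "A = {\<alpha>. 0 < \<alpha> \<and> \<alpha> \<le> 1 \<and> (\<exists>y\<in>S. \<alpha> *\<^sub>R v + y \<in> G)}"
  define r where "r = norm v + (\<Sum>i<length us. norm (us ! i))"
  \<comment> \<open>By \<open>uniq\<close> the coordinate along \<open>v\<close> is well defined, so
    \<open>SOME\<close> recovers it from the point and \<open>A\<close> lies in the image of a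
    finite set.\<close>
  have "A \<subseteq> (\<lambda>x. SOME \<alpha>. \<exists>y\<in>S. x = \<alpha> *\<^sub>R v + y) ` {x\<in>G. norm x \<le> r}"
  proof
    fix \<alpha> assume "\<alpha> \<in> A"
    then obtain y where y: "0 < \<alpha>" "\<alpha> \<le> 1" "y \<in> S" "\<alpha> *\<^sub>R v + y \<in> G" by (auto simp: A_def)
    then obtain b where b: "y = (\<Sum>i<length us. b i *\<^sub>R us ! i)" by (auto simp: S_def in_span_list_iff)
    define z where "z = (\<Sum>i<length us. of_int \<lfloor>b i\<rfloor> *\<^sub>R us ! i)"
    have zG: "z \<in> G" using uG unfolding z_def
      by (auto intro!: discrete_subgroup_sum[OF G] discrete_subgroup_of_int[OF G])
    have zS: "y - z \<in> S" using y(3) unfolding z_def S_def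
      by (rule span_diff[OF _ lincomb_in_span])
    have "(\<alpha> *\<^sub>R v + y) - z \<in> G" using y(4) zG by (rule discrete_subgroup_diff[OF G])
    then have xG: "\<alpha> *\<^sub>R v + (y - z) \<in> G" by (simp add: algebra_simps)
    have "norm (y - z) \<le> (\<Sum>i<length us. norm (frac (b i) *\<^sub>R us ! i))"
      unfolding b z_def sum_subtractf[symmetric] scaleR_diff_left[symmetric] frac_def[symmetric]
      by (rule norm_sum)
    also have "\<dots> \<le> (\<Sum>i<length us. norm (us ! i))"
      by (intro sum_mono) (simp add: frac_ge_0 mult_left_le_one_le less_imp_le[OF frac_lt_1])
    moreover have "norm (\<alpha> *\<^sub>R v) \<le> norm v" using y by (simp add: mult_left_le_one_le)
    ultimately have "norm (\<alpha> *\<^sub>R v + (y - z)) \<le> r"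
      unfolding r_def by (intro norm_triangle_mono) auto
    moreover have "(SOME \<beta>. \<exists>y'\<in>S. \<alpha> *\<^sub>R v + (y - z) = \<beta> *\<^sub>R v + y') = \<alpha>"
      using uniq zS by (intro some_equality) blast+
    ultimately show "\<alpha> \<in> (\<lambda>x. SOME \<alpha>. \<exists>y\<in>S. x = \<alpha> *\<^sub>R v + y) ` {x\<in>G. norm x \<le> r}"
      using xG by (intro image_eqI[of _ _ "\<alpha> *\<^sub>R v + (y - z)"]) auto
  qed
  then have "finite A" by (rule finite_surj[OF discrete_subgroup_finite[OF G]])
  moreover have "1 \<in> A" using v S by (auto simp: A_def subspace_0 intro!: bexI[of _ 0])
  ultimately have "Min A \<in> A" and Amin: "\<And>\<alpha>. \<alpha> \<in> A \<Longrightarrow> Min A \<le> \<alpha>" by (auto intro: Min_in)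
  then obtain y0 where y0: "0 < Min A" "Min A \<le> 1" "y0 \<in> S" "Min A *\<^sub>R v + y0 \<in> G"
    unfolding A_def by blast
  define v' where "v' = Min A *\<^sub>R v + y0"
  have v'S: "v' \<notin> S"
  proof
    assume "v' \<in> S"
    then have "(1 / Min A) *\<^sub>R (v' - y0) \<in> S" using S y0 by (simp add: subspace_diff subspace_scale)
    then show False using y0 vS by (simp add: v'_def)
  qed
  have span': "span (set (us @ [v'])) = {x. \<exists>k. x - k *\<^sub>R v' \<in> S}"
    unfolding S_def by (simp add: span_insert)
  have "G \<inter> span (set (us @ [v'])) = {(\<Sum>i<length (us @ [v']). of_int (c i) *\<^sub>R ((us @ [v']) ! i)) | c :: nat \<Rightarrow> int. True}"
    (is "_ = ?R")
  proof
    show "?R \<subseteq> G \<inter> span (set (us @ [v']))"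
    proof clarify
      fix c :: "nat \<Rightarrow> int"
      have "(us @ [v']) ! i \<in> G" if "i < length (us @ [v'])" for i
        using that uG y0 by (auto simp: nth_append v'_def)
      then have "(\<Sum>i<length (us @ [v']). of_int (c i) *\<^sub>R ((us @ [v']) ! i)) \<in> G"
        by (intro discrete_subgroup_sum[OF G] discrete_subgroup_of_int[OF G]) blast
      moreover have "(\<Sum>i<length (us @ [v']). of_int (c i) *\<^sub>R ((us @ [v']) ! i)) \<in> span (set (us @ [v']))"
        unfolding in_span_list_iff by (intro exI[of _ "\<lambda>i. of_int (c i)"]) simp
      ultimately show "(\<Sum>i<length (us @ [v']). of_int (c i) *\<^sub>R ((us @ [v']) ! i)) \<in> G \<inter> span (set (us @ [v']))" ..
    qed
    show "G \<inter> span (set (us @ [v'])) \<subseteq> ?R"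
    proof
      fix x assume x: "x \<in> G \<inter> span (set (us @ [v']))"
      then obtain k where k: "x - k *\<^sub>R v' \<in> S" using span' by auto
      define q where "q = \<lfloor>k\<rfloor>"
      have xq: "x - of_int q *\<^sub>R v' \<in> G"
        using x y0(4) by (auto simp: v'_def intro!: discrete_subgroup_diff[OF G] discrete_subgroup_of_int[OF G])
      have eq: "x - of_int q *\<^sub>R v' = (frac k * Min A) *\<^sub>R v + ((x - k *\<^sub>R v') + frac k *\<^sub>R y0)"
        by (simp add: v'_def q_def frac_def algebra_simps)
      have inS: "(x - k *\<^sub>R v') + frac k *\<^sub>R y0 \<in> S"
        using k y0(3) S by (simp add: subspace_add subspace_scale)
      have "frac k = 0"
      proof (rule ccontr)
        assume "frac k \<noteq> 0"
        then have f: "frac k > 0" "frac k < 1" using frac_ge_0[of k] frac_lt_1[of k] by linarith+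
        then have lt: "frac k * Min A < Min A" using y0(1) by simp
        have "0 < frac k * Min A" using f(1) y0(1) by simp
        moreover have "frac k * Min A \<le> 1" using lt y0(2) by linarith
        ultimately have "frac k * Min A \<in> A"
          using xq inS unfolding eq by (subst A_def) blast
        then show False using Amin[of "frac k * Min A"] lt by simp
      qed
      then have "k = of_int q" by (simp add: q_def frac_def)
      then have "x - of_int q *\<^sub>R v' \<in> G \<inter> S" using k xq by simp
      then obtain c :: "nat \<Rightarrow> int" where c: "x - of_int q *\<^sub>R v' = (\<Sum>i<length us. of_int (c i) *\<^sub>R us ! i)"
        using u unfolding is_Zbasis_def S_def by blast
      have "x = (\<Sum>i<length (us @ [v']). of_int ((c(length us := q)) i) *\<^sub>R ((us @ [v']) ! i))"
        using c by (simp add: nth_append algebra_simps)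
      then show "x \<in> ?R" by blast
    qed
  qed
  moreover have "distinct (us @ [v'])"
    using u v'S span_base unfolding is_Zbasis_def S_def by auto
  moreover have "independent (set (us @ [v']))"
    using u v'S unfolding is_Zbasis_def S_def by (simp add: independent_insert)
  ultimately have "is_Zbasis (G \<inter> span (set (us @ [v']))) (us @ [v'])" by (simp add: is_Zbasis_def)
  with v'S show thesis unfolding S_def by (rule that)
qed

lemma is_Zbasis_extend:
  assumes G: "discrete_subgroup G" and "is_Zbasis (G \<inter> span (set us)) us"
  obtains vs where "is_Zbasis G (us @ vs)"
proof -
  have "\<exists>vs. is_Zbasis G (us @ vs)"
    using assms(2)
  proof (induction "CARD('a) - length us" arbitrary: us rule: less_induct)
    case less
    show ?case
    proof (cases "G \<subseteq> span (set us)")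
      case True
      then have "G \<inter> span (set us) = G" by blast
      then show ?thesis using less.prems by (intro exI[of _ "[]"]) simp
    next
      case False
      then obtain v where "v \<in> G" "v \<notin> span (set us)" by blast
      then obtain v' where v': "v' \<notin> span (set us)" "is_Zbasis (G \<inter> span (set (us @ [v']))) (us @ [v'])"
        using is_Zbasis_extend_one[OF G less.prems] by blast
      have "length (us @ [v']) = dim (span (set (us @ [v'])))" by (rule is_Zbasis_length[OF v'(2)])
      also have "\<dots> \<le> CARD('a)" using dim_subset_UNIV_cart by blast
      finally have "CARD('a) - length (us @ [v']) < CARD('a) - length us" by simp
      then show ?thesis using less.hyps[OF _ v'(2)] by auto
    qed
  qed
  then show thesis using that by blast
qed

lemma is_Zbasis_exists:
  assumes "discrete_subgroup G"
  obtains vs where "is_Zbasis G vs"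
proof -
  have "G \<inter> span (set []) = {0}" using discrete_subgroup_zero[OF assms] by auto
  then have "is_Zbasis (G \<inter> span (set [])) []" using is_Zbasis_Nil by simp
  from is_Zbasis_extend[OF assms this] that show thesis by auto
qed

lemma gram_det_pos:
  assumes "distinct vs" "independent (set vs)"
  shows "gram_det vs > 0"
  unfolding gram_det_eq_prod_infdist
proof (rule prod_pos)
  fix i assume "i \<in> {..<length vs}"
  then have i: "i < length vs" by simp
  have "vs ! i \<notin> set (take i vs)"
    using assms(1) i by (auto simp: in_set_conv_nth nth_eq_iff_index_eq)
  then have "set (take i vs) \<subseteq> set vs - {vs ! i}" using set_take_subset by fastforce
  moreover have "vs ! i \<notin> span (set vs - {vs ! i})"
    using assms(2) i by (auto simp: dependent_def)
  ultimately have "vs ! i \<notin> span (set (take i vs))" using span_mono by blast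
  moreover have "closed (span (set (take i vs)))" "span (set (take i vs)) \<noteq> {}"
    using span_zero by (auto intro: closed_span)
  ultimately have "infdist (vs ! i) (span (set (take i vs))) \<noteq> 0"
    using in_closed_iff_infdist_zero by blast
  then show "0 < (infdist (vs ! i) (span (set (take i vs))))\<^sup>2" by simp
qed

text \<open>The quotient of the two Gram determinants is the square of the index of the lattice spanned
  by \<open>ws\<close>.\<close>

lemma gram_det_Zbasis_le:
  assumes u: "is_Zbasis G us" and A: "linear A"
    and ws: "set ws \<subseteq> G" "length ws = length us" "distinct ws" "independent (set ws)"
  shows "gram_det (map A us) \<le> gram_det (map A ws)"
proof -
  have "\<forall>i<length us. \<exists>c :: nat \<Rightarrow> int. ws ! i = (\<Sum>j<length us. of_int (c j) *\<^sub>R us ! j)"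
  proof (intro allI impI)
    fix i assume "i < length us"
    then have "ws ! i \<in> G" using ws(1,2) by auto
    then show "\<exists>c :: nat \<Rightarrow> int. ws ! i = (\<Sum>j<length us. of_int (c j) *\<^sub>R us ! j)"
      using u unfolding is_Zbasis_def by blast
  qed
  then obtain m :: "nat \<Rightarrow> nat \<Rightarrow> int"
    where m: "\<And>i. i < length us \<Longrightarrow> ws ! i = (\<Sum>j<length us. of_int (m i j) *\<^sub>R us ! j)"
    by metis
  have "gram_det ws = (ndet (length us) (\<lambda>i j. of_int (m i j)))\<^sup>2 * gram_det us"
    using m ws(2) by (intro gram_det_lincomb) auto
  then have "ndet (length us) m \<noteq> 0"
    using gram_det_pos[OF ws(3,4)] by (auto simp: ndet_of_int)
  then have "(ndet (length us) m)\<^sup>2 \<ge> 1" by (simp add: int_one_le_iff_zero_less)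
  then have "real_of_int ((ndet (length us) m)\<^sup>2) \<ge> 1" by linarith
  moreover have "map A ws ! i = (\<Sum>j<length us. of_int (m i j) *\<^sub>R map A us ! j)" if "i < length us" for i
    using that ws(2) by (simp add: m linear_sum[OF A] linear_scale[OF A])
  then have "gram_det (map A ws) = (ndet (length us) (\<lambda>i j. of_int (m i j)))\<^sup>2 * gram_det (map A us)"
    using ws(2) by (intro gram_det_lincomb) auto
  ultimately show ?thesis
    using gram_det_nonneg[of "map A us"] mult_right_mono[of 1 "real_of_int ((ndet (length us) m)\<^sup>2)" "gram_det (map A us)"]
    by (simp add: ndet_of_int)
qed

section \<open>Volumes of rational subspaces\<close>

definition rational_subspace :: "(real^'n) set \<Rightarrow> (real^'n) set \<Rightarrow> bool" where
  "rational_subspace L V \<longleftrightarrow> V = span (L \<inter> V)"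

definition Zbas :: "(real^'n) set \<Rightarrow> (real^'n) set \<Rightarrow> (real^'n) list" where
  "Zbas L V = (SOME vs. is_Zbasis (L \<inter> V) vs)"

text \<open>The factor 1/2 appears because \<open>gram_det\<close> is the squared covolume. The
  linear term subtracts the share of a uniform dilation, which leaves \<open>lnvol\<close> invariant
  under constant vectors (\<open>lnvol_shift\<close>).\<close>

definition lnvol :: "(real^'n) set \<Rightarrow> (real^'n) set \<Rightarrow> real^'n \<Rightarrow> real" where
  "lnvol L V t = ln (gram_det (map (scl t) (Zbas L V))) / 2 - dim V / CARD('n) * (\<Sum>j\<in>UNIV. t $ j)"

definition lnvol_grad :: "(real^'n) set \<Rightarrow> real^'n \<Rightarrow> real^'n" where
  "lnvol_grad V s = (\<chi> j. diagp (scl s ` V) $ j - dim V / CARD('n))"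

lemma rational_subspace_subspace: "rational_subspace L V \<Longrightarrow> subspace V"
  unfolding rational_subspace_def by (metis subspace_span)

lemma rational_subspace_span: "S \<subseteq> L \<Longrightarrow> rational_subspace L (span S)"
  unfolding rational_subspace_def
  by (intro antisym span_mono span_minimal subspace_span) (auto intro: span_base)

lemma gram_det_scl_pos:
  assumes "distinct vs" "independent (set vs)"
  shows "gram_det (map (scl t) vs) > 0"
proof -
  have "inj_on (scl t) (span (set vs))" using inj_scl inj_on_subset by blast
  then have "independent (set (map (scl t) vs))"
    using linear_independent_injective_image[OF linear_scl assms(2)] by simp
  moreover have "distinct (map (scl t) vs)"
    using assms(1) inj_scl by (simp add: distinct_map inj_on_subset[OF inj_scl])
  ultimately show ?thesis by (intro gram_det_pos)
qed

lemma scl_image_span: "span (set (map (scl t) vs)) = scl t ` span (set vs)"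
  by (simp add: linear_span_image[OF linear_scl])

lemma dim_scl_image: "dim (scl t ` V) = dim V"
  by (rule dim_image_eq[OF linear_scl]) (use inj_scl inj_on_subset in blast)

lemma norm_lnvol_grad_le:
  fixes V :: "(real^'n) set"
  assumes "subspace V"
  shows "norm (lnvol_grad V s) \<le> CARD('n)"
proof -
  have "norm (lnvol_grad V s) \<le> (\<Sum>j\<in>UNIV. \<bar>lnvol_grad V s $ j\<bar>)" by (rule norm_le_l1_cart)
  also have "\<dots> \<le> (\<Sum>j\<in>(UNIV::'n set). 1)"
  proof (rule sum_mono)
    fix j
    have "subspace (scl s ` V)" using assms by (rule linear_subspace_image[OF linear_scl])
    then have "0 \<le> diagp (scl s ` V) $ j" "diagp (scl s ` V) $ j \<le> 1"
      by (simp_all add: diagp_nonneg diagp_le_1)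
    moreover have "0 \<le> dim V / CARD('n)" "dim V / CARD('n) \<le> 1"
      using dim_subset_UNIV_cart[of V] by (auto simp: divide_le_eq)
    ultimately show "\<bar>lnvol_grad V s $ j\<bar> \<le> 1" unfolding lnvol_grad_def vec_lambda_beta by linarith
  qed
  finally show ?thesis by simp
qed

section \<open>Convexity and submodularity of covolumes\<close>

lemma gram_det_append:
  "gram_det (xs @ ys) = gram_det xs *
    (\<Prod>j<length ys. (infdist (ys ! j) (span (set xs \<union> set (take j ys))))\<^sup>2)"
proof -
  let ?d = "\<lambda>i. (infdist ((xs @ ys) ! i) (span (set (take i (xs @ ys)))))\<^sup>2"
  have "(\<Prod>i<length xs + k. ?d i) = (\<Prod>i<length xs. ?d i) * (\<Prod>j<k. ?d (length xs + j))" for k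
    by (induction k) (auto simp: mult_ac)
  moreover have "(\<Prod>i<length xs. ?d i) = gram_det xs"
    unfolding gram_det_eq_prod_infdist by (intro prod.cong) (auto simp: nth_append)
  ultimately show ?thesis unfolding gram_det_eq_prod_infdist[of "xs @ ys"] by simp
qed

text \<open>Heights shrink over larger spans: adjoining \<open>ys\<close> first can only lower the
  distance of each \<open>zs ! j\<close> from its predecessors.\<close>

lemma gram_det_submodular:
  assumes "gram_det xs > 0"
  shows "gram_det (xs @ ys @ zs) * gram_det xs \<le> gram_det (xs @ ys) * gram_det (xs @ zs)"
proof -
  let ?d = "\<lambda>S j. (infdist (zs ! j) (span (S \<union> set (take j zs))))\<^sup>2"
  have "(\<Prod>j<length zs. ?d (set (xs @ ys)) j) \<le> (\<Prod>j<length zs. ?d (set xs) j)"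
  proof (intro prod_mono conjI power_mono infdist_mono)
    fix j
    show "span (set xs \<union> set (take j zs)) \<subseteq> span (set (xs @ ys) \<union> set (take j zs))"
      by (intro span_mono) auto
    show "span (set xs \<union> set (take j zs)) \<noteq> {}" using span_zero by blast
  qed (auto simp: infdist_nonneg)
  then have "gram_det (xs @ ys) * gram_det xs * (\<Prod>j<length zs. ?d (set (xs @ ys)) j)
     \<le> gram_det (xs @ ys) * gram_det xs * (\<Prod>j<length zs. ?d (set xs) j)"
    by (intro mult_left_mono mult_nonneg_nonneg gram_det_nonneg)
  then show ?thesis
    unfolding append_assoc[symmetric] gram_det_append[of "xs @ ys" zs] gram_det_append[of xs zs]
    by (simp add: mult_ac)
qed

context
  fixes L :: "(real^'n) set"
  assumes L: "discrete_subgroup L"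
begin

lemma is_Zbasis_Zbas:
  assumes "rational_subspace L V"
  shows "is_Zbasis (L \<inter> V) (Zbas L V)"
proof -
  have "discrete_subgroup (L \<inter> V)"
    by (rule discrete_subgroup_Int_subspace[OF L rational_subspace_subspace[OF assms]])
  then obtain vs where "is_Zbasis (L \<inter> V) vs" by (rule is_Zbasis_exists)
  then show ?thesis unfolding Zbas_def by (rule someI)
qed

lemma Zbas:
  assumes "rational_subspace L V"
  shows "span (set (Zbas L V)) = V" "length (Zbas L V) = dim V" "distinct (Zbas L V)"
    "independent (set (Zbas L V))" "set (Zbas L V) \<subseteq> L"
proof -
  note Z = is_Zbasis_Zbas[OF assms]
  show V: "span (set (Zbas L V)) = V"
    using is_Zbasis_span_eq[OF Z] assms by (simp add: rational_subspace_def)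
  show "length (Zbas L V) = dim V" using is_Zbasis_length[OF Z] V by simp
  show "distinct (Zbas L V)" "independent (set (Zbas L V))" "set (Zbas L V) \<subseteq> L"
    using Z is_Zbasis_subset[OF Z] by (auto simp: is_Zbasis_def)
qed

lemma gram_det_Zbas_pos: "rational_subspace L V \<Longrightarrow> gram_det (map (scl t) (Zbas L V)) > 0"
  by (intro gram_det_scl_pos Zbas)

lemma lnvol_eq_Zbasis:
  assumes V: "rational_subspace L V" and vs: "is_Zbasis (L \<inter> V) vs"
  shows "lnvol L V t = ln (gram_det (map (scl t) vs)) / 2 - dim V / CARD('n) * (\<Sum>j\<in>UNIV. t $ j)"
proof -
  note Z = is_Zbasis_Zbas[OF V]
  have "length vs = length (Zbas L V)"
    using is_Zbasis_length[OF vs] is_Zbasis_length[OF Z] is_Zbasis_span_eq[OF vs] is_Zbasis_span_eq[OF Z]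
    by simp
  then have "gram_det (map (scl t) vs) = gram_det (map (scl t) (Zbas L V))"
    using gram_det_Zbasis_le[OF vs linear_scl is_Zbasis_subset[OF Z]]
      gram_det_Zbasis_le[OF Z linear_scl is_Zbasis_subset[OF vs]] vs Z
    by (intro antisym) (auto simp: is_Zbasis_def)
  then show ?thesis by (simp add: lnvol_def)
qed

text \<open>\<open>ws\<close> may generate only a subgroup of finite index in the lattice of its
  span, and passing to such a subgroup does not decrease the covolume.\<close>

lemma lnvol_le:
  assumes ws: "set ws \<subseteq> L" "distinct ws" "independent (set ws)"
  shows "lnvol L (span (set ws)) t
    \<le> ln (gram_det (map (scl t) ws)) / 2 - length ws / CARD('n) * (\<Sum>j\<in>UNIV. t $ j)"
proof -
  let ?V = "span (set ws)"
  have V: "rational_subspace L ?V" using ws(1) by (rule rational_subspace_span)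
  have len: "length ws = dim ?V" using ws by (simp add: dim_eq_card_independent distinct_card)
  have "gram_det (map (scl t) (Zbas L ?V)) \<le> gram_det (map (scl t) ws)"
    using ws len Zbas(2)[OF V] span_superset
    by (intro gram_det_Zbasis_le[OF is_Zbasis_Zbas[OF V] linear_scl]) auto
  then show ?thesis
    using gram_det_Zbas_pos[OF V, of t] by (simp add: lnvol_def len)
qed

text \<open>The tangent inequality \<open>gram_det_scl_ge\<close> holds at the origin; applied to a
  basis already scaled by \<open>scl s\<close> it has its point of tangency at
  \<open>s\<close>.\<close>

lemma lnvol_subgradient:
  assumes V: "rational_subspace L V"
  shows "lnvol L V s - lnvol L V t \<le> lnvol_grad V s \<bullet> (s - t)"
proof -
  let ?vs = "map (scl s) (Zbas L V)" and ?n = "real CARD('n)"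
  have sp: "span (set ?vs) = scl s ` V" unfolding scl_image_span Zbas(1)[OF V] ..
  have "length ?vs = dim (span (set ?vs))"
    unfolding sp dim_scl_image by (simp add: Zbas(2)[OF V])
  from gram_det_scl_ge[OF this, of "t - s"]
  have "gram_det (map (scl t) (Zbas L V))
      \<ge> gram_det ?vs * exp (2 * (diagp (scl s ` V) \<bullet> (t - s)))"
    unfolding sp by (simp add: o_def scl_scl)
  then have "ln (gram_det ?vs * exp (2 * (diagp (scl s ` V) \<bullet> (t - s)))) \<le> ln (gram_det (map (scl t) (Zbas L V)))"
    using gram_det_Zbas_pos[OF V] by (intro ln_mono) auto
  then have "ln (gram_det ?vs) + 2 * (diagp (scl s ` V) \<bullet> (t - s)) \<le> ln (gram_det (map (scl t) (Zbas L V)))"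
    using gram_det_Zbas_pos[OF V, of s] by (simp add: ln_mult)
  moreover have "lnvol_grad V s \<bullet> (s - t) = - (diagp (scl s ` V) \<bullet> (t - s)) - dim V / ?n * ((\<Sum>j\<in>UNIV. s $ j) - (\<Sum>j\<in>UNIV. t $ j))"
    unfolding lnvol_grad_def inner_vec_def
    by (simp add: left_diff_distrib right_diff_distrib sum_subtractf sum_distrib_left sum_negf[symmetric])
  ultimately show ?thesis unfolding lnvol_def by (simp add: right_diff_distrib)
qed

lemma lnvol_lipschitz:
  assumes V: "rational_subspace L V"
  shows "\<bar>lnvol L V s - lnvol L V t\<bar> \<le> CARD('n) * norm (s - t)"
proof -
  have *: "lnvol L V s - lnvol L V t \<le> CARD('n) * norm (s - t)" for s t
  proof -
    have "lnvol L V s - lnvol L V t \<le> norm (lnvol_grad V s) * norm (s - t)"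
      using lnvol_subgradient[OF V, of s t] norm_cauchy_schwarz order_trans by blast
    also have "\<dots> \<le> CARD('n) * norm (s - t)"
      by (intro mult_right_mono norm_lnvol_grad_le rational_subspace_subspace[OF V]) auto
    finally show ?thesis .
  qed
  show ?thesis using *[of s t] *[of t s] by (simp add: abs_le_iff norm_minus_commute)
qed

text \<open>A real relation between the three families would give an integral one, hence an
  element of \<open>L \<inter> V \<inter> W\<close> that is not an integral combination of \<open>us\<close>.\<close>

lemma independent_Zbasis_union:
  assumes V: "rational_subspace L V" and W: "rational_subspace L W"
    and u: "is_Zbasis (L \<inter> V \<inter> W) us"
    and v: "is_Zbasis (L \<inter> V) (us @ vs)" and w: "is_Zbasis (L \<inter> W) (us @ ws)"
  shows "distinct (us @ vs @ ws) \<and> independent (set (us @ vs @ ws))"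
proof -
  let ?xs = "us @ vs @ ws"
  have sV: "subspace V" and sW: "subspace W" using V W rational_subspace_subspace by blast+
  have xsL: "set ?xs \<subseteq> L" using is_Zbasis_subset[OF v] is_Zbasis_subset[OF w] by auto
  have nth0: "\<alpha> j = 0" if rel: "(\<Sum>i<length ?xs. \<alpha> i *\<^sub>R ?xs ! i) = 0" and j: "j < length ?xs" for \<alpha> j
  proof (rule ccontr)
    assume "\<alpha> j \<noteq> 0"
    then obtain c :: "nat \<Rightarrow> int"
      where c: "(\<Sum>i<length ?xs. of_int (c i) *\<^sub>R ?xs ! i) = 0" and cj: "c j \<noteq> 0"
      using integral_relation[OF L xsL rel j] by blast
    let ?a = "length us" and ?b = "length vs" and ?e = "length ws"
    have split: "(\<Sum>i<?a + k. f i) = (\<Sum>i<?a. f i) + (\<Sum>i<k. f (?a + i))" for k and f :: "nat \<Rightarrow> real^'n"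
      by (induction k) (auto simp: add.assoc)
    have split2: "(\<Sum>i<?a + ?b + k. f i) = (\<Sum>i<?a + ?b. f i) + (\<Sum>i<k. f (?a + ?b + i))" for k and f :: "nat \<Rightarrow> real^'n"
      by (induction k) (auto simp: add.assoc)
    define A where "A = (\<Sum>i<?a + ?b. of_int (c i) *\<^sub>R (us @ vs) ! i)"
    define B where "B = (\<Sum>i<?e. of_int (c (?a + ?b + i)) *\<^sub>R ws ! i)"
    have "(\<Sum>i<?a + ?b. of_int (c i) *\<^sub>R ?xs ! i) = A"
      unfolding A_def by (intro sum.cong) (auto simp: nth_append)
    moreover have "(\<Sum>i<?e. of_int (c (?a + ?b + i)) *\<^sub>R ?xs ! (?a + ?b + i)) = B"
      unfolding B_def by (intro sum.cong) (auto simp: nth_append)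
    ultimately have AB: "A + B = 0" using c split2[of "\<lambda>i. of_int (c i) *\<^sub>R ?xs ! i" ?e] by (simp add: add.assoc)
    have "(us @ vs) ! i \<in> V" if "i < ?a + ?b" for i
      using is_Zbasis_subset[OF v] nth_mem[of i "us @ vs"] that by auto
    then have AV: "A \<in> V"
      unfolding A_def using sV by (intro subspace_sum subspace_scale) auto
    have BW: "B \<in> L \<inter> W"
      unfolding B_def using is_Zbasis_subset[OF w] sW
      by (intro IntI subspace_sum subspace_scale discrete_subgroup_sum[OF L] discrete_subgroup_of_int[OF L]) auto
    have "B = - A" using AB by (simp add: eq_neg_iff_add_eq_0 add.commute)
    then have "B \<in> L \<inter> V \<inter> W" using AV BW sV by (simp add: subspace_neg)
    then obtain e :: "nat \<Rightarrow> int" where e: "B = (\<Sum>i<?a. of_int (e i) *\<^sub>R us ! i)"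
      using u unfolding is_Zbasis_def by blast
    have lin0: "\<beta> i = 0" if "distinct zs" "independent (set zs)" "(\<Sum>i<length zs. \<beta> i *\<^sub>R zs ! i) = 0" "i < length zs"
      for \<beta> i and zs :: "(real^'n) list"
    proof -
      have bij: "bij_betw ((!) zs) {..<length zs} (set zs)" using that(1) by (rule bij_betw_nth) auto
      define \<gamma> where "\<gamma> z = \<beta> (the_inv_into {..<length zs} ((!) zs) z)" for z
      have g: "\<gamma> (zs ! i) = \<beta> i" if "i < length zs" for i
        using that bij unfolding \<gamma>_def by (simp add: the_inv_into_f_f bij_betw_def)
      have "(\<Sum>z\<in>set zs. \<gamma> z *\<^sub>R z) = (\<Sum>i<length zs. \<beta> i *\<^sub>R zs ! i)"
        unfolding sum.reindex_bij_betw[OF bij, symmetric] by (intro sum.cong) (auto simp: g)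
      then have "(\<Sum>z\<in>set zs. \<gamma> z *\<^sub>R z) = 0" using that(3) by simp
      then have "\<gamma> (zs ! i) = 0"
        using that(2,4) independentD[OF that(2) finite_set subset_refl] by auto
      then show ?thesis using g that(4) by simp
    qed
    have "(\<Sum>i<length (us @ ws). (if i < ?a then - of_int (e i) else of_int (c (?b + i))) *\<^sub>R (us @ ws) ! i)
       = - (\<Sum>i<?a. of_int (e i) *\<^sub>R us ! i) + B"
      unfolding length_append split B_def sum_negf[symmetric]
      by (intro arg_cong2[where f="(+)"] sum.cong) (auto simp: nth_append ac_simps)
    then have z: "(\<Sum>i<length (us @ ws). (if i < ?a then - of_int (e i) else of_int (c (?b + i))) *\<^sub>R (us @ ws) ! i) = 0"
      using e by simp
    have c_ws: "c (?a + ?b + i) = 0" if "i < ?e" for i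
      using lin0[OF _ _ z, of "?a + i"] w that unfolding is_Zbasis_def by (simp add: ac_simps)
    then have "B = 0" by (simp add: B_def)
    then have "(\<Sum>i<length (us @ vs). of_int (c i) *\<^sub>R (us @ vs) ! i) = 0" using AB by (simp add: A_def)
    from lin0[OF _ _ this] have c_uv: "c i = 0" if "i < ?a + ?b" for i
      using v that unfolding is_Zbasis_def by simp
    have "c j = 0"
      using c_uv[of j] c_ws[of "j - (?a + ?b)"] j by (cases "j < ?a + ?b") auto
    then show False using cj by simp
  qed
  have "distinct ?xs"
    unfolding distinct_conv_nth
  proof (intro allI impI notI)
    fix i j assume ij: "i < length ?xs" "j < length ?xs" "i \<noteq> j" "?xs ! i = ?xs ! j"
    define \<alpha> :: "nat \<Rightarrow> real" where "\<alpha> k = (if k = i then 1 else 0) - (if k = j then 1 else 0)" for k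
    have "(\<Sum>k<length ?xs. \<alpha> k *\<^sub>R ?xs ! k)
       = (\<Sum>k<length ?xs. (if k = i then ?xs ! k else 0) - (if k = j then ?xs ! k else 0))"
      by (intro sum.cong) (auto simp: \<alpha>_def)
    also have "\<dots> = 0" using ij by (simp add: sum_subtractf)
    finally have "\<alpha> i = 0" using ij(1) by (rule nth0)
    then show False using ij(3) by (simp add: \<alpha>_def)
  qed
  moreover have "independent (set ?xs)"
  proof (rule independent_if_scalars_zero)
    fix f x assume f: "(\<Sum>x\<in>set ?xs. f x *\<^sub>R x) = 0" and x: "x \<in> set ?xs"
    have "(\<Sum>i<length ?xs. f (?xs ! i) *\<^sub>R ?xs ! i) = 0"
      using f sum.reindex_bij_betw[OF bij_betw_nth[OF \<open>distinct ?xs\<close> refl refl], of "\<lambda>x. f x *\<^sub>R x"] by simp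
    moreover obtain i where "i < length ?xs" "?xs ! i = x" using x by (metis in_set_conv_nth)
    ultimately show "f x = 0" using nth0[of "\<lambda>i. f (?xs ! i)" i] by simp
  qed simp
  ultimately show ?thesis ..
qed

text \<open>\<open>U\<close> is spanned by L \<inter> V \<inter> W, and \<open>S\<close> by a basis
  of this group extended separately into \<open>V\<close> and into \<open>W\<close>. These vectors
  may generate a proper subgroup of L \<inter> S, which only lowers \<open>lnvol L S t\<close>. The
  inclusions serve to exclude \<open>U = UNIV\<close> and \<open>S = {0}\<close>; the numbers
  \<open>p\<close> and \<open>q\<close> measure how far \<open>V\<close> and \<open>W\<close> are
  from being nested.\<close>

lemma lnvol_submodular:
  assumes V: "rational_subspace L V" and W: "rational_subspace L W"
  obtains U S p q where "rational_subspace L U" "rational_subspace L S" "U \<subseteq> V" "W \<subseteq> S"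
    "dim V = dim U + p" "dim W = dim U + q" "dim S = dim U + p + q"
    "p = 0 \<longrightarrow> V \<subseteq> W" "q = 0 \<longrightarrow> W \<subseteq> V"
    "\<And>t. lnvol L U t + lnvol L S t \<le> lnvol L V t + lnvol L W t"
proof -
  have sV: "subspace V" and sW: "subspace W" using V W rational_subspace_subspace by blast+
  have dV: "discrete_subgroup (L \<inter> V)" and dW: "discrete_subgroup (L \<inter> W)"
    using discrete_subgroup_Int_subspace[OF L] sV sW by blast+
  have "discrete_subgroup (L \<inter> V \<inter> W)" by (rule discrete_subgroup_Int_subspace[OF dV sW])
  then obtain us where u: "is_Zbasis (L \<inter> V \<inter> W) us" by (rule is_Zbasis_exists)
  have uVW: "span (set us) \<subseteq> V" "span (set us) \<subseteq> W"
    using is_Zbasis_subset[OF u] by (intro span_minimal sV sW; blast)+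
  have "L \<inter> V \<inter> span (set us) = L \<inter> V \<inter> W" "L \<inter> W \<inter> span (set us) = L \<inter> V \<inter> W"
    and LU: "L \<inter> span (set us) = L \<inter> V \<inter> W"
    using uVW is_Zbasis_span[OF u] by auto
  then obtain vs ws where v: "is_Zbasis (L \<inter> V) (us @ vs)" and w: "is_Zbasis (L \<inter> W) (us @ ws)"
    using is_Zbasis_extend[OF dV, of us] is_Zbasis_extend[OF dW, of us] u by metis
  define U where "U = span (set us)"
  define S where "S = span (set (us @ vs @ ws))"
  have xs: "distinct (us @ vs @ ws)" "independent (set (us @ vs @ ws))"
    using independent_Zbasis_union[OF V W u v w] by auto
  have usL: "set us \<subseteq> L" "set (us @ vs @ ws) \<subseteq> L"
    using is_Zbasis_subset[OF v] is_Zbasis_subset[OF w] by auto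
  have U: "rational_subspace L U" and S: "rational_subspace L S"
    unfolding U_def S_def by (rule rational_subspace_span[OF usL(1)], rule rational_subspace_span[OF usL(2)])
  have spV: "span (set (us @ vs)) = V" and spW: "span (set (us @ ws)) = W"
    using is_Zbasis_span_eq[OF v] is_Zbasis_span_eq[OF w] V W unfolding rational_subspace_def by auto
  have dims: "dim U = length us" "dim V = length us + length vs" "dim W = length us + length ws"
    "dim S = length us + length vs + length ws"
    using is_Zbasis_length[OF u] is_Zbasis_length[OF v, unfolded spV] is_Zbasis_length[OF w, unfolded spW]
      dim_eq_card_independent[OF xs(2)] distinct_card[OF xs(1)]
    by (simp_all only: U_def S_def length_append dim_span add.assoc)
  have WS: "W \<subseteq> S" unfolding spW[symmetric] S_def by (intro span_mono) auto
  have incl: "length vs = 0 \<longrightarrow> V \<subseteq> W" "length ws = 0 \<longrightarrow> W \<subseteq> V"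
    using spV spW uVW by auto
  have main: "lnvol L U t + lnvol L S t \<le> lnvol L V t + lnvol L W t" for t
  proof -
    let ?g = "\<lambda>xs. gram_det (map (scl t) xs)"
    have pos: "?g us > 0" "?g (us @ vs) > 0" "?g (us @ ws) > 0" "?g (us @ vs @ ws) > 0"
      using u v w xs unfolding is_Zbasis_def by (blast intro: gram_det_scl_pos)+
    have "?g (us @ vs @ ws) * ?g us \<le> ?g (us @ vs) * ?g (us @ ws)"
      using gram_det_submodular[OF pos(1)] by simp
    then have "ln (?g (us @ vs @ ws) * ?g us) \<le> ln (?g (us @ vs) * ?g (us @ ws))"
      using pos by (intro ln_mono) auto
    then have "ln (?g (us @ vs @ ws)) + ln (?g us) \<le> ln (?g (us @ vs)) + ln (?g (us @ ws))"
      using pos by (simp add: ln_mult)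
    moreover have "lnvol L S t \<le> ln (?g (us @ vs @ ws)) / 2 - dim S / CARD('n) * (\<Sum>j\<in>UNIV. t $ j)"
      using lnvol_le[OF usL(2) xs, of t] unfolding S_def[symmetric] dims by (simp add: add.assoc)
    moreover have "lnvol L U t = ln (?g us) / 2 - dim U / CARD('n) * (\<Sum>j\<in>UNIV. t $ j)"
      using u LU unfolding U_def by (intro lnvol_eq_Zbasis) (simp_all add: U[unfolded U_def])
    moreover note lnvol_eq_Zbasis[OF V v, of t] lnvol_eq_Zbasis[OF W w, of t]
    moreover have "real (dim U) + real (dim S) = real (dim V) + real (dim W)" using dims by simp
    then have "dim U / CARD('n) * (\<Sum>j\<in>UNIV. t $ j) + dim S / CARD('n) * (\<Sum>j\<in>UNIV. t $ j)
       = dim V / CARD('n) * (\<Sum>j\<in>UNIV. t $ j) + dim W / CARD('n) * (\<Sum>j\<in>UNIV. t $ j)"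
      unfolding distrib_right[symmetric] add_divide_distrib[symmetric] by simp
    ultimately show ?thesis by linarith
  qed
  show thesis
    by (rule that[of U S "length vs" "length ws"]) (use U S uVW WS dims incl main in \<open>auto simp: U_def[symmetric]\<close>)
qed

end

section \<open>Finiteness of rational subspaces of bounded volume\<close>

text \<open>Column \<open>l\<close> of the orthogonal projection onto \<open>V\<close>. The
  projection matrix determines \<open>V\<close> and has bounded entries, which suits it for counting
  subspaces.\<close>

definition projcol :: "(real^'n) set \<Rightarrow> 'n \<Rightarrow> real^'n" where
  "projcol V l = (\<Sum>i<length (SOME ps. onb V ps). ((SOME ps. onb V ps) ! i $ l) *\<^sub>R (SOME ps. onb V ps) ! i)"

lemma projcol:
  fixes V :: "(real^'n) set"
  assumes "subspace V"
  shows "projcol V l \<in> V" "v \<in> V \<Longrightarrow> projcol V l \<bullet> v = v $ l" "\<bar>projcol V l $ j\<bar> \<le> 1"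
    "span (range (projcol V)) = V"
proof -
  define ps where "ps = (SOME ps. onb V ps)"
  have ps: "onb V ps" unfolding ps_def by (rule someI_ex) (use onb_exists[OF assms] in blast)
  have P: "projcol V l = (\<Sum>i<length ps. (ps ! i $ l) *\<^sub>R ps ! i)" for l
    unfolding projcol_def ps_def ..
  show in_V: "projcol V l \<in> V" for l
    unfolding P using onb_in[OF ps] assms by (intro subspace_sum subspace_scale) auto
  show inner: "projcol V l \<bullet> v = v $ l" if "v \<in> V" for v l
  proof -
    have "v $ l = (\<Sum>i<length ps. (v \<bullet> ps ! i) *\<^sub>R ps ! i) $ l"
      by (subst onb_expansion[OF ps that, symmetric]) simp
    also have "\<dots> = projcol V l \<bullet> v" by (simp add: P inner_sum_right inner_commute mult.commute)
    finally show ?thesis by simp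
  qed
  have "(norm (projcol V l))\<^sup>2 = projcol V l $ l"
    unfolding power2_norm_eq_inner by (rule inner[OF in_V])
  also have "\<dots> = diagp V $ l" by (simp add: P diagp_nth[OF ps] power2_eq_square)
  also have "\<dots> \<le> 1" by (rule diagp_le_1[OF assms])
  finally have "norm (projcol V l) \<le> 1" by (simp add: abs_square_le_1)
  then show "\<bar>projcol V l $ j\<bar> \<le> 1" using component_le_norm_cart order_trans by blast
  show "span (range (projcol V)) = V"
  proof
    show "span (range (projcol V)) \<subseteq> V" using in_V assms by (intro span_minimal) auto
    show "V \<subseteq> span (range (projcol V))"
    proof
      fix v assume v: "v \<in> V"
      define x where "x = (\<Sum>l\<in>UNIV. (v $ l) *\<^sub>R projcol V l)"
      have "x \<in> span (range (projcol V))" unfolding x_def by (intro span_sum span_scale span_base) auto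
      moreover have "x = v"
      proof -
        have xV: "x - v \<in> V" using v in_V assms unfolding x_def
          by (intro subspace_diff subspace_sum subspace_scale) auto
        then have "x \<bullet> (x - v) = v \<bullet> (x - v)"
          unfolding x_def inner_sum_left inner_scaleR_left inner[OF xV[unfolded x_def]]
          by (simp add: inner_vec_def)
        then have "(x - v) \<bullet> (x - v) = 0" by (simp add: inner_diff_left)
        then show ?thesis by simp
      qed
      ultimately show "v \<in> span (range (projcol V))" by simp
    qed
  qed
qed

lemma gram_det_int:
  fixes zs :: "(real^'n) list"
  assumes "set zs \<subseteq> int_vectors"
  obtains z :: "nat \<Rightarrow> 'n \<Rightarrow> int" and G :: "nat \<Rightarrow> nat \<Rightarrow> int"
    where "\<And>i l. i < length zs \<Longrightarrow> zs ! i $ l = of_int (z i l)"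
      "\<And>i j. i < length zs \<Longrightarrow> j < length zs \<Longrightarrow> zs ! i \<bullet> zs ! j = of_int (G i j)"
      "gram_det zs = of_int (ndet (length zs) G)"
proof -
  define z where "z i l = \<lfloor>zs ! i $ l\<rfloor>" for i l
  define G where "G i j = (\<Sum>l\<in>UNIV. z i l * z j l)" for i j
  have z: "zs ! i $ l = of_int (z i l)" if "i < length zs" for i l
  proof -
    have "zs ! i \<in> int_vectors" using assms that by auto
    then have "zs ! i $ l \<in> \<int>" by (simp add: int_vectors_def)
    then show ?thesis by (simp add: z_def)
  qed
  have G: "zs ! i \<bullet> zs ! j = of_int (G i j)" if "i < length zs" "j < length zs" for i j
    by (simp add: inner_vec_def G_def z that)
  have "gram_det zs = ndet (length zs) (\<lambda>i j. of_int (G i j))"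
    unfolding gram_det_eq_ndet by (rule ndet_cong) (rule G)
  then have "gram_det zs = of_int (ndet (length zs) G)" by (simp add: ndet_of_int)
  with z G show thesis by (rule that)
qed

text \<open>By Cramer's rule, \<open>gram_det zs\<close> is a denominator of the orthogonal projection onto the
  span of the integral vectors \<open>zs\<close>.\<close>

lemma gram_det_projcol_int:
  fixes zs :: "(real^'n) list"
  assumes zs: "set zs \<subseteq> int_vectors"
  shows "gram_det zs * projcol (span (set zs)) l $ j \<in> \<int>"
proof -
  let ?k = "length zs" and ?p = "projcol (span (set zs)) l"
  obtain z :: "nat \<Rightarrow> 'n \<Rightarrow> int" and G :: "nat \<Rightarrow> nat \<Rightarrow> int"
    where z: "\<And>i l. i < length zs \<Longrightarrow> zs ! i $ l = of_int (z i l)"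
      and G: "\<And>i j. i < length zs \<Longrightarrow> j < length zs \<Longrightarrow> zs ! i \<bullet> zs ! j = of_int (G i j)"
      and det: "gram_det zs = of_int (ndet (length zs) G)"
    using gram_det_int[OF zs] by metis
  obtain adj :: "nat \<Rightarrow> nat \<Rightarrow> int" where adj: "\<And>i j. i < ?k \<Longrightarrow> j < ?k \<Longrightarrow>
      (\<Sum>a<?k. adj i a * G a j) = (if i = j then ndet ?k G else 0)"
    using ndet_adjugate[of ?k G] by metis
  obtain c where c: "?p = (\<Sum>i<?k. c i *\<^sub>R zs ! i)"
    using projcol(1)[OF subspace_span, of "set zs" l] in_span_list_iff by blast
  have cz: "(\<Sum>i<?k. of_int (G a i) * c i) = of_int (z a l)" if a: "a < ?k" for a
  proof -
    have "zs ! a \<in> span (set zs)" using a by (simp add: span_base)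
    then have "?p \<bullet> zs ! a = zs ! a $ l" by (rule projcol(2)[OF subspace_span])
    also have "?p \<bullet> zs ! a = (\<Sum>i<?k. of_int (G a i) * c i)"
      unfolding c inner_sum_left
      by (intro sum.cong) (auto simp: G[OF a, symmetric] inner_commute)
    finally show ?thesis by (simp add: z a)
  qed
  have Nc: "gram_det zs * c b = of_int (\<Sum>a<?k. adj b a * z a l)" if b: "b < ?k" for b
  proof -
    have "of_int (\<Sum>a<?k. adj b a * z a l) = (\<Sum>a<?k. of_int (adj b a) * (\<Sum>i<?k. of_int (G a i) * c i))"
      by (simp add: cz)
    also have "\<dots> = (\<Sum>i<?k. of_int (\<Sum>a<?k. adj b a * G a i) * c i)"
      unfolding sum_distrib_left of_int_sum sum_distrib_right by (subst sum.swap) (simp add: mult.assoc)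
    also have "\<dots> = (\<Sum>i<?k. if i = b then gram_det zs * c b else 0)"
      using b by (intro sum.cong) (auto simp: adj det)
    also have "\<dots> = gram_det zs * c b" using b by simp
    finally show ?thesis by simp
  qed
  have "gram_det zs * ?p $ j = (\<Sum>i<?k. (gram_det zs * c i) * zs ! i $ j)"
    by (simp add: c sum_distrib_left mult.assoc)
  also have "\<dots> = (\<Sum>i<?k. of_int (\<Sum>a<?k. adj i a * z a l) * of_int (z i j))"
    by (intro sum.cong) (auto simp: Nc z)
  also have "\<dots> = of_int (\<Sum>i<?k. (\<Sum>a<?k. adj i a * z a l) * z i j)" by simp
  finally show ?thesis by (simp only: Ints_of_int)
qed

text \<open>A subspace is determined by its projection matrix. Here the entries are at most 1 in
  absolute value and have the denominator \<open>gram_det zs\<close>, a positive integer bounded by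
  \<open>B\<close>, so finitely many matrices occur.\<close>

lemma finite_bounded_gram_det_spans:
  "finite {V. \<exists>zs :: (real^'n) list. V = span (set zs) \<and> set zs \<subseteq> int_vectors \<and>
     0 < gram_det zs \<and> gram_det zs \<le> B}"
proof -
  define F where "F = {- \<lceil>\<bar>B\<bar>\<rceil>..\<lceil>\<bar>B\<bar>\<rceil>}"
  define \<Phi> :: "int \<times> ('n \<Rightarrow> 'n \<Rightarrow> int) \<Rightarrow> (real^'n) set"
    where "\<Phi> = (\<lambda>(N, M). span (range (\<lambda>l. \<chi> j. of_int (M l j) / of_int N)))"
  let ?D = "F \<times> (PiE (UNIV :: 'n set) (\<lambda>_. PiE (UNIV :: 'n set) (\<lambda>_. F)))"
  have "finite ?D" by (intro finite_cartesian_product finite_PiE) (auto simp: F_def)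
  moreover have "V \<in> \<Phi> ` ?D" if "V = span (set zs)" and zs: "set zs \<subseteq> int_vectors"
    "0 < gram_det zs" "gram_det zs \<le> B" for V and zs :: "(real^'n) list"
  proof -
    obtain z :: "nat \<Rightarrow> 'n \<Rightarrow> int" and G :: "nat \<Rightarrow> nat \<Rightarrow> int"
      where "gram_det zs = of_int (ndet (length zs) G)"
      using gram_det_int[OF zs(1)] by metis
    then obtain N :: int where N: "gram_det zs = of_int N" by blast
    define M where "M l j = \<lfloor>gram_det zs * projcol V l $ j\<rfloor>" for l j
    have M: "of_int (M l j) = of_int N * projcol V l $ j" for l j
      using gram_det_projcol_int[OF zs(1), of l j] unfolding M_def that(1) N[symmetric] by simp
    have NB: "0 < N" "N \<le> \<lceil>\<bar>B\<bar>\<rceil>" using zs N by linarith+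
    have sV: "subspace V" using that(1) by simp
    have MN: "\<bar>M l j\<bar> \<le> N" for l j
    proof -
      have "\<bar>real_of_int (M l j)\<bar> = of_int N * \<bar>projcol V l $ j\<bar>" using NB by (simp add: M abs_mult)
      also have "\<dots> \<le> of_int N" using NB projcol(3)[OF sV, of l j] by (simp add: mult_left_le)
      finally show ?thesis by linarith
    qed
    have "M l j \<in> F" for l j
    proof -
      show ?thesis using MN[of l j] NB unfolding F_def atLeastAtMost_iff by linarith
    qed
    moreover have "N \<in> F" using NB by (simp add: F_def)
    moreover have "\<Phi> (N, M) = V"
    proof -
      have "(\<lambda>l. \<chi> j. of_int (M l j) / of_int N) = projcol V"
        using NB by (auto simp: fun_eq_iff vec_eq_iff M)
      then show ?thesis unfolding \<Phi>_def prod.case by (simp only: projcol(4)[OF sV])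
    qed
    ultimately show ?thesis by (intro image_eqI[of _ _ "(N, M)"]) (auto simp: PiE_def)
  qed
  ultimately show ?thesis by (elim finite_surj) blast
qed

section \<open>Lattices as images of the integral vectors\<close>

definition Zlattice :: "real^'n^'n \<Rightarrow> (real^'n) set" where
  "Zlattice g = (\<lambda>z. g *v z) ` int_vectors"

lemma Zlattice_list_preimage:
  assumes "set vs \<subseteq> Zlattice g"
  obtains zs where "set zs \<subseteq> int_vectors" "map ((*v) g) zs = vs"
proof -
  have "\<forall>x\<in>set vs. \<exists>z. z \<in> int_vectors \<and> x = g *v z" using assms by (auto simp: Zlattice_def)
  then obtain \<zeta> where \<zeta>: "\<And>x. x \<in> set vs \<Longrightarrow> \<zeta> x \<in> int_vectors \<and> x = g *v \<zeta> x" by metis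
  show thesis
  proof
    show "set (map \<zeta> vs) \<subseteq> int_vectors" using \<zeta> by auto
    show "map ((*v) g) (map \<zeta> vs) = vs" unfolding map_map by (rule map_idI) (use \<zeta> in simp)
  qed
qed

lemma finite_bounded_int_vectors: "finite {z :: real^'n. z \<in> int_vectors \<and> norm z \<le> r}"
proof -
  let ?F = "{- \<lceil>\<bar>r\<bar>\<rceil>..\<lceil>\<bar>r\<bar>\<rceil>}"
  let ?D = "PiE (UNIV :: 'n set) (\<lambda>_. ?F)"
  have "finite ?D" by (intro finite_PiE) auto
  moreover have "z \<in> (\<lambda>f. \<chi> j. of_int (f j)) ` ?D" if "z \<in> int_vectors" "norm z \<le> r" for z :: "real^'n"
  proof (rule image_eqI[of _ _ "\<lambda>j. \<lfloor>z $ j\<rfloor>"])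
    show "z = (\<chi> j. of_int \<lfloor>z $ j\<rfloor>)"
      using that(1) by (simp add: int_vectors_def vec_eq_iff)
    have "\<lfloor>z $ j\<rfloor> \<in> ?F" for j
    proof -
      have "\<bar>z $ j\<bar> \<le> r" using component_le_norm_cart[of z j] that(2) by linarith
      then show ?thesis unfolding atLeastAtMost_iff by linarith
    qed
    then show "(\<lambda>j. \<lfloor>z $ j\<rfloor>) \<in> ?D" by (simp add: PiE_def Pi_def)
  qed
  ultimately show ?thesis by (elim finite_surj) blast
qed

lemma linear_lower_bound:
  fixes A :: "real^'n \<Rightarrow> real^'n"
  assumes "linear A" "inj A"
  obtains m where "m > 0" "\<And>x. m * norm x \<le> norm (A x)"
  using linear_inj_bounded_below_pos[OF assms] by (metis mult.commute)

lemma discrete_subgroup_Zlattice: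
  fixes g :: "real^'n^'n"
  assumes "invertible g"
  shows "discrete_subgroup (Zlattice g)"
  unfolding discrete_subgroup_def
proof (intro conjI ballI allI)
  show "0 \<in> Zlattice g" unfolding Zlattice_def
    by (rule image_eqI[of _ _ 0]) (simp_all add: int_vectors_def)
  fix x y assume "x \<in> Zlattice g" "y \<in> Zlattice g"
  then obtain a b where ab: "x = g *v a" "y = g *v b" "a \<in> int_vectors" "b \<in> int_vectors"
    by (auto simp: Zlattice_def)
  have "a - b \<in> int_vectors" using ab by (simp add: int_vectors_def)
  then show "x - y \<in> Zlattice g" unfolding Zlattice_def ab
    by (intro image_eqI[of _ _ "a - b"]) (simp_all add: matrix_vector_mult_diff_distrib)
next
  fix r
  have inj: "inj ((*v) g)" using assms by (simp add: inj_matrix_vector_mult)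
  obtain m where m: "m > 0" "\<And>x. m * norm x \<le> norm (g *v x)"
    using linear_lower_bound[OF matrix_vector_mul_linear inj] by blast
  have "{x \<in> Zlattice g. norm x \<le> r} \<subseteq> (\<lambda>z. g *v z) ` {z. z \<in> int_vectors \<and> norm z \<le> r / m}"
  proof
    fix x assume "x \<in> {x \<in> Zlattice g. norm x \<le> r}"
    then obtain z where z: "x = g *v z" "z \<in> int_vectors" "norm (g *v z) \<le> r" by (auto simp: Zlattice_def)
    have "m * norm z \<le> r" using m(2)[of z] z(3) by linarith
    then have "norm z \<le> r / m" using m(1) by (simp add: field_simps)
    then show "x \<in> (\<lambda>z. g *v z) ` {z. z \<in> int_vectors \<and> norm z \<le> r / m}" using z by blast
  qed
  then show "finite {x \<in> Zlattice g. norm x \<le> r}"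
    using finite_bounded_int_vectors finite_surj by blast
qed

text \<open>Pulling back by \<open>g\<close> makes the bases integral. Since \<open>A\<close>
  shrinks no vector by more than the factor \<open>m\<close>, a bound on \<open>lnvol\<close> at
  \<open>s\<close> bounds the integral Gram determinants.\<close>

lemma finite_lnvol_le:
  fixes g :: "real^'n^'n"
  assumes g: "invertible g"
  shows "finite {V. rational_subspace (Zlattice g) V \<and> lnvol (Zlattice g) V s \<le> H}"
proof -
  let ?L = "Zlattice g"
  note L = discrete_subgroup_Zlattice[OF g]
  define A where "A = scl s \<circ> (*v) g"
  have A: "linear A" unfolding A_def by (intro linear_compose) auto
  have "inj A" unfolding A_def using g inj_scl by (intro inj_compose) (auto simp: inj_matrix_vector_mult)
  then obtain m where m: "m > 0" "\<And>x. m * norm x \<le> norm (A x)" using linear_lower_bound[OF A] by blast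
  define T where "T = \<bar>\<Sum>j\<in>UNIV. s $ j\<bar>"
  \<comment> \<open>With the base capped at 1 the powers decrease, so one constant serves the
    subspaces of all dimensions.\<close>
  define c where "c = (min m 1) ^ (2 * CARD('n))"
  have c: "c > 0" using m by (simp add: c_def)
  define B where "B = exp (2 * (H + T)) / c"
  let ?Z = "{V. \<exists>zs :: (real^'n) list. V = span (set zs) \<and> set zs \<subseteq> int_vectors \<and> 0 < gram_det zs \<and> gram_det zs \<le> B}"
  have "V \<in> (`) ((*v) g) ` ?Z" if V: "rational_subspace ?L V" and H: "lnvol ?L V s \<le> H" for V
  proof -
    obtain zs where zsI: "set zs \<subseteq> int_vectors" and gz: "map ((*v) g) zs = Zbas ?L V"
      using Zlattice_list_preimage[OF Zbas(5)[OF L V]] .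
    have spV: "(*v) g ` span (set zs) = V"
      using linear_span_image[OF matrix_vector_mul_linear, of g "set zs"] Zbas(1)[OF L V]
      unfolding gz[symmetric] set_map by simp
    have len: "length zs = dim V" using arg_cong[OF gz, of length] by (simp add: Zbas(2)[OF L V])
    have "inj_on ((*v) g) (span (span (set zs)))"
      by (rule inj_on_subset[OF inj_matrix_vector_mult[OF g] subset_UNIV])
    from dim_image_eq[OF matrix_vector_mul_linear this]
    have "dim V = dim (span (set zs))" by (simp only: spV)
    then have lendim: "length zs = dim (span (set zs))" using len by simp
    have mapA: "map A zs = map (scl s) (Zbas ?L V)" unfolding gz[symmetric] A_def by simp
    have pos: "gram_det (map A zs) > 0" unfolding mapA by (rule gram_det_Zbas_pos[OF L V])
    have "gram_det (map A zs) \<ge> gram_det zs * (min m 1) ^ (2 * length zs)"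
    proof (rule gram_det_map_ge[OF A lendim])
      show "0 \<le> min m 1" using m by simp
      show "min m 1 * norm x \<le> norm (A x)" for x
        using m(2)[of x] mult_right_mono[of "min m 1" m "norm x"] by simp
    qed
    moreover have "(min m 1) ^ (2 * length zs) \<ge> c"
      unfolding c_def using m dim_subset_UNIV_cart[of V] len by (intro power_decreasing) auto
    ultimately have zc: "gram_det zs * c \<le> gram_det (map A zs)"
      using mult_left_mono[OF _ gram_det_nonneg[of zs]] by (meson order_trans)
    have "dim V / CARD('n) * (\<Sum>j\<in>UNIV. s $ j) \<le> T"
    proof -
      have d: "0 \<le> dim V / CARD('n)" "dim V / CARD('n) \<le> 1"
        using dim_subset_UNIV_cart[of V] by (auto simp: divide_le_eq)
      have "dim V / CARD('n) * (\<Sum>j\<in>UNIV. s $ j) \<le> dim V / CARD('n) * T"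
        unfolding T_def using d by (intro mult_left_mono) auto
      also have "\<dots> \<le> 1 * T" using d by (intro mult_right_mono) (auto simp: T_def)
      finally show ?thesis by simp
    qed
    then have "ln (gram_det (map A zs)) \<le> 2 * (H + T)"
      using H unfolding lnvol_def mapA by simp
    then have "gram_det (map A zs) \<le> exp (2 * (H + T))" using pos by (metis exp_le_cancel_iff exp_ln)
    then have "gram_det zs \<le> B" using zc c by (simp add: B_def pos_le_divide_eq)
    moreover have "gram_det zs > 0"
    proof -
      obtain ps where ps: "onb (span (set zs)) ps"
        "\<And>i j. i < length ps \<Longrightarrow> j < length ps \<Longrightarrow> i \<noteq> j \<Longrightarrow> A (ps ! i) \<bullet> A (ps ! j) = 0"
        using simultaneous_diagonalisation[OF subspace_span A] by blast
      have len_ps: "length zs = length ps" using lendim onb_length[OF ps(1)] by simp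
      have "gram_det (map A zs) = gram_det zs * (\<Prod>i<length ps. (norm (A (ps ! i)))\<^sup>2)"
        by (rule gram_det_map_eq[where V="span (set zs)"])
          (use A ps len_ps span_superset in \<open>simp_all\<close>)
      then show ?thesis using pos gram_det_nonneg[of zs] by (cases "gram_det zs = 0") auto
    qed
    ultimately have "span (set zs) \<in> ?Z" using zsI by blast
    then have "(*v) g ` span (set zs) \<in> (`) ((*v) g) ` ?Z" by (rule imageI)
    then show ?thesis by (simp only: spV)
  qed
  then have "{V. rational_subspace ?L V \<and> lnvol ?L V s \<le> H} \<subseteq> (`) ((*v) g) ` ?Z" by blast
  then show ?thesis by (rule finite_subset) (rule finite_imageI[OF finite_bounded_gram_det_spans[of B]])
qed

section \<open>A covering argument\<close>

context
  fixes I :: "'v set" and w :: "'v \<Rightarrow> 'a::euclidean_space \<Rightarrow> real"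
    and g :: "'v \<Rightarrow> 'a" and h :: "'v \<Rightarrow> real" and s :: 'a and C :: real
  assumes cont: "\<And>V. V \<in> I \<Longrightarrow> continuous_on UNIV (w V)"
    and nonneg: "\<And>V t. V \<in> I \<Longrightarrow> w V t \<ge> 0"
    and cover: "\<And>t. \<exists>V\<in>I. w V t > 0"
    and pair: "\<And>V t. V \<in> I \<Longrightarrow> w V t > 0 \<Longrightarrow> h V \<le> g V \<bullet> (s - t)"
    and fin: "\<And>H. finite {V\<in>I. h V \<le> H}"
    and bound: "\<And>V. V \<in> I \<Longrightarrow> norm (g V) \<le> C"
begin

private abbreviation active :: "'a \<Rightarrow> 'v set" where
  "active t \<equiv> {V\<in>I. w V t > 0}"

text \<open>In the application \<open>g V\<close> is \<open>lnvol_grad V s\<close> and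
  \<open>h V\<close> is \<open>lnvol L V s - c\<close>, both at the fixed base point. Together with
  \<open>fin\<close>, this bound leaves finitely many indices that can be active anywhere on a given
  ball.\<close>

lemma active_le: "V \<in> active t \<Longrightarrow> h V \<le> C * dist t s"
proof -
  assume V: "V \<in> active t"
  then have "h V \<le> g V \<bullet> (s - t)" using pair by blast
  also have "\<dots> \<le> norm (g V) * norm (s - t)" by (rule norm_cauchy_schwarz)
  also have "\<dots> \<le> C * dist t s"
    using V by (intro mult_mono) (auto simp: bound dist_norm norm_minus_commute order_trans[OF norm_ge_zero bound])
  finally show ?thesis .
qed

lemma finite_active: "finite (active t)"
  by (rule finite_subset[OF _ fin[of "C * dist t s"]]) (use active_le in blast)

lemma h_lower_bound: "\<exists>K\<ge>0. \<forall>V\<in>I. h V \<ge> - K"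
proof -
  let ?S = "(\<lambda>V. - h V) ` {V\<in>I. h V \<le> 0}"
  have M: "Max (insert 0 ?S) \<ge> 0" using fin[of 0] by simp
  moreover have "- Max (insert 0 ?S) \<le> h V" if V: "V \<in> I" for V
  proof (cases "h V \<le> 0")
    case True
    then have "- h V \<le> Max (insert 0 ?S)" using V fin[of 0] by (intro Max_ge) auto
    then show ?thesis by simp
  next
    case False
    then show ?thesis using M by linarith
  qed
  ultimately show ?thesis by blast
qed

lemma sum_active_pos: "(\<Sum>V\<in>active t. w V t) > 0"
  using cover[of t] by (intro sum_pos finite_active) auto

text \<open>The vector field \<open>\<epsilon> (\<Sum>w) (t - s) - \<Sum>w g\<close> points outwards on a large sphere
  around \<open>s\<close>, so it has a zero by Brouwer's theorem.\<close>

lemma perturbed_zero_exists: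
  assumes "\<epsilon> > 0"
  obtains t where
    "(\<Sum>V\<in>active t. w V t *\<^sub>R g V) = (\<epsilon> * (\<Sum>V\<in>active t. w V t)) *\<^sub>R (t - s)"
proof -
  obtain K where K: "K \<ge> 0" "\<And>V. V \<in> I \<Longrightarrow> h V \<ge> - K" using h_lower_bound by blast
  \<comment> \<open>On the sphere of radius \<open>r\<close> the outward term
    \<open>\<epsilon> * r\<^sup>2\<close> is \<open>K + 1\<close>, which beats the worst pairing
    \<open>- K\<close> by 1.\<close>
  define r where "r = sqrt ((K + 1) / \<epsilon>)"
  have r: "r > 0" "\<epsilon> * r\<^sup>2 = K + 1" using K assms by (auto simp: r_def)
  \<comment> \<open>A fixed finite index set for the whole ball makes \<open>X\<close> a finite sum
    of continuous functions, whereas \<open>active t\<close> jumps with \<open>t\<close>.\<close>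
  define F where "F = {V\<in>I. h V \<le> \<bar>C\<bar> * r}"
  have F: "finite F" "F \<subseteq> I" using fin by (auto simp: F_def)
  have active_F: "active t \<subseteq> F" if "t \<in> cball s r" for t
  proof
    fix V assume V: "V \<in> active t"
    have "h V \<le> C * dist t s" using active_le V by blast
    also have "\<dots> \<le> \<bar>C\<bar> * r" using that by (intro mult_mono) (auto simp: dist_commute)
    finally show "V \<in> F" using V by (simp add: F_def)
  qed
  define X where "X t = (\<epsilon> * (\<Sum>V\<in>F. w V t)) *\<^sub>R (t - s) - (\<Sum>V\<in>F. w V t *\<^sub>R g V)" for t
  have contX: "continuous_on (cball s r) X"
    unfolding X_def using F
    by (intro continuous_intros continuous_on_subset[OF cont]) auto
  have "\<exists>t\<in>cball s r. X t = 0"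
  proof (rule ccontr)
    assume "\<not> ?thesis"
    then have X0: "X t \<noteq> 0" if "t \<in> cball s r" for t using that by blast
    \<comment> \<open>A fixed point lies on the sphere with \<open>t - s\<close> a negative multiple
      of \<open>X t\<close>, contradicting that \<open>X\<close> points outwards there.\<close>
    define \<phi> where "\<phi> t = s - (r / norm (X t)) *\<^sub>R X t" for t
    have "continuous_on (cball s r) \<phi>"
      unfolding \<phi>_def using X0 by (intro continuous_intros contX) auto
    moreover have "\<phi> ` cball s r \<subseteq> cball s r"
      using X0 r by (auto simp: \<phi>_def dist_norm)
    ultimately obtain t where t: "t \<in> cball s r" "\<phi> t = t"
      using brouwer_ball[of r s \<phi>] r by blast
    have ts: "t - s = - (r / norm (X t)) *\<^sub>R X t"
      using t(2) by (simp add: \<phi>_def algebra_simps)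
    then have "norm (t - s) = r" using X0[OF t(1)] r by simp
    then have nts: "(t - s) \<bullet> (t - s) = r\<^sup>2" by (metis power2_norm_eq_inner)
    have "X t \<bullet> (t - s) = - r * norm (X t)"
      unfolding ts using X0[OF t(1)] by (simp add: power2_norm_eq_inner[symmetric] power2_eq_square)
    then have neg: "X t \<bullet> (t - s) < 0" using X0[OF t(1)] r by simp
    define d where "d = t - s"
    have d: "s - t = - d" "d \<bullet> d = r\<^sup>2" using nts by (simp_all add: d_def)
    have "X t \<bullet> (t - s) = (\<Sum>V\<in>F. w V t * (\<epsilon> * r\<^sup>2 + g V \<bullet> (s - t)))"
      unfolding X_def d d_def[symmetric] inner_diff_left inner_scaleR_left inner_sum_left
      by (simp add: distrib_left right_diff_distrib sum_subtractf sum_distrib_left sum_distrib_right ac_simps)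
    also have "\<dots> \<ge> (\<Sum>V\<in>F. w V t * 1)"
    proof (rule sum_mono)
      fix V assume V: "V \<in> F"
      show "w V t * 1 \<le> w V t * (\<epsilon> * r\<^sup>2 + g V \<bullet> (s - t))"
      proof (cases "w V t > 0")
        case True
        then have "- K \<le> g V \<bullet> (s - t)" using pair K(2) V F(2) by (meson order_trans subsetD)
        then show ?thesis using True r(2) by (intro mult_left_mono) auto
      next
        case False
        then show ?thesis using nonneg[of V t] V F(2) by (auto simp: subset_iff)
      qed
    qed
    moreover have "(\<Sum>V\<in>F. w V t * 1) \<ge> (\<Sum>V\<in>active t. w V t)"
      using active_F[OF t(1)] F nonneg by (auto intro!: sum_mono2)
    ultimately show False using neg sum_active_pos[of t] by linarith
  qed
  then obtain t where t: "t \<in> cball s r" "X t = 0" by blast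
  have "(\<Sum>V\<in>active t. w V t) = (\<Sum>V\<in>F. w V t)"
    using active_F[OF t(1)] F nonneg[of _ t] by (intro sum.mono_neutral_left) (auto simp: order.order_iff_strict)
  moreover have "(\<Sum>V\<in>active t. w V t *\<^sub>R g V) = (\<Sum>V\<in>F. w V t *\<^sub>R g V)"
    using active_F[OF t(1)] F nonneg[of _ t] by (intro sum.mono_neutral_left) (auto simp: order.order_iff_strict)
  ultimately show thesis using t(2) by (intro that[of t]) (simp add: X_def)
qed

text \<open>Normalise the weights at the zero to \<open>u\<close> and pair with
  \<open>s - t\<close>: the mean of \<open>h\<close> is at most - \<epsilon> |t - s|^2. As
  \<open>h\<close> is at least \<open>- K\<close>, this bounds both the mean of
  \<open>h V + K\<close> and the norm \<epsilon> |t - s| of the combination.\<close>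

lemma approximate_zero_exists:
  "\<exists>K. K \<ge> 0 \<and> (\<forall>V\<in>I. h V \<ge> - K) \<and>
    (\<forall>\<epsilon>>0. \<exists>t u. (\<forall>V\<in>active t. u V \<ge> 0) \<and> (\<Sum>V\<in>active t. u V) = 1 \<and>
      (\<Sum>V\<in>active t. u V * (h V + K)) \<le> K \<and> norm (\<Sum>V\<in>active t. u V *\<^sub>R g V) \<le> sqrt (\<epsilon> * K))"
proof -
  obtain K where K: "K \<ge> 0" "\<And>V. V \<in> I \<Longrightarrow> h V \<ge> - K" using h_lower_bound by blast
  have "\<exists>t u. (\<forall>V\<in>active t. u V \<ge> 0) \<and> (\<Sum>V\<in>active t. u V) = 1 \<and>
      (\<Sum>V\<in>active t. u V * (h V + K)) \<le> K \<and> norm (\<Sum>V\<in>active t. u V *\<^sub>R g V) \<le> sqrt (\<epsilon> * K)"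
    if \<epsilon>: "\<epsilon> > 0" for \<epsilon>
  proof -
    obtain t where t: "(\<Sum>V\<in>active t. w V t *\<^sub>R g V) = (\<epsilon> * (\<Sum>V\<in>active t. w V t)) *\<^sub>R (t - s)"
      using perturbed_zero_exists[OF \<epsilon>] by blast
    define W where "W = (\<Sum>V\<in>active t. w V t)"
    have W: "W > 0" unfolding W_def by (rule sum_active_pos)
    define u where "u V = w V t / W" for V
    have u: "u V \<ge> 0" if "V \<in> active t" for V using that W by (simp add: u_def)
    have u1: "(\<Sum>V\<in>active t. u V) = 1"
      using W by (simp add: u_def sum_divide_distrib[symmetric] W_def[symmetric])
    have "(\<Sum>V\<in>active t. u V *\<^sub>R g V) = (1 / W) *\<^sub>R (\<Sum>V\<in>active t. w V t *\<^sub>R g V)"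
      by (simp add: u_def scaleR_sum_right)
    also have "\<dots> = \<epsilon> *\<^sub>R (t - s)" using W by (simp add: t W_def[symmetric])
    finally have ug: "(\<Sum>V\<in>active t. u V *\<^sub>R g V) = \<epsilon> *\<^sub>R (t - s)" .
    have "(\<Sum>V\<in>active t. u V * h V) \<le> (\<Sum>V\<in>active t. u V * (g V \<bullet> (s - t)))"
      using u pair by (intro sum_mono mult_left_mono) auto
    also have "\<dots> = (\<Sum>V\<in>active t. u V *\<^sub>R g V) \<bullet> (s - t)" by (simp add: inner_sum_left)
    also have "\<dots> = - \<epsilon> * (norm (t - s))\<^sup>2"
      unfolding ug power2_norm_eq_inner by (simp add: inner_diff_right algebra_simps)
    finally have uh: "(\<Sum>V\<in>active t. u V * h V) \<le> - \<epsilon> * (norm (t - s))\<^sup>2" .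
    have uhK: "(\<Sum>V\<in>active t. u V * (h V + K)) = (\<Sum>V\<in>active t. u V * h V) + K"
      using u1 by (simp add: distrib_left sum.distrib sum_distrib_right[symmetric])
    have "(\<Sum>V\<in>active t. u V * (h V + K)) \<ge> 0"
    proof (intro sum_nonneg mult_nonneg_nonneg)
      fix V assume V: "V \<in> active t"
      then show "0 \<le> u V" by (rule u)
      show "0 \<le> h V + K" using K(2)[of V] V by simp
    qed
    then have "\<epsilon> * (norm (t - s))\<^sup>2 \<le> K" using uh uhK by linarith
    then have "(norm (\<Sum>V\<in>active t. u V *\<^sub>R g V))\<^sup>2 \<le> \<epsilon> * K"
      unfolding ug using \<epsilon> by (simp add: power_mult_distrib power2_eq_square[of \<epsilon>] mult.assoc)
    then have "norm (\<Sum>V\<in>active t. u V *\<^sub>R g V) \<le> sqrt (\<epsilon> * K)" by (rule real_le_rsqrt)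
    moreover have "(\<Sum>V\<in>active t. u V * (h V + K)) \<le> K"
      using uh uhK mult_nonneg_nonneg[OF less_imp_le[OF \<epsilon>] zero_le_power2[of "norm (t - s)"]] by linarith
    ultimately show ?thesis using u u1 by blast
  qed
  with K show ?thesis by blast
qed

text \<open>Let the perturbation tend to zero.  The indices occurring infinitely often form a finite
  set \<open>\<tau>\<close>; all other active indices have \<open>h\<close> tending to infinity, hence weight tending to zero.\<close>

lemma zero_in_convex_hull_active:
  assumes card: "\<And>t. card (active t) \<le> N"
  obtains t where "0 \<in> convex hull (g ` active t)"
proof -
  obtain K where K': "K \<ge> 0 \<and> (\<forall>V\<in>I. h V \<ge> - K) \<and>
    (\<forall>\<epsilon>>0. \<exists>t u. (\<forall>V\<in>active t. u V \<ge> 0) \<and> (\<Sum>V\<in>active t. u V) = 1 \<and>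
      (\<Sum>V\<in>active t. u V * (h V + K)) \<le> K \<and> norm (\<Sum>V\<in>active t. u V *\<^sub>R g V) \<le> sqrt (\<epsilon> * K))"
    using approximate_zero_exists by (rule exE)
  then have K: "K \<ge> 0" "\<And>V. V \<in> I \<Longrightarrow> h V \<ge> - K" by simp_all
  define Q where "Q m t u \<longleftrightarrow> (\<forall>V\<in>active t. u V \<ge> 0) \<and> (\<Sum>V\<in>active t. u V) = 1 \<and>
      (\<Sum>V\<in>active t. u V * (h V + K)) \<le> K \<and>
      norm (\<Sum>V\<in>active t. u V *\<^sub>R g V) \<le> sqrt (1 / real (Suc m) * K)" for m t u
  have "\<exists>t u. Q m t u" for m
    unfolding Q_def by (rule K'[THEN conjunct2, THEN conjunct2, rule_format]) simp
  then have "\<exists>t u. \<forall>m. Q m (t m) (u m)" by metis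
  then obtain t u where "\<forall>m. Q m (t m) (u m)" by (elim exE)
  then have
      u0: "\<And>m V. V \<in> active (t m) \<Longrightarrow> u m V \<ge> 0"
    and u1: "\<And>m. (\<Sum>V\<in>active (t m). u m V) = 1"
    and uK: "\<And>m. (\<Sum>V\<in>active (t m). u m V * (h V + K)) \<le> K"
    and ug: "\<And>m. norm (\<Sum>V\<in>active (t m). u m V *\<^sub>R g V) \<le> sqrt (1 / real (Suc m) * K)"
    unfolding Q_def by simp_all
  define P where "P \<tau> \<longleftrightarrow> finite \<tau> \<and> infinite {m. \<tau> \<subseteq> active (t m)}" for \<tau>
  have "P {}" by (simp add: P_def)
  moreover have "card \<tau> \<le> N" if "P \<tau>" for \<tau>
  proof -
    have "{m. \<tau> \<subseteq> active (t m)} \<noteq> {}" using that unfolding P_def by (metis (no_types, lifting) finite.emptyI)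
    then obtain m where "\<tau> \<subseteq> active (t m)" by blast
    then show ?thesis using card card_mono[OF finite_active] order_trans by blast
  qed
  \<comment> \<open>A largest set contained in infinitely many active sets. By maximality every
    further index occurs together with it only finitely often.\<close>
  ultimately have "\<exists>\<tau>. P \<tau> \<and> (\<forall>\<tau>'. P \<tau>' \<longrightarrow> card \<tau>' \<le> card \<tau>)"
    by (intro ex_has_greatest_nat[of P "{}" card "Suc N"]) (auto simp: less_Suc_eq_le)
  then obtain \<tau> where "P \<tau>" and max: "\<And>\<tau>'. P \<tau>' \<Longrightarrow> card \<tau>' \<le> card \<tau>" by auto
  then have \<tau>: "finite \<tau>" "infinite {m. \<tau> \<subseteq> active (t m)}" by (simp_all add: P_def)
  let ?M = "{m. \<tau> \<subseteq> active (t m)}"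
  have rare: "finite {m. m \<in> ?M \<and> V \<in> active (t m)}" if "V \<notin> \<tau>" for V
  proof (rule ccontr)
    assume "infinite {m\<in>?M. V \<in> active (t m)}"
    moreover have "{m\<in>?M. V \<in> active (t m)} = {m. insert V \<tau> \<subseteq> active (t m)}" by blast
    ultimately have "P (insert V \<tau>)" unfolding P_def using \<tau>(1) by (simp only: finite_insert simp_thms)
    then show False using max[of "insert V \<tau>"] \<tau> that by simp
  qed
  \<comment> \<open>Of the indices with \<open>h V\<close> at most \<open>j\<close> outside \<tau>
    there are finitely many, each excluded for almost all relevant \<open>m\<close>. The condition
    \<open>m \<ge> j\<close> keeps the perturbation tending to 0 along the subsequence.\<close>
  define Q' where "Q' j m \<longleftrightarrow> \<tau> \<subseteq> active (t m) \<and> m \<ge> j \<and> (\<forall>V\<in>active (t m) - \<tau>. h V > real j)" for j m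
  have "\<exists>m. Q' j m" for j
  proof -
    have "finite (\<Union>V\<in>{V\<in>I. h V \<le> real j} - \<tau>. {m\<in>?M. V \<in> active (t m)})"
      by (rule finite_UN_I[OF finite_Diff[OF fin]]) (use rare in blast)
    then have "infinite (?M - (\<Union>V\<in>{V\<in>I. h V \<le> real j} - \<tau>. {m\<in>?M. V \<in> active (t m)}) - {..<j})"
      using \<tau> by (intro Diff_infinite_finite) auto
    then have "?M - (\<Union>V\<in>{V\<in>I. h V \<le> real j} - \<tau>. {m\<in>?M. V \<in> active (t m)}) - {..<j} \<noteq> {}"
      by (metis (no_types, lifting) finite.emptyI)
    then obtain m where "m \<in> ?M - (\<Union>V\<in>{V\<in>I. h V \<le> real j} - \<tau>. {m\<in>?M. V \<in> active (t m)}) - {..<j}"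
      by blast
    then have "Q' j m" by (auto simp: not_le Q'_def)
    then show ?thesis ..
  qed
  then have "\<exists>m. \<forall>j. Q' j (m j)" by metis
  then obtain m where mM: "\<And>j. \<tau> \<subseteq> active (t (m j))" and mj: "\<And>j. m j \<ge> j"
    and mh: "\<And>j V. V \<in> active (t (m j)) - \<tau> \<Longrightarrow> h V > real j"
    unfolding Q'_def by blast
  define S where "S j = (\<Sum>V\<in>\<tau>. u (m j) V)" for j
  define y where "y j = (\<Sum>V\<in>\<tau>. u (m j) V *\<^sub>R g V)" for j
  define R where "R j = (\<Sum>V\<in>active (t (m j)) - \<tau>. u (m j) V)" for j
  have R0: "R j \<ge> 0" for j unfolding R_def using u0 by (intro sum_nonneg) blast
  have SR: "S j + R j = 1" for j
    unfolding S_def R_def u1[of "m j", symmetric]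
    using sum.subset_diff[OF mM finite_active, of "u (m j)" j] by simp
  \<comment> \<open>Markov's inequality: outside \<tau> the quantity \<open>h V + K\<close> exceeds
    \<open>j\<close>, while its mean is at most \<open>K\<close>.\<close>
  have Rle: "R j \<le> K / real j" if "j > 0" for j
  proof -
    have "R j * real j = (\<Sum>V\<in>active (t (m j)) - \<tau>. u (m j) V * real j)"
      by (simp add: R_def sum_distrib_right)
    also have "\<dots> \<le> (\<Sum>V\<in>active (t (m j)) - \<tau>. u (m j) V * (h V + K))"
    proof (rule sum_mono)
      fix V assume V: "V \<in> active (t (m j)) - \<tau>"
      show "u (m j) V * real j \<le> u (m j) V * (h V + K)"
        using mh[OF V] K(1) u0[of V "m j"] V by (intro mult_left_mono) auto
    qed
    also have "\<dots> \<le> (\<Sum>V\<in>active (t (m j)). u (m j) V * (h V + K))"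
    proof (rule sum_mono2[OF finite_active])
      fix V assume "V \<in> active (t (m j)) - (active (t (m j)) - \<tau>)"
      then show "0 \<le> u (m j) V * (h V + K)"
        using u0[of V "m j"] K(2)[of V] by (intro mult_nonneg_nonneg) auto
    qed auto
    also have "\<dots> \<le> K" by (rule uK)
    finally show ?thesis using that by (simp add: pos_le_divide_eq)
  qed
  have R_lim: "R \<longlonglongrightarrow> 0"
  proof (rule tendsto_sandwich[of "\<lambda>_. 0" R _ "\<lambda>j. K / real j"])
    show "\<forall>\<^sub>F j in sequentially. R j \<le> K / real j"
      using Rle eventually_sequentiallyI[of 1] by force
    show "(\<lambda>j. K / real j) \<longlonglongrightarrow> 0" by (rule lim_const_over_n)
  qed (auto simp: R0)
  have S_lim: "S \<longlonglongrightarrow> 1"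
  proof -
    have "S = (\<lambda>j. 1 - R j)" using SR by (auto simp: algebra_simps)
    then show ?thesis using tendsto_diff[OF tendsto_const[of 1] R_lim] by simp
  qed
  have y_bound: "norm (y j) \<le> sqrt (1 / real (Suc j) * K) + C * R j" for j
  proof -
    have "y j = (\<Sum>V\<in>active (t (m j)). u (m j) V *\<^sub>R g V) - (\<Sum>V\<in>active (t (m j)) - \<tau>. u (m j) V *\<^sub>R g V)"
      unfolding y_def by (simp add: sum.subset_diff[OF mM finite_active, of "\<lambda>V. u (m j) V *\<^sub>R g V" j])
    also have "norm \<dots> \<le> norm (\<Sum>V\<in>active (t (m j)). u (m j) V *\<^sub>R g V)
        + norm (\<Sum>V\<in>active (t (m j)) - \<tau>. u (m j) V *\<^sub>R g V)" by (rule norm_triangle_ineq4)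
    also have "norm (\<Sum>V\<in>active (t (m j)) - \<tau>. u (m j) V *\<^sub>R g V) \<le> (\<Sum>V\<in>active (t (m j)) - \<tau>. C * u (m j) V)"
      using u0[of _ "m j"] bound
      by (intro sum_norm_le) (auto simp: mult.commute[of C] intro!: mult_left_mono)
    also have "\<dots> = C * R j" by (simp add: R_def sum_distrib_left)
    also have "norm (\<Sum>V\<in>active (t (m j)). u (m j) V *\<^sub>R g V) \<le> sqrt (1 / real (Suc (m j)) * K)" by (rule ug)
    also have "\<dots> \<le> sqrt (1 / real (Suc j) * K)"
      using mj[of j] K(1) by (intro real_sqrt_le_mono mult_right_mono) (auto simp: frac_le)
    finally show ?thesis by simp
  qed
  have "y \<longlonglongrightarrow> 0"
  proof (rule Lim_null_comparison)
    show "\<forall>\<^sub>F j in sequentially. norm (y j) \<le> sqrt (1 / real (Suc j) * K) + C * R j"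
      using y_bound by simp
    have "(\<lambda>j. 1 / real (Suc j)) \<longlonglongrightarrow> 0" by (rule LIMSEQ_Suc[OF lim_1_over_n])
    then have "(\<lambda>j. sqrt (1 / real (Suc j) * K) + C * R j) \<longlonglongrightarrow> sqrt (0 * K) + C * 0"
      by (intro tendsto_intros R_lim)
    then show "(\<lambda>j. sqrt (1 / real (Suc j) * K) + C * R j) \<longlonglongrightarrow> 0" by simp
  qed
  then have lim: "(\<lambda>j. (1 / S j) *\<^sub>R y j) \<longlonglongrightarrow> (1 / 1) *\<^sub>R 0"
    by (intro tendsto_intros S_lim) auto
  have "\<forall>\<^sub>F j in sequentially. S j > 0"
    using S_lim by (rule order_tendstoD) simp
  then have "\<forall>\<^sub>F j in sequentially. (1 / S j) *\<^sub>R y j \<in> convex hull (g ` \<tau>)"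
  proof eventually_elim
    case (elim j)
    have "(1 / S j) *\<^sub>R y j = (\<Sum>V\<in>\<tau>. (u (m j) V / S j) *\<^sub>R g V)"
      by (simp add: y_def scaleR_sum_right)
    also have "\<dots> \<in> convex hull (g ` \<tau>)"
    proof (rule convex_sum)
      show "(\<Sum>V\<in>\<tau>. u (m j) V / S j) = 1"
        using elim by (simp add: sum_divide_distrib[symmetric] S_def[symmetric])
      show "\<And>V. V \<in> \<tau> \<Longrightarrow> 0 \<le> u (m j) V / S j" using u0 mM elim by (force intro!: divide_nonneg_pos)
    qed (use \<tau> in \<open>auto intro: hull_inc\<close>)
    finally show ?case .
  qed
  moreover have "closed (convex hull (g ` \<tau>))"
    using \<tau> by (intro compact_imp_closed finite_imp_compact_convex_hull) auto
  ultimately have "0 \<in> convex hull (g ` \<tau>)"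
    using lim by (intro Lim_in_closed_set[of "convex hull (g ` \<tau>)" _ sequentially]) auto
  moreover have "convex hull (g ` \<tau>) \<subseteq> convex hull (g ` active (t (m 0)))"
    using mM by (intro hull_mono image_mono)
  ultimately show thesis using that by blast
qed

end

section \<open>Rational functions on the half line\<close>

text \<open>The half line is closed because the degenerate configuration is the value at 0: if it is
  nonzero there, the numerator is not the zero polynomial.\<close>

definition ratfun :: "(real \<Rightarrow> real) \<Rightarrow> bool" where
  "ratfun F \<longleftrightarrow> (\<exists>p q. \<forall>y\<ge>0. poly q y \<noteq> 0 \<and> F y = poly p y / poly q y)"

lemma ratfun_const: "ratfun (\<lambda>_. c)"
  unfolding ratfun_def by (intro exI[of _ "[:c:]"] exI[of _ 1]) simp

lemma ratfun_power: "ratfun (\<lambda>y. y ^ k)"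
  unfolding ratfun_def by (intro exI[of _ "monom 1 k"] exI[of _ 1]) (simp add: poly_monom)

lemma ratfun_add:
  assumes "ratfun F" "ratfun G"
  shows "ratfun (\<lambda>y. F y + G y)"
proof -
  obtain p q where 1: "\<forall>y\<ge>0. poly q y \<noteq> 0 \<and> F y = poly p y / poly q y" using assms(1) unfolding ratfun_def by blast
  obtain r s where 2: "\<forall>y\<ge>0. poly s y \<noteq> 0 \<and> G y = poly r y / poly s y" using assms(2) unfolding ratfun_def by blast
  have "poly (q * s) y \<noteq> 0 \<and> F y + G y = poly (p * s + r * q) y / poly (q * s) y" if "y \<ge> 0" for y
    using 1[rule_format, OF that] 2[rule_format, OF that] by (simp add: add_frac_eq)
  then show ?thesis unfolding ratfun_def by blast
qed

lemma ratfun_mult: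
  assumes "ratfun F" "ratfun G"
  shows "ratfun (\<lambda>y. F y * G y)"
proof -
  obtain p q where 1: "\<forall>y\<ge>0. poly q y \<noteq> 0 \<and> F y = poly p y / poly q y" using assms(1) unfolding ratfun_def by blast
  obtain r s where 2: "\<forall>y\<ge>0. poly s y \<noteq> 0 \<and> G y = poly r y / poly s y" using assms(2) unfolding ratfun_def by blast
  have "poly (q * s) y \<noteq> 0 \<and> F y * G y = poly (p * r) y / poly (q * s) y" if "y \<ge> 0" for y
    using 1[rule_format, OF that] 2[rule_format, OF that] by simp
  then show ?thesis unfolding ratfun_def by blast
qed

lemma ratfun_divide:
  assumes "ratfun F" "ratfun G" "\<And>y. y \<ge> 0 \<Longrightarrow> G y \<noteq> 0"
  shows "ratfun (\<lambda>y. F y / G y)"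
proof -
  obtain p q where 1: "\<forall>y\<ge>0. poly q y \<noteq> 0 \<and> F y = poly p y / poly q y" using assms(1) unfolding ratfun_def by blast
  obtain r s where 2: "\<forall>y\<ge>0. poly s y \<noteq> 0 \<and> G y = poly r y / poly s y" using assms(2) unfolding ratfun_def by blast
  have "poly (q * r) y \<noteq> 0 \<and> F y / G y = poly (p * s) y / poly (q * r) y" if "y \<ge> 0" for y
    using 1[rule_format, OF that] 2[rule_format, OF that] assms(3)[OF that] by auto
  then show ?thesis unfolding ratfun_def by blast
qed

lemma ratfun_uminus: "ratfun F \<Longrightarrow> ratfun (\<lambda>y. - F y)"
  using ratfun_mult[OF ratfun_const[of "-1"]] by simp

lemma ratfun_diff: "ratfun F \<Longrightarrow> ratfun G \<Longrightarrow> ratfun (\<lambda>y. F y - G y)"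
  using ratfun_add[OF _ ratfun_uminus] by simp

lemma ratfun_sum: "(\<And>i. i \<in> A \<Longrightarrow> ratfun (F i)) \<Longrightarrow> ratfun (\<lambda>y. \<Sum>i\<in>A. F i y)"
  by (induction A rule: infinite_finite_induct) (auto intro: ratfun_const ratfun_add)

lemma ratfun_prod: "(\<And>i. i \<in> A \<Longrightarrow> ratfun (F i)) \<Longrightarrow> ratfun (\<lambda>y. \<Prod>i\<in>A. F i y)"
  by (induction A rule: infinite_finite_induct) (auto intro: ratfun_const ratfun_mult)

lemma ratfun_det:
  fixes M :: "real \<Rightarrow> real^'n^'n"
  assumes "\<And>a j. ratfun (\<lambda>y. M y $ a $ j)"
  shows "ratfun (\<lambda>y. det (M y))"
  unfolding det_def by (intro ratfun_sum ratfun_mult ratfun_const ratfun_prod assms)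

lemma ratfun_finite_zeros:
  assumes "ratfun F" "F 0 \<noteq> 0"
  shows "finite {y. y > 0 \<and> F y = 0}"
proof -
  obtain p q where pq: "\<forall>y\<ge>0. poly q y \<noteq> 0 \<and> F y = poly p y / poly q y"
    using assms(1) unfolding ratfun_def by blast
  then have "poly p 0 \<noteq> 0" using assms(2) by fastforce
  then have "p \<noteq> 0" by auto
  then have "finite {y. poly p y = 0}" by (rule poly_roots_finite)
  moreover have "{y. y > 0 \<and> F y = 0} \<subseteq> {y. poly p y = 0}" using pq by auto
  ultimately show ?thesis by (rule finite_subset[rotated])
qed

section \<open>Generic diagonal elements\<close>

definition echelon :: "('n \<Rightarrow> nat) \<Rightarrow> ('n \<Rightarrow> real^'n) \<Rightarrow> bool" where
  "echelon \<rho> c \<longleftrightarrow> (\<forall>j. c j $ j = 1 \<and> (\<forall>l. \<rho> l > \<rho> j \<longrightarrow> c j $ l = 0))"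

text \<open>The pivots of an echelon form of \<open>V\<close>, a pivot being the last nonzero
  position in the order \<open>\<rho>\<close>. They index the coordinate subspace to which
  \<open>flow\<close> degenerates \<open>V\<close>.\<close>

definition leads :: "('n \<Rightarrow> nat) \<Rightarrow> (real^'n) set \<Rightarrow> 'n set" where
  "leads \<rho> V = {j. \<exists>v\<in>V. v $ j \<noteq> 0 \<and> (\<forall>l. \<rho> l > \<rho> j \<longrightarrow> v $ l = 0)}"

context
  fixes \<rho> :: "'n::finite \<Rightarrow> nat"
  assumes \<rho>: "bij_betw \<rho> UNIV {..<CARD('n)}"
begin

lemma rho_inj: "\<rho> j = \<rho> l \<longleftrightarrow> j = l"
  using \<rho> by (auto simp: bij_betw_def inj_on_def)

lemma rho_less: "\<rho> j < CARD('n)"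
  using \<rho> by (auto simp: bij_betw_def)

text \<open>Gaussian elimination from the highest position downwards.\<close>

lemma echelon_span:
  assumes c: "echelon \<rho> c" and V: "subspace V" "\<And>j. j \<in> leads \<rho> V \<Longrightarrow> c j \<in> V"
  shows "span (c ` leads \<rho> V) = V"
proof
  show "span (c ` leads \<rho> V) \<subseteq> V" using V by (intro span_minimal) auto
  have *: "v \<in> span (c ` leads \<rho> V)" if "v \<in> V" "\<forall>l. \<rho> l \<ge> k \<longrightarrow> v $ l = 0" for k v
    using that
  proof (induction k arbitrary: v)
    case 0
    then have "v = 0" by (simp add: vec_eq_iff)
    then show ?case by (simp add: span_zero)
  next
    case (Suc k)
    show ?case
    proof (cases "\<exists>j. \<rho> j = k \<and> v $ j \<noteq> 0")
      case False
      then have "\<forall>l. \<rho> l \<ge> k \<longrightarrow> v $ l = 0"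
        using Suc.prems(2) by (metis Suc_leI le_neq_implies_less)
      then show ?thesis using Suc.IH Suc.prems(1) by blast
    next
      case True
      then obtain j where j: "\<rho> j = k" "v $ j \<noteq> 0" by blast
      have lead: "j \<in> leads \<rho> V" using Suc.prems j by (auto simp: leads_def)
      let ?w = "v - (v $ j) *\<^sub>R c j"
      have "?w \<in> V" using V lead Suc.prems(1) by (simp add: subspace_diff subspace_scale)
      moreover have "\<forall>l. \<rho> l \<ge> k \<longrightarrow> ?w $ l = 0"
      proof (intro allI impI)
        fix l assume l: "\<rho> l \<ge> k"
        show "?w $ l = 0"
        proof (cases "\<rho> l = k")
          case True
          then have "l = j" using j(1) rho_inj by metis
          then show ?thesis using c by (simp add: echelon_def)
        next
          case False
          then show ?thesis using l j(1) c Suc.prems(2) by (simp add: echelon_def)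
        qed
      qed
      ultimately have "?w \<in> span (c ` leads \<rho> V)" by (rule Suc.IH)
      moreover have "(v $ j) *\<^sub>R c j \<in> span (c ` leads \<rho> V)" using lead by (intro span_scale span_base) auto
      ultimately have "?w + (v $ j) *\<^sub>R c j \<in> span (c ` leads \<rho> V)" by (rule span_add)
      then show ?thesis by simp
    qed
  qed
  show "V \<subseteq> span (c ` leads \<rho> V)"
  proof
    fix v assume "v \<in> V"
    then show "v \<in> span (c ` leads \<rho> V)" by (rule *[of _ "CARD('n)"]) (use rho_less in \<open>simp add: not_le[symmetric]\<close>)
  qed
qed

lemma echelon_independent:
  assumes c: "echelon \<rho> c"
  shows "inj c" "independent (range c)"
proof -
  have "leads \<rho> (UNIV :: (real^'n) set) = UNIV"
    unfolding leads_def using c by (auto simp: echelon_def intro!: exI[of _ "c _"])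
  then have sp: "span (range c) = UNIV" using echelon_span[OF c subspace_UNIV] by simp
  have le: "card (range c) \<le> CARD('n)" by (simp add: card_image_le)
  then show "independent (range c)"
    by (intro card_le_dim_spanning[of _ UNIV]) (auto simp: sp)
  have "CARD('n) \<le> card (range c)" using dim_le_card[of UNIV "range c"] sp by simp
  then show "inj c" using le by (intro eq_card_imp_inj_on) auto
qed

text \<open>A rescaling of \<open>scl (flow y) (c j)\<close> for positive \<open>y\<close> that
  keeps the pivot at 1. Its entries are polynomials in \<open>y\<close> and hence extend to 0, where
  only the pivot survives.\<close>

definition deform :: "('n \<Rightarrow> real^'n) \<Rightarrow> real \<Rightarrow> 'n \<Rightarrow> real^'n" where
  "deform c y j = (\<chi> l. if \<rho> l \<le> \<rho> j then c j $ l * y ^ (\<rho> j - \<rho> l) else 0)"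

definition flow :: "real \<Rightarrow> real^'n" where
  "flow y = (\<chi> j. - real (\<rho> j) * ln y)"

lemma echelon_deform: "echelon \<rho> c \<Longrightarrow> echelon \<rho> (deform c y)"
  by (simp add: echelon_def deform_def)

lemma deform_eq:
  assumes "echelon \<rho> c" "y > 0"
  shows "deform c y j = (y ^ \<rho> j) *\<^sub>R scl (flow y) (c j)"
proof -
  have "y ^ (\<rho> j - \<rho> l) = y ^ \<rho> j * exp (- real (\<rho> l) * ln y)" if "\<rho> l \<le> \<rho> j" for l
    using assms(2) that
    by (simp add: power_diff exp_minus exp_of_nat_mult divide_inverse)
  then show ?thesis
    using assms(1) by (auto simp: vec_eq_iff deform_def flow_def echelon_def not_le)
qed

lemma deform_0: "echelon \<rho> c \<Longrightarrow> deform c 0 j = axis j 1"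
  using rho_inj
  by (auto simp: vec_eq_iff deform_def echelon_def axis_def power_0_left)

lemma span_deform:
  assumes c: "echelon \<rho> c" and y: "y > 0"
  shows "span (deform c y ` J) = scl (flow y) ` span (c ` J)"
proof -
  have "span (deform c y ` J) = span ((\<lambda>j. scl (flow y) (c j)) ` J)"
  proof (intro antisym span_minimal subspace_span image_subsetI)
    fix j assume j: "j \<in> J"
    show "deform c y j \<in> span ((\<lambda>j. scl (flow y) (c j)) ` J)"
      unfolding deform_eq[OF assms] using j by (intro span_scale span_base) auto
    have "(1 / y ^ \<rho> j) *\<^sub>R deform c y j \<in> span (deform c y ` J)" using j by (intro span_scale span_base) auto
    then show "scl (flow y) (c j) \<in> span (deform c y ` J)"
      using y by (simp add: deform_eq[OF assms])
  qed
  also have "\<dots> = scl (flow y) ` span (c ` J)"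
    unfolding linear_span_image[OF linear_scl, symmetric] image_image ..
  finally show ?thesis .
qed

text \<open>For each pivot \<open>j\<close> the vector is taken from the smallest member of the
  chain with that pivot. It then lies in all larger members, so one basis is adapted to the whole
  chain.\<close>

lemma chain_echelon_exists:
  fixes \<tau> :: "(real^'n) set set"
  assumes "finite \<tau>" "\<And>V W. V \<in> \<tau> \<Longrightarrow> W \<in> \<tau> \<Longrightarrow> V \<subseteq> W \<or> W \<subseteq> V" "\<And>V. V \<in> \<tau> \<Longrightarrow> subspace V"
  obtains c where "echelon \<rho> c" "\<And>V j. V \<in> \<tau> \<Longrightarrow> j \<in> leads \<rho> V \<Longrightarrow> c j \<in> V"
proof -
  have "\<exists>x. x $ j = 1 \<and> (\<forall>l. \<rho> l > \<rho> j \<longrightarrow> x $ l = 0) \<and> (\<forall>V\<in>\<tau>. j \<in> leads \<rho> V \<longrightarrow> x \<in> V)" for j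
  proof (cases "\<exists>V\<in>\<tau>. j \<in> leads \<rho> V")
    case False
    then show ?thesis by (intro exI[of _ "axis j 1"]) (auto simp: axis_def)
  next
    case True
    let ?T = "{V\<in>\<tau>. j \<in> leads \<rho> V}"
    obtain V0 where "V0 \<in> ?T" using True by blast
    then obtain W where W: "W \<in> ?T" "\<And>V. V \<in> ?T \<Longrightarrow> dim W \<le> dim V"
      using ex_has_least_nat[of "\<lambda>V. V \<in> ?T" V0 dim] by blast
    have WV: "W \<subseteq> V" if "V \<in> ?T" for V
    proof (cases "W \<subseteq> V")
      case False
      then have "V \<subseteq> W" using assms(2) W(1) that by blast
      then have "V = W" using W assms(3) that by (intro subspace_dim_equal) auto
      then show ?thesis by simp
    qed
    obtain v where v: "v \<in> W" "v $ j \<noteq> 0" "\<And>l. \<rho> l > \<rho> j \<Longrightarrow> v $ l = 0" using W(1) by (auto simp: leads_def)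
    have "(1 / v $ j) *\<^sub>R v \<in> W" using v(1) W(1) assms(3) by (simp add: subspace_scale)
    then show ?thesis using v WV by (intro exI[of _ "(1 / v $ j) *\<^sub>R v"]) auto
  qed
  then obtain c where "\<And>j. c j $ j = 1 \<and> (\<forall>l. \<rho> l > \<rho> j \<longrightarrow> c j $ l = 0) \<and> (\<forall>V\<in>\<tau>. j \<in> leads \<rho> V \<longrightarrow> c j \<in> V)"
    by metis
  then show thesis by (intro that[of c]) (auto simp: echelon_def)
qed

text \<open>\<open>r j\<close> counts the members that miss the pivot \<open>j\<close>. As
  \<open>\<rho>\<close> stays below \<open>?n\<close>, the key \<open>\<kappa>\<close> orders by
  \<open>r\<close> and breaks ties by \<open>\<rho>\<close>; sorting by it turns each pivot set into
  an initial segment.\<close>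

lemma chain_ordering_exists:
  fixes \<tau> :: "(real^'n) set set"
  assumes fin: "finite \<tau>" and chain: "\<And>V W. V \<in> \<tau> \<Longrightarrow> W \<in> \<tau> \<Longrightarrow> V \<subseteq> W \<or> W \<subseteq> V"
  obtains \<sigma> where "bij_betw \<sigma> {..<CARD('n)} UNIV" "\<And>V. V \<in> \<tau> \<Longrightarrow> \<exists>m\<le>CARD('n). leads \<rho> V = \<sigma> ` {..<m}"
proof -
  let ?n = "CARD('n)"
  define r where "r j = card {V\<in>\<tau>. j \<notin> leads \<rho> V}" for j
  define \<kappa> where "\<kappa> j = r j * ?n + \<rho> j" for j
  have "\<kappa> j mod ?n = \<rho> j" for j using rho_less by (simp add: \<kappa>_def)
  then have inj: "inj \<kappa>" using rho_inj by (metis injI)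
  have down: "j' \<in> leads \<rho> V" if V: "V \<in> \<tau>" and j: "j \<in> leads \<rho> V" and less: "\<kappa> j' < \<kappa> j" for V j j'
  proof (rule ccontr)
    assume j': "j' \<notin> leads \<rho> V"
    have mono: "leads \<rho> V1 \<subseteq> leads \<rho> V2" if sub: "V1 \<subseteq> V2" for V1 V2
    proof
      fix l assume "l \<in> leads \<rho> V1"
      then obtain v where v: "v \<in> V1" "v $ l \<noteq> 0 \<and> (\<forall>l'. \<rho> l' > \<rho> l \<longrightarrow> v $ l' = 0)"
        by (auto simp: leads_def)
      from v(1) sub have "v \<in> V2" by (rule rev_subsetD)
      with v(2) show "l \<in> leads \<rho> V2" unfolding leads_def mem_Collect_eq by (rule bexI)
    qed
    have "{V\<in>\<tau>. j \<notin> leads \<rho> V} \<subset> {V\<in>\<tau>. j' \<notin> leads \<rho> V}"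
    proof
      show "{V\<in>\<tau>. j \<notin> leads \<rho> V} \<subseteq> {V\<in>\<tau>. j' \<notin> leads \<rho> V}"
      proof clarify
        fix W assume W: "W \<in> \<tau>" "j \<notin> leads \<rho> W" "j' \<in> leads \<rho> W"
        then have "\<not> V \<subseteq> W" using mono j by blast
        then have "W \<subseteq> V" using chain[OF V W(1)] by blast
        then show False using mono W(3) j' by blast
      qed
      show "{V\<in>\<tau>. j \<notin> leads \<rho> V} \<noteq> {V\<in>\<tau>. j' \<notin> leads \<rho> V}" using V j j' by blast
    qed
    then have "r j < r j'" unfolding r_def using fin by (intro psubset_card_mono) auto
    then have "(r j + 1) * ?n \<le> r j' * ?n" by (intro mult_le_mono1) simp
    then have "\<kappa> j < \<kappa> j'" using rho_less[of j] by (simp add: \<kappa>_def)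
    then show False using less by simp
  qed
  have card: "card (range \<kappa>) = ?n" using inj by (simp add: card_image)
  obtain h where h: "bij_betw h {..<?n} (range \<kappa>)" "strict_mono_on {..<?n} h"
    using ex_bij_betw_strict_mono_card[of "range \<kappa>"] card by auto
  define \<sigma> where "\<sigma> = inv_into UNIV \<kappa> \<circ> h"
  have "bij_betw (inv_into UNIV \<kappa>) (range \<kappa>) UNIV"
    using inj by (intro bij_betw_inv_into) (simp add: bij_betw_def)
  then have \<sigma>: "bij_betw \<sigma> {..<?n} UNIV" unfolding \<sigma>_def using h(1) by (rule bij_betw_trans[rotated])
  have \<kappa>\<sigma>: "\<kappa> (\<sigma> i) = h i" if "i < ?n" for i
    using h(1) that unfolding \<sigma>_def by (auto simp: bij_betw_def intro!: f_inv_into_f)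
  have "\<exists>m\<le>?n. leads \<rho> V = \<sigma> ` {..<m}" if V: "V \<in> \<tau>" for V
  proof -
    define A where "A = {i\<in>{..<?n}. \<sigma> i \<in> leads \<rho> V}"
    have dA: "i' \<in> A" if "i \<in> A" "i' < i" for i i'
    proof -
      have "h i' < h i" using h(2) that by (auto simp: A_def strict_mono_on_def)
      then have "\<kappa> (\<sigma> i') < \<kappa> (\<sigma> i)" using that by (simp add: \<kappa>\<sigma> A_def)
      then show ?thesis using down[OF V, of "\<sigma> i" "\<sigma> i'"] that by (auto simp: A_def)
    qed
    define m where "m = (LEAST i. i \<notin> A)"
    have ex: "?n \<notin> A" by (simp add: A_def)
    have "m \<notin> A" unfolding m_def using ex by (rule LeastI)
    moreover have "m \<le> ?n" unfolding m_def using ex by (rule Least_le)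
    moreover have "A = {..<m}"
    proof (intro Set.set_eqI iffI)
      fix i assume "i \<in> A"
      then show "i \<in> {..<m}" using \<open>m \<notin> A\<close> dA[of i m] by (metis lessThan_iff nat_neq_iff)
    next
      fix i assume "i \<in> {..<m}"
      then show "i \<in> A" using not_less_Least[of i "\<lambda>i. i \<notin> A"] by (auto simp: m_def)
    qed
    moreover have "leads \<rho> V = \<sigma> ` A"
      using \<sigma> unfolding A_def bij_betw_def by (auto simp: image_iff)
    ultimately show ?thesis by blast
  qed
  with \<sigma> show thesis by (rule that)
qed

text \<open>The matrix of squares of the Gram--Schmidt frame of the deformed echelon basis is rational in
  \<open>y\<close> and is a permutation matrix at \<open>y = 0\<close>; where it is invertible, some linear functional is
  positive on all the gradients of the chain.\<close>

lemma finite_nongeneric: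
  fixes \<tau> :: "(real^'n) set set"
  assumes fin: "finite \<tau>" and chain: "\<And>V W. V \<in> \<tau> \<Longrightarrow> W \<in> \<tau> \<Longrightarrow> V \<subseteq> W \<or> W \<subseteq> V"
    and sub: "\<And>V. V \<in> \<tau> \<Longrightarrow> subspace V \<and> V \<noteq> {0} \<and> V \<noteq> UNIV"
  shows "finite {y. y > 0 \<and> 0 \<in> convex hull ((\<lambda>V. lnvol_grad V (flow y)) ` \<tau>)}"
proof -
  let ?n = "CARD('n)"
  obtain c where c: "echelon \<rho> c" and cV: "\<And>V j. V \<in> \<tau> \<Longrightarrow> j \<in> leads \<rho> V \<Longrightarrow> c j \<in> V"
    using chain_echelon_exists[OF fin chain] sub by metis
  obtain \<sigma> where \<sigma>: "bij_betw \<sigma> {..<?n} UNIV" and m: "\<And>V. V \<in> \<tau> \<Longrightarrow> \<exists>m\<le>?n. leads \<rho> V = \<sigma> ` {..<m}"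
    using chain_ordering_exists[OF fin chain] by metis
  define D where "D y i = deform c y (\<sigma> i)" for y i
  define e where "e y = gs (D y)" for y
  have e0: "e y i \<noteq> 0" if "i < ?n" for y i
  proof -
    have ind: "inj (deform c y)" "independent (range (deform c y))"
      using echelon_independent[OF echelon_deform[OF c]] by blast+
    have "inj_on (D y) {..<?n}"
      using \<sigma> ind(1) unfolding D_def bij_betw_def inj_on_def by blast
    moreover have "D y ` {..<?n} = range (deform c y)"
      using \<sigma> unfolding D_def bij_betw_def by (metis image_image)
    ultimately show ?thesis unfolding e_def using ind(2) that by (intro gs_nonzero[of _ ?n]) auto
  qed
  have rat_e: "ratfun (\<lambda>y. e y i $ j)" if "i < ?n" for i j
    using that
  proof (induction i arbitrary: j rule: less_induct)
    case (less i)
    have D_rat: "ratfun (\<lambda>y. D y i $ l)" for l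
      unfolding D_def deform_def vec_lambda_beta
      by (cases "\<rho> l \<le> \<rho> (\<sigma> i)") (auto intro!: ratfun_mult ratfun_const ratfun_power)
    have IH: "ratfun (\<lambda>y. e y l $ j)" if "l < i" for l j using less that by simp
    have nz: "e y l \<bullet> e y l \<noteq> 0" if "l < i" for l y using e0[of l y] less.prems that by simp
    have eq: "(\<lambda>y. e y i $ j) = (\<lambda>y. D y i $ j - (\<Sum>l<i. (D y i \<bullet> e y l) / (e y l \<bullet> e y l) * e y l $ j))"
      unfolding e_def by (subst gs.simps) simp
    show ?case
      unfolding eq
    proof (intro ratfun_diff ratfun_sum ratfun_mult ratfun_divide D_rat)
      fix l assume l: "l \<in> {..<i}"
      show "ratfun (\<lambda>y. D y i \<bullet> e y l)" "ratfun (\<lambda>y. e y l \<bullet> e y l)"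
        unfolding inner_vec_def inner_real_def using l by (auto intro!: ratfun_sum ratfun_mult D_rat IH)
    qed (use IH nz in auto)
  qed
  \<comment> \<open>Squaring the normalised entries avoids square roots, so the matrix stays
    rational in \<open>y\<close>. Partial sums of its rows, in the order of \<open>\<rho>\<close>,
    are the vectors \<open>diagp\<close> along the flag.\<close>
  define M :: "real \<Rightarrow> real^'n^'n" where "M y = (\<chi> a j. (e y (\<rho> a) $ j)\<^sup>2 / (e y (\<rho> a) \<bullet> e y (\<rho> a)))" for y
  have "ratfun (\<lambda>y. M y $ a $ j)" for a j
    unfolding M_def vec_lambda_beta power2_eq_square inner_vec_def inner_real_def
  proof (intro ratfun_divide ratfun_mult ratfun_sum rat_e rho_less)
    fix y :: real
    show "(\<Sum>i\<in>UNIV. e y (\<rho> a) $ i * e y (\<rho> a) $ i) \<noteq> 0"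
      using e0[OF rho_less, of y a] by (simp add: inner_vec_def[symmetric] inner_real_def[symmetric] del: inner_real_def)
  qed
  then have "ratfun (\<lambda>y. det (M y))" by (rule ratfun_det)
  moreover have "det (M 0) \<noteq> 0"
  proof -
    have ax: "D 0 i = axis (\<sigma> i) 1" for i unfolding D_def by (rule deform_0[OF c])
    \<comment> \<open>At 0 the vectors are distinct unit vectors of the standard basis, so
      Gram-Schmidt leaves them unchanged.\<close>
    have "e 0 i = axis (\<sigma> i) 1" if "i < ?n" for i
      using that
    proof (induction i rule: less_induct)
      case (less i)
      have "D 0 i \<bullet> e 0 l = 0" if "l < i" for l
      proof -
        have "\<sigma> i \<noteq> \<sigma> l" using \<sigma> that less.prems unfolding bij_betw_def inj_on_def
          by (metis lessThan_iff less_trans nat_neq_iff)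
        then show ?thesis using less that by (simp add: ax inner_axis_axis)
      qed
      then show ?case unfolding e_def by (subst gs.simps) (simp add: e_def[symmetric] ax)
    qed
    then have M0: "M 0 $ a $ j = (if j = \<sigma> (\<rho> a) then 1 else 0)" for a j
      using rho_less[of a] by (simp add: M_def inner_axis_axis) (simp add: axis_def)
    have "\<sigma> (\<rho> a) = \<sigma> (\<rho> b) \<longleftrightarrow> a = b" for a b
      using \<sigma> rho_less rho_inj unfolding bij_betw_def inj_on_def by (metis lessThan_iff)
    then have "M 0 ** transpose (M 0) = mat 1"
      by (simp add: vec_eq_iff matrix_matrix_mult_def transpose_def M0
          Finite_Cartesian_Product.mat_def if_distrib[of "\<lambda>x. x * _"] cong: if_cong)
    then have "det (M 0) * det (M 0) = 1"
      by (metis det_I det_mul det_transpose)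
    then show ?thesis by auto
  qed
  ultimately have finite: "finite {y. y > 0 \<and> det (M y) = 0}" by (rule ratfun_finite_zeros)
  have "0 \<notin> convex hull ((\<lambda>V. lnvol_grad V (flow y)) ` \<tau>)" if y: "y > 0" and det: "det (M y) \<noteq> 0" for y
  proof -
    obtain a0 where a0: "\<rho> a0 = 0" using \<rho> unfolding bij_betw_def
      by (metis (no_types, lifting) imageE lessThan_iff zero_less_card_finite)
    obtain B where B: "M y ** B = mat 1" using det invertible_det_nz[of "M y"] by (auto simp: invertible_def)
    \<comment> \<open>\<open>z\<close> pairs to 1 with the first row and to 0 with the others. Hence
      \<open>diagp\<close> of every nonzero span of leading frame vectors pairs to 1 with
      \<open>z\<close>, whatever its dimension.\<close>
    define z where "z = B *v axis a0 1"
    have "M y *v z = axis a0 1" by (simp add: z_def matrix_vector_mul_assoc B)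
    then have Mz: "(\<Sum>j\<in>UNIV. M y $ a $ j * z $ j) = (if a = a0 then 1 else 0)" for a
      by (simp add: vec_eq_iff matrix_vector_mult_def axis_def)
    have ez: "(\<Sum>j\<in>UNIV. (e y i $ j)\<^sup>2 / (e y i \<bullet> e y i) * z $ j) = (if i = 0 then 1 else 0)" if i: "i < ?n" for i
    proof -
      obtain a where a: "\<rho> a = i" using \<rho> i unfolding bij_betw_def by (metis imageE lessThan_iff)
      have "a = a0 \<longleftrightarrow> i = 0" using a a0 rho_inj by metis
      then show ?thesis using Mz[of a] by (simp add: M_def a)
    qed
    have key: "diagp (span (D y ` {..<k})) \<bullet> z = 1 \<and> dim (span (D y ` {..<k})) = k" if k: "0 < k" "k \<le> ?n" for k
    proof -
      let ?ps = "map (\<lambda>i. (1 / norm (e y i)) *\<^sub>R e y i) [0..<k]"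
      have "span (set ?ps) = span (e y ` {..<k})"
      proof (intro antisym span_minimal subspace_span)
        have "(1 / norm (e y i)) *\<^sub>R e y i \<in> span (e y ` {..<k})" if "i < k" for i
          using that by (intro span_scale span_base) auto
        then show "set ?ps \<subseteq> span (e y ` {..<k})" by auto
        show "e y ` {..<k} \<subseteq> span (set ?ps)"
        proof
          fix x assume "x \<in> e y ` {..<k}"
          then obtain i where i: "i < k" "x = e y i" by auto
          have "norm (e y i) *\<^sub>R ((1 / norm (e y i)) *\<^sub>R e y i) \<in> span (set ?ps)"
            using i by (intro span_scale span_base) auto
          then show "x \<in> span (set ?ps)" using e0[of i y] i k by simp
        qed
      qed
      also have "\<dots> = span (D y ` {..<k})" unfolding e_def by (rule gs_span)
      finally have sp: "span (set ?ps) = span (D y ` {..<k})" .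
      have "?ps ! i \<bullet> ?ps ! j = (if i = j then 1 else 0)" if "i < k" "j < k" for i j
        using that e0[of i y] k gs_orthogonal[of j i "D y"] unfolding e_def
        by (auto simp: power2_norm_eq_inner[symmetric] power2_eq_square)
      then have onb: "onb (span (D y ` {..<k})) ?ps" using sp by (simp add: onb_def)
      have "diagp (span (D y ` {..<k})) \<bullet> z = (\<Sum>j\<in>UNIV. (\<Sum>i<k. (e y i $ j)\<^sup>2 / (e y i \<bullet> e y i)) * z $ j)"
        unfolding inner_vec_def[of "diagp _"] inner_real_def
        by (intro sum.cong refl) (simp add: diagp_nth[OF onb] power_mult_distrib power_divide power2_norm_eq_inner)
      also have "\<dots> = (\<Sum>i<k. \<Sum>j\<in>UNIV. (e y i $ j)\<^sup>2 / (e y i \<bullet> e y i) * z $ j)"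
        unfolding sum_distrib_right by (rule sum.swap)
      also have "\<dots> = (\<Sum>i<k. if i = 0 then 1 else 0)"
        using ez k by (intro sum.cong) auto
      also have "\<dots> = 1" using k by simp
      finally show ?thesis using onb_length[OF onb] by simp
    qed
    have full: "V = UNIV" if "dim V = ?n" "subspace V" for V :: "(real^'n) set"
      using that dim_eq_full[of V] span_eq_iff[of V] by simp
    have "span (D y ` {..<?n}) = UNIV" using key[of ?n] by (intro full) auto
    \<comment> \<open>The full space also pairs to 1 and has all diagonal entries 1. The gradient of
      a k-dimensional member therefore pairs to 1 - k/n, which is positive for a proper
      subspace.\<close>
    then have sum_z: "(\<Sum>j\<in>UNIV. z $ j) = 1"
      using key[of ?n] by (simp add: inner_vec_def diagp_UNIV)
    have "lnvol_grad V (flow y) \<bullet> z > 0" if V: "V \<in> \<tau>" for V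
    proof -
      obtain k where k: "k \<le> ?n" "leads \<rho> V = \<sigma> ` {..<k}" using m[OF V] by blast
      have sV: "subspace V" "V \<noteq> {0}" "V \<noteq> UNIV" using sub[OF V] by auto
      have "scl (flow y) ` V = span (deform c y ` leads \<rho> V)"
        unfolding span_deform[OF c y] by (simp add: echelon_span[OF c sV(1) cV[OF V]])
      also have "deform c y ` leads \<rho> V = D y ` {..<k}" unfolding k(2) D_def by (simp add: image_image)
      finally have img: "scl (flow y) ` V = span (D y ` {..<k})" .
      have "k > 0"
      proof (rule ccontr)
        assume "\<not> k > 0"
        then have "leads \<rho> V = {}" using k by simp
        then have "V = {0}" using echelon_span[OF c sV(1) cV[OF V]] by simp
        then show False using sV by simp
      qed
      note kk = key[OF this k(1)]
      have dimV: "dim V = k" using kk dim_scl_image[of "flow y" V] unfolding img by simp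
      have "k \<noteq> ?n" using dimV sV full by blast
      then have "real k / real ?n < 1" using k(1) by simp
      moreover have "lnvol_grad V (flow y) \<bullet> z = 1 - real k / real ?n"
      proof -
        have "lnvol_grad V (flow y) \<bullet> z = diagp (span (D y ` {..<k})) \<bullet> z - (\<Sum>j\<in>UNIV. real k / real ?n * z $ j)"
          unfolding lnvol_grad_def img dimV inner_vec_def by (simp add: left_diff_distrib sum_subtractf)
        also have "(\<Sum>j\<in>UNIV. real k / real ?n * z $ j) = real k / real ?n"
          unfolding sum_distrib_left[symmetric] sum_z by simp
        finally show ?thesis using kk by simp
      qed
      ultimately show ?thesis by linarith
    qed
    then have "(\<lambda>V. lnvol_grad V (flow y)) ` \<tau> \<subseteq> {x. z \<bullet> x > 0}" by (auto simp: inner_commute)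
    then have "convex hull ((\<lambda>V. lnvol_grad V (flow y)) ` \<tau>) \<subseteq> {x. z \<bullet> x > 0}"
      by (intro hull_minimal convex_halfspace_gt) 
    then show ?thesis by auto
  qed
  then show ?thesis by (intro finite_subset[OF _ finite]) auto
qed

end

section \<open>Covers by flags of rational subspaces\<close>

abbreviation proper_subspaces :: "(real^'n) set \<Rightarrow> (real^'n) set set" where
  "proper_subspaces L \<equiv> {V. rational_subspace L V \<and> V \<noteq> {0} \<and> V \<noteq> UNIV}"

text \<open>In both applications the weights are designed so that a common zero is either the point
  sought or a contradiction.\<close>

lemma no_flag_cover:
  fixes g :: "real^'n^'n" and w :: "(real^'n) set \<Rightarrow> real^'n \<Rightarrow> real"
  defines "L \<equiv> Zlattice g"
  assumes g: "invertible g"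
    and cont: "\<And>V. V \<in> proper_subspaces L \<Longrightarrow> continuous_on UNIV (w V)"
    and nonneg: "\<And>V t. V \<in> proper_subspaces L \<Longrightarrow> w V t \<ge> 0"
    and below: "\<And>V t. V \<in> proper_subspaces L \<Longrightarrow> w V t > 0 \<Longrightarrow> lnvol L V t \<le> c"
    and nested: "\<And>V W t. V \<in> proper_subspaces L \<Longrightarrow> W \<in> proper_subspaces L \<Longrightarrow>
      w V t > 0 \<Longrightarrow> w W t > 0 \<Longrightarrow> V \<subseteq> W \<or> W \<subseteq> V"
  shows "\<exists>t. \<forall>V\<in>proper_subspaces L. w V t = 0"
proof (rule ccontr)
  let ?I = "proper_subspaces L"
  assume "\<not> ?thesis"
  then have nz: "\<exists>V\<in>?I. w V t \<noteq> 0" for t by blast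
  have cover: "\<exists>V\<in>?I. w V t > 0" for t
  proof -
    obtain V where V: "V \<in> ?I" "w V t \<noteq> 0" using nz by blast
    then have "w V t > 0" using nonneg[OF V(1), of t] by linarith
    then show ?thesis using V(1) by blast
  qed
  have L: "discrete_subgroup L" unfolding L_def by (rule discrete_subgroup_Zlattice[OF g])
  obtain \<rho> :: "'n \<Rightarrow> nat" where \<rho>: "bij_betw \<rho> UNIV {..<CARD('n)}"
    using ex_bij_betw_finite_nat[of "UNIV :: 'n set"] by (auto simp: atLeast0LessThan)
  have fin: "finite {V\<in>?I. lnvol L V s - c \<le> H}" for s H
    unfolding L_def by (rule finite_subset[OF _ finite_lnvol_le[OF g, of s "H + c"]]) auto
  have sub: "subspace V \<and> V \<noteq> {0} \<and> V \<noteq> UNIV" if "V \<in> ?I" for V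
    using that rational_subspace_subspace by blast
  define T where "T = {\<tau>. finite \<tau> \<and> \<tau> \<subseteq> ?I \<and> (\<forall>V\<in>\<tau>. \<forall>W\<in>\<tau>. V \<subseteq> W \<or> W \<subseteq> V)}"
  have "countable ?I"
  proof -
    have "?I \<subseteq> (\<Union>k::nat. {V\<in>?I. lnvol L V 0 - c \<le> real k})"
    proof
      fix V assume V: "V \<in> ?I"
      obtain k :: nat where "lnvol L V 0 - c \<le> real k" using real_arch_simple by blast
      then show "V \<in> (\<Union>k::nat. {V\<in>?I. lnvol L V 0 - c \<le> real k})" using V by blast
    qed
    moreover have "countable (\<Union>k::nat. {V\<in>?I. lnvol L V 0 - c \<le> real k})"
      by (intro countable_UN countableI_type countable_finite fin)
    ultimately show ?thesis by (rule countable_subset)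
  qed
  then have "countable {\<tau>. finite \<tau> \<and> \<tau> \<subseteq> ?I}" by (rule countable_Collect_finite_subset)
  then have "countable T" by (rule countable_subset[rotated]) (auto simp: T_def)
  have bad: "\<exists>\<tau>\<in>T. 0 \<in> convex hull ((\<lambda>V. lnvol_grad V (flow \<rho> y)) ` \<tau>)" for y
  proof -
    define s where "s = flow \<rho> y"
    have pair: "lnvol L V s - c \<le> lnvol_grad V s \<bullet> (s - t)" if "V \<in> ?I" "w V t > 0" for V t
    proof -
      have "rational_subspace L V" using that(1) by blast
      from lnvol_subgradient[OF L this, of s t] below[OF that] show ?thesis by linarith
    qed
    have finA: "finite {V\<in>?I. w V t > 0}" for t
    proof (rule finite_subset[OF _ fin[of s "CARD('n) * norm (s - t)"]], rule subsetI)
      fix V assume V: "V \<in> {V\<in>?I. w V t > 0}"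
      then have V': "V \<in> ?I" "w V t > 0" by blast+
      then have "lnvol L V s - c \<le> lnvol_grad V s \<bullet> (s - t)" by (rule pair)
      also have "\<dots> \<le> norm (lnvol_grad V s) * norm (s - t)" by (rule norm_cauchy_schwarz)
      also have "\<dots> \<le> CARD('n) * norm (s - t)"
        using sub[OF V'(1)] by (intro mult_right_mono norm_lnvol_grad_le) simp_all
      finally show "V \<in> {V\<in>?I. lnvol L V s - c \<le> CARD('n) * norm (s - t)}" using V'(1) by blast
    qed
    \<comment> \<open>Distinct members of a chain of subspaces have distinct dimensions.\<close>
    have card: "card {V\<in>?I. w V t > 0} \<le> Suc CARD('n)" for t
    proof -
      have "inj_on dim {V\<in>?I. w V t > 0}"
      proof (rule inj_onI)
        fix V W assume VW: "V \<in> {V\<in>?I. w V t > 0}" "W \<in> {V\<in>?I. w V t > 0}" "dim V = dim W"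
        then have I: "V \<in> ?I" "W \<in> ?I" and "w V t > 0" "w W t > 0" by blast+
        then consider "V \<subseteq> W" | "W \<subseteq> V" using nested[of V W t] by blast
        then show "V = W"
        proof cases
          case 1
          then show ?thesis using sub[OF I(1)] sub[OF I(2)] VW(3) by (intro subspace_dim_equal) simp_all
        next
          case 2
          then have "W = V" using sub[OF I(1)] sub[OF I(2)] VW(3) by (intro subspace_dim_equal) simp_all
          then show ?thesis ..
        qed
      qed
      moreover have "dim ` {V\<in>?I. w V t > 0} \<subseteq> {..CARD('n)}" using dim_subset_UNIV_cart by auto
      ultimately show ?thesis using card_inj_on_le[of dim _ "{..CARD('n)}"] by simp
    qed
    obtain t where t: "0 \<in> convex hull ((\<lambda>V. lnvol_grad V s) ` {V\<in>?I. w V t > 0})"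
    proof (rule zero_in_convex_hull_active[where I="?I" and w=w and g="\<lambda>V. lnvol_grad V s"
          and h="\<lambda>V. lnvol L V s - c" and s=s and C="CARD('n)" and N="Suc CARD('n)"])
      show "norm (lnvol_grad V s) \<le> CARD('n)" if "V \<in> ?I" for V
        using sub[OF that] by (intro norm_lnvol_grad_le) simp
    qed (rule cont nonneg cover pair fin card that; assumption)+
    have "{V\<in>?I. w V t > 0} \<in> T"
      unfolding T_def
    proof (intro CollectI conjI finA ballI)
      show "{V\<in>?I. w V t > 0} \<subseteq> ?I" by (rule Collect_restrict)
    next
      fix V W assume "V \<in> {V\<in>?I. w V t > 0}" "W \<in> {V\<in>?I. w V t > 0}"
      then show "V \<subseteq> W \<or> W \<subseteq> V" by (elim CollectE conjE) (rule nested, simp_all)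
    qed
    then show ?thesis using t unfolding s_def by (rule bexI[rotated])
  qed
  have "{0<..} \<subseteq> (\<Union>\<tau>\<in>T. {y. y > 0 \<and> 0 \<in> convex hull ((\<lambda>V. lnvol_grad V (flow \<rho> y)) ` \<tau>)})"
  proof
    fix y :: real assume "y \<in> {0<..}"
    then show "y \<in> (\<Union>\<tau>\<in>T. {y. y > 0 \<and> 0 \<in> convex hull ((\<lambda>V. lnvol_grad V (flow \<rho> y)) ` \<tau>)})"
      using bad[of y] by blast
  qed
  moreover have "countable (\<Union>\<tau>\<in>T. {y. y > 0 \<and> 0 \<in> convex hull ((\<lambda>V. lnvol_grad V (flow \<rho> y)) ` \<tau>)})"
  proof (intro countable_UN \<open>countable T\<close> countable_finite)
    fix \<tau> assume \<tau>: "\<tau> \<in> T"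
    show "finite {y. y > 0 \<and> 0 \<in> convex hull ((\<lambda>V. lnvol_grad V (flow \<rho> y)) ` \<tau>)}"
    proof (rule finite_nongeneric[OF \<rho>])
      show "finite \<tau>" using \<tau> by (simp only: T_def mem_Collect_eq)
      show "V \<subseteq> W \<or> W \<subseteq> V" if "V \<in> \<tau>" "W \<in> \<tau>" for V W using \<tau> that unfolding T_def by blast
      have st: "\<tau> \<subseteq> ?I" using \<tau> by (simp only: T_def mem_Collect_eq)
      show "subspace V \<and> V \<noteq> {0} \<and> V \<noteq> UNIV" if "V \<in> \<tau>" for V
        by (rule sub[OF subsetD[OF st that]])
    qed
  qed
  ultimately have "countable {0::real<..}" by (rule countable_subset)
  then have "countable {0::real<..<1}" by (rule countable_subset[rotated]) auto
  then show False using uncountable_open_interval[of 0 "1::real"] by simp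
qed

section \<open>Stable lattices\<close>

lemma lnvol_zero:
  assumes L: "discrete_subgroup L"
  shows "lnvol L {0} t = 0"
proof -
  have "rational_subspace L (span {})" by (rule rational_subspace_span) simp
  then have "length (Zbas L {0}) = 0" using Zbas(2)[OF L, of "{0}"] by simp
  then show ?thesis by (simp add: lnvol_def gram_det_eq_prod_infdist)
qed

text \<open>As det g = 1, a lattice basis has the same Gram determinant as its integral preimage, a
  positive integer. This settles \<open>t = 0\<close>; there the gradient for \<open>UNIV\<close>
  vanishes, and convexity carries the bound to all \<open>t\<close>.\<close>

lemma lnvol_UNIV_nonneg:
  fixes g :: "real^'n^'n"
  assumes det: "det g = 1"
  shows "rational_subspace (Zlattice g) UNIV" "lnvol (Zlattice g) UNIV t \<ge> 0"
proof -
  let ?L = "Zlattice g"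
  have g: "invertible g" using det by (simp add: invertible_det_nz)
  note L = discrete_subgroup_Zlattice[OF g]
  have "range (\<lambda>i. axis i 1) \<subseteq> (int_vectors :: (real^'n) set)" by (auto simp: int_vectors_def axis_def)
  then have "(*v) g ` range (\<lambda>i. axis i 1) \<subseteq> ?L" by (auto simp: Zlattice_def)
  moreover have "span ((*v) g ` range (\<lambda>i. axis i (1::real))) = UNIV"
  proof -
    have "span (range (\<lambda>i::'n. axis i (1::real))) = UNIV"
    proof -
      have "x \<in> span (range (\<lambda>i::'n. axis i (1::real)))" for x
        by (subst basis_expansion[of x, symmetric], unfold scalar_mult_eq_scaleR)
          (rule span_sum, rule span_scale, rule span_base, simp)
      then show ?thesis by blast
    qed
    then show ?thesis
      using linear_span_image[OF matrix_vector_mul_linear, of g "range (\<lambda>i. axis i 1)"]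
      using g by (simp add: invertible_eq_bij bij_is_surj)
  qed
  ultimately show U: "rational_subspace ?L UNIV" using rational_subspace_span by metis
  have "gram_det (Zbas ?L UNIV) \<ge> 1"
  proof -
    obtain zs where zsI: "set zs \<subseteq> int_vectors" and gz: "map ((*v) g) zs = Zbas ?L UNIV"
      using Zlattice_list_preimage[OF Zbas(5)[OF L U]] .
    from zsI obtain z :: "nat \<Rightarrow> 'n \<Rightarrow> int" and G :: "nat \<Rightarrow> nat \<Rightarrow> int"
      where "gram_det zs = of_int (ndet (length zs) G)"
      using gram_det_int by metis
    then obtain N :: int where N: "gram_det zs = of_int N" by blast
    have "length zs = CARD('n)" using arg_cong[OF gz, of length] by (simp add: Zbas(2)[OF L U])
    then have "gram_det (map ((*v) g) zs) = gram_det zs" using det by (simp add: gram_det_matrix_mult)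
    moreover have "gram_det (Zbas ?L UNIV) > 0" using Zbas(3,4)[OF L U] by (rule gram_det_pos)
    ultimately have "gram_det (Zbas ?L UNIV) = of_int N" "N > 0" using N gz by simp_all
    then show ?thesis by simp
  qed
  moreover have "map (scl 0) (Zbas ?L UNIV) = Zbas ?L UNIV" by (rule map_idI) simp
  ultimately have "lnvol ?L UNIV 0 \<ge> 0" by (simp add: lnvol_def)
  moreover have "lnvol_grad (UNIV :: (real^'n) set) 0 = 0"
    by (simp add: lnvol_grad_def vec_eq_iff diagp_UNIV)
  then have "lnvol ?L UNIV 0 - lnvol ?L UNIV t \<le> 0" using lnvol_subgradient[OF L U, of 0 t] by simp
  ultimately show "lnvol ?L UNIV t \<ge> 0" by linarith
qed

text \<open>The trace of a projection is its rank, so every gradient is orthogonal to the constant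
  vectors. The subgradient inequality in both directions then forces equality.\<close>

lemma lnvol_shift:
  fixes L :: "(real^'n) set"
  assumes L: "discrete_subgroup L" and V: "rational_subspace L V"
  shows "lnvol L V (t + (\<chi> j. c)) = lnvol L V t"
proof -
  have sub: "subspace (scl s ` V)" for s
    using rational_subspace_subspace[OF V] by (rule linear_subspace_image[OF linear_scl])
  have "lnvol_grad V s \<bullet> (\<chi> j. d) = 0" for s d
  proof -
    have "lnvol_grad V s \<bullet> (\<chi> j. d) = ((\<Sum>j\<in>UNIV. diagp (scl s ` V) $ j) - dim V) * d"
      by (simp add: lnvol_grad_def inner_vec_def sum_distrib_right[symmetric] sum_subtractf)
    then show ?thesis by (simp add: sum_diagp[OF sub] dim_scl_image)
  qed
  then have le: "lnvol L V s - lnvol L V (s - (\<chi> j. d)) \<le> 0" for s d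
    using lnvol_subgradient[OF L V, of s "s - (\<chi> j. d)"] by simp
  have "t - (\<chi> j. - c) = t + (\<chi> j. c)"
    by (simp add: vec_eq_iff)
  then have "lnvol L V t \<le> lnvol L V (t + (\<chi> j. c))" using le[of t "- c"] by (simp only: diff_le_0_iff_le)
  moreover have "lnvol L V (t + (\<chi> j. c)) \<le> lnvol L V t" using le[of "t + (\<chi> j. c)" c] by simp
  ultimately show ?thesis by (rule antisym[rotated])
qed

lemma lipschitz_INF:
  fixes f :: "'v \<Rightarrow> 'a::real_normed_vector \<Rightarrow> real"
  assumes "I \<noteq> {}" and lip: "\<And>V s t. V \<in> I \<Longrightarrow> \<bar>f V s - f V t\<bar> \<le> K * norm (s - t)"
    and bdd: "\<And>t. bdd_below ((\<lambda>V. f V t) ` I)"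
  shows "\<bar>(INF V\<in>I. f V s) - (INF V\<in>I. f V t)\<bar> \<le> K * norm (s - t)"
proof -
  have *: "(INF V\<in>I. f V s) - K * norm (s - t) \<le> (INF V\<in>I. f V t)" for s t
  proof (rule cINF_greatest[OF assms(1)])
    fix V assume V: "V \<in> I"
    have "(INF V\<in>I. f V s) \<le> f V s" by (rule cINF_lower[OF bdd V])
    then show "(INF V\<in>I. f V s) - K * norm (s - t) \<le> f V t" using lip[OF V, of s t] by linarith
  qed
  show ?thesis using *[of s t] *[of t s] by (simp add: norm_minus_commute abs_le_iff)
qed

lemma lipschitz_continuous:
  fixes f :: "'a::real_normed_vector \<Rightarrow> real"
  assumes "\<And>s t. \<bar>f s - f t\<bar> \<le> K * norm (s - t)"
  shows "continuous_on UNIV f"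
proof (rule lipschitz_on_continuous_on)
  show "(max K 0)-lipschitz_on UNIV f"
  proof (rule lipschitz_onI)
    fix s t
    have "\<bar>f s - f t\<bar> \<le> max K 0 * norm (s - t)"
      using assms[of s t] mult_right_mono[of K "max K 0" "norm (s - t)"] by simp
    then show "dist (f s) (f t) \<le> max K 0 * dist s t" by (simp add: dist_norm)
  qed simp
qed

text \<open>If no point is stable, perturb \<open>lnvol\<close> by a small strictly concave function of the
  dimension.  By submodularity the near-minimisers of the perturbed function are nested.\<close>

lemma stable_point_exists:
  fixes g :: "real^'n^'n"
  assumes det: "det g = 1"
  shows "\<exists>t. \<forall>V\<in>proper_subspaces (Zlattice g). lnvol (Zlattice g) V t \<ge> 0"
proof (rule ccontr)
  let ?L = "Zlattice g" and ?n = "real CARD('n)"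
  let ?I = "proper_subspaces ?L"
  assume "\<not> ?thesis"
  then have neg: "\<exists>V\<in>?I. lnvol ?L V t < 0" for t by (auto simp: not_le)
  have g: "invertible g" using det by (simp add: invertible_det_nz)
  note L = discrete_subgroup_Zlattice[OF g]
  have I0: "?I \<noteq> {}" using neg[of 0] by blast
  \<comment> \<open>Finitely many \<open>V\<close> have nonpositive \<open>lnvol\<close> at
    \<open>t\<close>, and at least one is negative, so the infimum is attained.\<close>
  have min: "\<exists>V0\<in>?I. lnvol ?L V0 t < 0 \<and> (\<forall>V\<in>?I. lnvol ?L V0 t \<le> lnvol ?L V t)" for t
  proof -
    let ?S = "{V\<in>?I. lnvol ?L V t \<le> 0}"
    have fS: "finite ?S" by (rule finite_subset[OF _ finite_lnvol_le[OF g, of t 0]]) auto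
    obtain V1 where V1: "V1 \<in> ?I" "lnvol ?L V1 t < 0" using neg by blast
    then have "?S \<noteq> {}" by auto
    then have "Min ((\<lambda>V. lnvol ?L V t) ` ?S) \<in> (\<lambda>V. lnvol ?L V t) ` ?S" using fS by (intro Min_in) auto
    then obtain V0 where V0: "Min ((\<lambda>V. lnvol ?L V t) ` ?S) = lnvol ?L V0 t" "V0 \<in> ?S" by (rule imageE)
    have le: "lnvol ?L V0 t \<le> lnvol ?L V t" if "V \<in> ?S" for V
      unfolding V0(1)[symmetric] using fS that by (intro Min_le) auto
    have "V1 \<in> ?S" using V1 by simp
    then have "lnvol ?L V0 t < 0" using le V1(2) by fastforce
    moreover have "lnvol ?L V0 t \<le> lnvol ?L V t" if "V \<in> ?I" for V
      using le[of V] that \<open>lnvol ?L V0 t < 0\<close> by (cases "lnvol ?L V t \<le> 0") auto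
    ultimately show ?thesis using V0(2) by blast
  qed
  define a where "a t = (INF V\<in>?I. lnvol ?L V t)" for t
  have bdd: "bdd_below ((\<lambda>V. lnvol ?L V t) ` ?I)" for t
  proof -
    obtain V0 where "\<forall>V\<in>?I. lnvol ?L V0 t \<le> lnvol ?L V t" using min[of t] by blast
    then show ?thesis by (intro bdd_belowI2[of ?I "lnvol ?L V0 t"]) blast
  qed
  have a_le: "a t \<le> lnvol ?L V t" if "V \<in> ?I" for V t unfolding a_def by (rule cINF_lower[OF bdd that])
  have a_neg: "a t < 0" for t using min[of t] a_le[of _ t] by fastforce
  have a_att: "\<exists>V\<in>?I. lnvol ?L V t = a t" for t
  proof -
    obtain V0 where V0: "V0 \<in> ?I" "\<forall>V\<in>?I. lnvol ?L V0 t \<le> lnvol ?L V t" using min[of t] by blast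
    then have "lnvol ?L V0 t \<le> a t" unfolding a_def using I0 by (intro cINF_greatest) auto
    then show ?thesis using V0(1) a_le[OF V0(1), of t] by force
  qed
  have lip: "\<bar>lnvol ?L V s - lnvol ?L V t\<bar> \<le> ?n * norm (s - t)" if "V \<in> ?I" for V s t
    using that by (intro lnvol_lipschitz[OF L]) auto
  have a_lip: "\<bar>a s - a t\<bar> \<le> ?n * norm (s - t)" for s t
    unfolding a_def by (rule lipschitz_INF[OF I0 lip bdd])
  \<comment> \<open>The scale is set by q V + 1 \<le> n^2 for proper nonzero \<open>V\<close>: at a
    minimiser of \<open>lnvol\<close> even \<open>\<epsilon> t * (q V + 1)\<close> is at most
    \<open>- a t\<close>.\<close>
  define \<epsilon> where "\<epsilon> t = - a t / ?n\<^sup>2" for t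
  have n0: "?n > 0" by simp
  have \<epsilon>: "\<epsilon> t > 0" for t     using divide_neg_pos[OF a_neg[of t], of "?n\<^sup>2"] by (simp add: \<epsilon>_def)
  \<comment> \<open>By strict concavity, replacing dimensions d + i and d + j by d and d + i + j
    lowers the sum of \<open>q\<close> by 2 i j, which is at least 2 in the non-nested case.\<close>
  define q where "q V = real (dim V) * (?n - real (dim V))" for V :: "(real^'n) set"
  have dim_le: "real (dim V) \<le> ?n" for V :: "(real^'n) set" using dim_subset_UNIV_cart[of V] by simp
  have q: "0 \<le> q V" "q V \<le> ?n\<^sup>2" for V
    unfolding q_def power2_eq_square using dim_le[of V] by (auto intro!: mult_mono)
  define G where "G V t = lnvol ?L V t + \<epsilon> t * q V" for V t
  have G_lip: "\<bar>G V s - G V t\<bar> \<le> (2 * ?n) * norm (s - t)" if "V \<in> ?I" for V s t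
  proof -
    have "\<epsilon> s * q V - \<epsilon> t * q V = - ((q V / ?n\<^sup>2) * (a s - a t))"
      by (simp add: \<epsilon>_def field_simps)
    then have "\<bar>\<epsilon> s * q V - \<epsilon> t * q V\<bar> = (q V / ?n\<^sup>2) * \<bar>a s - a t\<bar>"
      using q[of V] by (simp add: abs_mult)
    also have "\<dots> \<le> 1 * \<bar>a s - a t\<bar>" using q[of V] n0 by (intro mult_right_mono) (auto simp: divide_le_eq)
    also have "\<dots> \<le> ?n * norm (s - t)" using a_lip[of s t] by simp
    finally have "\<bar>\<epsilon> s * q V - \<epsilon> t * q V\<bar> \<le> ?n * norm (s - t)" .
    moreover have "G V s - G V t = (lnvol ?L V s - lnvol ?L V t) + (\<epsilon> s * q V - \<epsilon> t * q V)"
      by (simp add: G_def)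
    ultimately show ?thesis using lip[OF that, of s t] abs_triangle_ineq[of "lnvol ?L V s - lnvol ?L V t" "\<epsilon> s * q V - \<epsilon> t * q V"]
      by (simp add: mult.assoc)
  qed
  have G_ge: "lnvol ?L V t \<le> G V t" for V t using \<epsilon>[of t] q(1)[of V] by (simp add: G_def)
  have G_bdd: "bdd_below ((\<lambda>V. G V t) ` ?I)" for t
    by (rule bdd_belowI2[of _ "a t"]) (use a_le G_ge order_trans in blast)
  define m where "m t = (INF V\<in>?I. G V t)" for t
  have m_le: "m t \<le> G V t" if "V \<in> ?I" for V t unfolding m_def by (rule cINF_lower[OF G_bdd that])
  have m_lip: "\<bar>m s - m t\<bar> \<le> (2 * ?n) * norm (s - t)" for s t
    unfolding m_def by (rule lipschitz_INF[OF I0 G_lip G_bdd])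
  have dims: "1 \<le> real (dim V)" "real (dim V) \<le> ?n - 1" if "V \<in> ?I" for V
  proof -
    have V: "subspace V" "V \<noteq> {0}" "V \<noteq> UNIV" using that rational_subspace_subspace by blast+
    have "dim V \<noteq> 0" using V subspace_0 by (auto simp: dim_eq_0)
    then show "1 \<le> real (dim V)" by linarith
    have "dim V \<noteq> CARD('n)"
    proof
      assume "dim V = CARD('n)"
      then have "span V = UNIV" using dim_eq_full[of V] by simp
      then show False using V(1,3) span_eq_iff[of V] by metis
    qed
    then show "real (dim V) \<le> ?n - 1" using dim_subset_UNIV_cart[of V] by linarith
  qed
  have m_neg: "m t + \<epsilon> t \<le> 0" for t
  proof -
    obtain V where V: "V \<in> ?I" "lnvol ?L V t = a t" using a_att by blast
    have "q V \<le> (?n - 1) * (?n - 1)" unfolding q_def using dims[OF V(1)] by (intro mult_mono) auto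
    then have "q V + 1 \<le> ?n\<^sup>2" using dims[OF V(1)] by (simp add: power2_eq_square algebra_simps)
    then have "(q V + 1) / ?n\<^sup>2 \<le> 1" using n0 by (simp add: divide_le_eq)
    then have "\<epsilon> t * (q V + 1) \<le> - a t"
      using mult_left_mono[of "(q V + 1) / ?n\<^sup>2" 1 "- a t"] a_neg[of t] by (simp add: \<epsilon>_def)
    then show ?thesis using m_le[OF V(1), of t] V(2) by (simp add: G_def distrib_left)
  qed
  \<comment> \<open>Active subspaces have perturbed value within \<open>\<epsilon> t\<close> of the
    infimum. By \<open>m_neg\<close> this window ends at or below 0, so their \<open>lnvol\<close>
    is negative.\<close>
  define w where "w V t = max 0 (m t + \<epsilon> t - G V t)" for V t
  have "\<exists>t. \<forall>V\<in>?I. w V t = 0"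
  proof (rule no_flag_cover[OF g])
    fix V assume V: "V \<in> ?I"
    have "continuous_on UNIV m" "continuous_on UNIV (G V)" "continuous_on UNIV a"
      using m_lip G_lip[OF V] a_lip by (auto intro!: lipschitz_continuous)
    then show "continuous_on UNIV (w V)"
      unfolding w_def \<epsilon>_def by (intro continuous_intros) auto
    show "w V t \<ge> 0" for t by (simp add: w_def)
    show "lnvol ?L V t \<le> 0" if "w V t > 0" for t
      using that m_neg[of t] G_ge[of V t] unfolding w_def by linarith
  next
    fix V W t assume VW: "V \<in> ?I" "W \<in> ?I" "w V t > 0" "w W t > 0"
    show "V \<subseteq> W \<or> W \<subseteq> V"
    proof (rule ccontr)
      assume not_nested: "\<not> ?thesis"
      have rV: "rational_subspace ?L V" and rW: "rational_subspace ?L W" using VW by blast+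
      obtain U S i j where U: "rational_subspace ?L U" "U \<subseteq> V" and S: "rational_subspace ?L S" "W \<subseteq> S"
        and dV: "dim V = dim U + i" and dW: "dim W = dim U + j" and dS: "dim S = dim U + i + j"
        and ij: "i = 0 \<longrightarrow> V \<subseteq> W" "j = 0 \<longrightarrow> W \<subseteq> V"
        and sm: "\<And>t. lnvol ?L U t + lnvol ?L S t \<le> lnvol ?L V t + lnvol ?L W t"
        by (rule lnvol_submodular[OF L rV rW]) blast
      have "i \<ge> 1" "j \<ge> 1" using ij not_nested by auto
      then have "real i * real j \<ge> 1 * 1" by (intro mult_mono) auto
      moreover have "q U + q S = q V + q W - 2 * (real i * real j)"
        by (simp add: q_def dV dW dS algebra_simps)
      ultimately have "q U + q S \<le> q V + q W - 2" by linarith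
      then have "\<epsilon> t * (q U + q S) \<le> \<epsilon> t * (q V + q W - 2)" using \<epsilon>[of t] by (intro mult_left_mono) auto
      then have "G U t + G S t \<le> G V t + G W t - 2 * \<epsilon> t"
        using sm[of t] unfolding G_def by (simp add: algebra_simps)
      also have "\<dots> < 2 * m t" using VW(3,4) unfolding w_def by linarith
      finally have lt: "G U t + G S t < 2 * m t" .
      \<comment> \<open>\<open>U\<close> may be \<open>{0}\<close> and \<open>S\<close> the whole
        space, which the infimum \<open>m t\<close> does not range over. There \<open>G\<close> is
        nonnegative while \<open>m t\<close> is at most 0.\<close>
      have m0: "m t \<le> 0" using m_neg[of t] \<epsilon>[of t] by linarith
      have "G U t \<ge> m t"
      proof (cases "U = {0}")
        case True
        then show ?thesis using m0 lnvol_zero[OF L, of t] by (simp add: G_def q_def)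
      next
        case False
        moreover have "U \<noteq> UNIV" using U(2) VW(1) by blast
        ultimately show ?thesis using U(1) by (intro m_le) simp
      qed
      moreover have "G S t \<ge> m t"
      proof (cases "S = UNIV")
        case True
        then have "lnvol ?L S t \<ge> 0" using lnvol_UNIV_nonneg(2)[OF det, of t] by simp
        then show ?thesis using m0 G_ge[of S t] by linarith
      next
        case False
        moreover have "0 \<in> W" "W \<noteq> {0}" using rW VW(2) subspace_0[OF rational_subspace_subspace] by blast+
        then have "S \<noteq> {0}" using S(2) by blast
        ultimately show ?thesis using S(1) by (intro m_le) simp
      qed
      ultimately show False using lt by linarith
    qed
  qed
  then obtain t where t: "\<And>V. V \<in> ?I \<Longrightarrow> w V t = 0" by blast
  \<comment> \<open>If all weights vanish, no value of \<open>G\<close> lies in the window just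
    above its own infimum.\<close>
  have "m t + \<epsilon> t \<le> m t"
    unfolding m_def[of t]
  proof (rule cINF_greatest[OF I0])
    fix V assume "V \<in> ?I"
    then show "(INF V\<in>?I. G V t) + \<epsilon> t \<le> G V t" using t[of V] unfolding w_def m_def by linarith
  qed
  then show False using \<epsilon>[of t] by linarith
qed

section \<open>Passage to the diagonal group\<close>

definition diagmat :: "real^'n \<Rightarrow> real^'n^'n" where
  "diagmat t = (\<chi> i j. if i = j then exp (t $ i) else 0)"

lemma diagmat_mult: "diagmat t *v x = scl t x"
  by (simp add: vec_eq_iff diagmat_def matrix_vector_mult_def if_distrib[of "\<lambda>x. x * _"] cong: if_cong)

lemma det_diagmat: "det (diagmat t) = exp (\<Sum>j\<in>UNIV. t $ j)"
  by (subst det_diagonal) (auto simp: diagmat_def exp_sum)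

lemma diagmat_diagA: "(\<Sum>j\<in>UNIV. t $ j) = 0 \<Longrightarrow> diagmat t \<in> diagA"
  using det_diagmat[of t] by (simp add: diagA_def) (simp add: diagmat_def)

lemma act_diagmat: "act (diagmat t) L = scl t ` L"
  by (simp add: act_def diagmat_mult)

lemma scl_Zlattice: "scl t ` Zlattice g = Zlattice (diagmat t ** g)"
  by (simp add: Zlattice_def image_image matrix_vector_mul_assoc[symmetric] diagmat_mult)

lemma lattices_X_eq: "L \<in> lattices_X \<longleftrightarrow> (\<exists>g. det g = 1 \<and> L = Zlattice g)"
  by (simp add: lattices_X_def Zlattice_def)

lemma act_diagmat_lattices_X:
  assumes "det g = 1" "(\<Sum>j\<in>UNIV. t $ j) = 0"
  shows "act (diagmat t) (Zlattice g) \<in> lattices_X"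
  unfolding lattices_X_eq act_diagmat scl_Zlattice
  by (intro exI[of _ "diagmat t ** g"]) (simp add: det_mul det_diagmat assms)

definition center :: "real^'n \<Rightarrow> real^'n" where
  "center t = t + (\<chi> j. - (\<Sum>i\<in>UNIV. t $ i) / CARD('n))"

lemma sum_center: "(\<Sum>j\<in>UNIV. center t $ j) = 0"
  by (simp add: center_def sum.distrib sum_negf sum_subtractf)

text \<open>Scaled back, a basis of an arbitrary subgroup generates a subgroup of finite index in L
  \<inter> V, with V its span. So its covolume is at least that of a rational subspace, and these
  suffice.\<close>

lemma stable_orbit_point_exists:
  fixes L :: "(real^'n) set"
  assumes "L \<in> lattices_X"
  shows "\<exists>a\<in>diagA. act a L \<in> ST"
proof -
  obtain g :: "real^'n^'n" where det: "det g = 1" and Lg: "L = Zlattice g"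
    using assms lattices_X_eq by blast
  have g: "invertible g" using det by (simp add: invertible_det_nz)
  note L = discrete_subgroup_Zlattice[OF g]
  obtain t0 where t0: "\<And>V. V \<in> proper_subspaces (Zlattice g) \<Longrightarrow> lnvol (Zlattice g) V t0 \<ge> 0"
    using stable_point_exists[OF det] by blast
  define t where "t = center t0"
  have t_sum: "(\<Sum>j\<in>UNIV. t $ j) = 0" unfolding t_def by (rule sum_center)
  have t: "lnvol L V t \<ge> 0" if "rational_subspace L V" for V
  proof -
    have "lnvol L V t0 \<ge> 0"
      using that t0[of V] lnvol_zero[OF L, of t0] lnvol_UNIV_nonneg(2)[OF det, of t0] unfolding Lg
      by (cases "V = {0} \<or> V = UNIV") auto
    then show ?thesis unfolding t_def center_def using lnvol_shift[OF L] that Lg by metis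
  qed
  have "cov G \<ge> 1" if "is_subgroup G (act (diagmat t) L)" for G
  proof -
    have GL: "G \<subseteq> scl t ` L" and G0: "0 \<in> G" and Gd: "\<And>x y. x \<in> G \<Longrightarrow> y \<in> G \<Longrightarrow> x - y \<in> G"
      using that by (auto simp: is_subgroup_def act_diagmat)
    have "invertible (diagmat t ** g)"
      using det by (simp add: invertible_det_nz det_mul det_diagmat)
    then have "discrete_subgroup (scl t ` L)"
      unfolding Lg scl_Zlattice by (rule discrete_subgroup_Zlattice)
    then have "discrete_subgroup G"
      using GL G0 Gd finite_subset[of "{x\<in>G. norm x \<le> _}"] unfolding discrete_subgroup_def
      by (auto intro: rev_finite_subset)
    then obtain vs0 where "is_Zbasis G vs0" by (rule is_Zbasis_exists)
    \<comment> \<open>\<open>cov\<close> is defined through a chosen basis, and the estimate is made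
      for exactly that choice.\<close>
    define vs where "vs = (SOME vs. is_Zbasis G vs)"
    have vs: "is_Zbasis G vs" unfolding vs_def using \<open>is_Zbasis G vs0\<close> by (rule someI)
    define ws where "ws = map (scl (- t)) vs"
    have vw: "map (scl t) ws = vs" unfolding ws_def map_map by (rule map_idI) (simp add: scl_scl)
    have "scl (- t) ` (scl t ` L) = L" by (simp add: image_image scl_scl)
    moreover have "set ws \<subseteq> scl (- t) ` (scl t ` L)"
      using is_Zbasis_subset[OF vs] GL unfolding ws_def set_map by (intro image_mono) blast
    ultimately have wsL: "set ws \<subseteq> L" by simp
    have "inj_on (scl (- t)) S" for S using inj_scl inj_on_subset by blast
    then have "distinct ws" "independent (set ws)"
      using vs linear_independent_injective_image[OF linear_scl, of "set vs" "- t"]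
      by (auto simp: ws_def is_Zbasis_def distinct_map)
    note ws = wsL this
    have "0 \<le> lnvol L (span (set ws)) t" by (rule t[OF rational_subspace_span[OF wsL]])
    also have "\<dots> \<le> ln (gram_det vs) / 2" using lnvol_le[OF L[folded Lg] ws, of t] t_sum vw by simp
    finally have "0 \<le> ln (gram_det vs)" by simp
    moreover have "gram_det vs > 0" using vs by (intro gram_det_pos) (auto simp: is_Zbasis_def)
    ultimately have "gram_det vs \<ge> 1" by simp
    then show ?thesis by (simp add: cov_def vs_def)
  qed
  then have "act (diagmat t) L \<in> ST"
    using act_diagmat_lattices_X[OF det t_sum] by (simp add: ST_def Lg)
  then show ?thesis using diagmat_diagA[OF t_sum] by blast
qed

section \<open>Short vectors\<close>

text \<open>There are \<open>(m + 1)\<^sup>n\<close> vectors \<open>g z\<close> with \<open>z \<in> {0..m}\<^sup>n\<close>, and for large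
  \<open>m\<close> their images under \<open>scl t\<close> lie in at most \<open>m\<^sup>n\<close> cubes of a size that is
  independent of \<open>t\<close>.\<close>

lemma short_vector_exists:
  fixes g :: "real^'n^'n"
  assumes g: "invertible g"
  obtains K where "\<And>t. (\<Sum>j\<in>UNIV. t $ j) = 0 \<Longrightarrow> \<exists>v\<in>Zlattice g. v \<noteq> 0 \<and> norm (scl t v) \<le> K"
proof -
  define \<Gamma> where "\<Gamma> = 1 + (\<Sum>i\<in>UNIV. \<Sum>j\<in>UNIV. \<bar>g $ i $ j\<bar>)"
  have \<Gamma>: "\<Gamma> > 0" unfolding \<Gamma>_def by (intro add_pos_nonneg sum_nonneg) auto
  have row: "(\<Sum>j\<in>UNIV. \<bar>g $ i $ j\<bar>) \<le> \<Gamma>" for i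
    unfolding \<Gamma>_def using member_le_sum[of i UNIV "\<lambda>i. \<Sum>j\<in>UNIV. \<bar>g $ i $ j\<bar>"] by (simp add: sum_nonneg)
  have short: "\<exists>v\<in>Zlattice g. v \<noteq> 0 \<and> norm (scl t v) \<le> CARD('n) * (4 * \<Gamma>)"
    if t: "(\<Sum>j\<in>UNIV. t $ j) = 0" for t
  proof -
    \<comment> \<open>This gives m exp(t_i) \<ge> 4. With y = m exp(t_i) / 4, coordinate i meets at
      most 2 y + 2 \<le> m exp(t_i) cells of side 4 \<Gamma>, and these counts multiply to m^n
      because the t_i sum to 0.\<close>
    define m where "m = nat \<lceil>\<Sum>i\<in>UNIV. 4 * exp (- t $ i)\<rceil>"
    have m: "4 \<le> real m * exp (t $ i)" for i
    proof -
      have "4 * exp (- t $ i) \<le> (\<Sum>i\<in>UNIV. 4 * exp (- t $ i))" by (rule member_le_sum) auto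
      also have "\<dots> \<le> real m" unfolding m_def by (rule real_nat_ceiling_ge)
      finally have "4 * exp (- t $ i) * exp (t $ i) \<le> real m * exp (t $ i)" by (rule mult_right_mono) simp
      then show ?thesis by (simp add: mult.assoc exp_add[symmetric])
    qed
    define Z where "Z = PiE (UNIV :: 'n set) (\<lambda>_. {..m})"
    define x where "x z = (\<chi> j. real (z j) :: real^'n)" for z :: "'n \<Rightarrow> nat"
    define f where "f z i = \<lfloor>exp (t $ i) * (g *v x z) $ i / (4 * \<Gamma>)\<rfloor>" for z i
    define T where "T = PiE (UNIV :: 'n set) (\<lambda>i. {\<lfloor>- (real m * exp (t $ i) / 4)\<rfloor>..\<lfloor>real m * exp (t $ i) / 4\<rfloor>})"
    have "f ` Z \<subseteq> T"
    proof (rule image_subsetI)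
      fix z assume z: "z \<in> Z"
      have "f z i \<in> {\<lfloor>- (real m * exp (t $ i) / 4)\<rfloor>..\<lfloor>real m * exp (t $ i) / 4\<rfloor>}" for i
      proof -
        have "\<bar>(g *v x z) $ i\<bar> \<le> (\<Sum>j\<in>UNIV. \<bar>g $ i $ j\<bar> * real (z j))"
          unfolding matrix_vector_mult_def x_def
          by (simp, rule order_trans[OF sum_abs]) (simp add: abs_mult)
        also have "\<dots> \<le> (\<Sum>j\<in>UNIV. \<bar>g $ i $ j\<bar> * real m)"
          using z by (intro sum_mono mult_left_mono) (auto simp: Z_def PiE_def Pi_def)
        also have "\<dots> \<le> \<Gamma> * real m"
          unfolding sum_distrib_right[symmetric] by (intro mult_right_mono row) simp
        finally have "exp (t $ i) * \<bar>(g *v x z) $ i\<bar> \<le> exp (t $ i) * (\<Gamma> * real m)" by (intro mult_left_mono) auto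
        then have "\<bar>exp (t $ i) * (g *v x z) $ i / (4 * \<Gamma>)\<bar> \<le> real m * exp (t $ i) / 4"
          using \<Gamma> by (simp add: abs_mult divide_le_eq mult_ac)
        then have "- (real m * exp (t $ i) / 4) \<le> exp (t $ i) * (g *v x z) $ i / (4 * \<Gamma>)"
          "exp (t $ i) * (g *v x z) $ i / (4 * \<Gamma>) \<le> real m * exp (t $ i) / 4" by linarith+
        then show ?thesis unfolding f_def by (simp add: floor_mono)
      qed
      then show "f z \<in> T" by (simp add: T_def PiE_def Pi_def)
    qed
    moreover have "finite T" unfolding T_def by (intro finite_PiE) auto
    ultimately have "card (f ` Z) \<le> card T" by (intro card_mono)
    also have "real (card T) \<le> (\<Prod>i\<in>(UNIV :: 'n set). real m * exp (t $ i))"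
      unfolding T_def card_PiE[OF finite] of_nat_prod
    proof (intro prod_mono conjI)
      fix i
      let ?y = "real m * exp (t $ i) / 4"
      have "?y \<ge> 0" by simp
      then have "\<lfloor>- ?y\<rfloor> \<le> \<lfloor>?y\<rfloor>" by (intro floor_mono) linarith
      then have "real (card {\<lfloor>- ?y\<rfloor>..\<lfloor>?y\<rfloor>}) = of_int \<lfloor>?y\<rfloor> - of_int \<lfloor>- ?y\<rfloor> + 1" by simp
      also have "\<dots> \<le> 2 * ?y + 2" by linarith
      also have "\<dots> \<le> real m * exp (t $ i)" using m[of i] by linarith
      finally show "real (card {\<lfloor>- ?y\<rfloor>..\<lfloor>?y\<rfloor>}) \<le> real m * exp (t $ i)" .
    qed auto
    also have "\<dots> = real m ^ CARD('n)" using t by (simp add: prod.distrib exp_sum[symmetric])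
    also have "\<dots> < real (card Z)"
      unfolding Z_def card_PiE[OF finite] by (simp add: power_strict_mono)
    finally have "card (f ` Z) < card Z" by simp
    then obtain y z where yz: "y \<in> Z" "z \<in> Z" "y \<noteq> z" "f y = f z"
      using pigeonhole[of f Z] by (auto simp: inj_on_def)
    have xI: "x y - x z \<in> int_vectors" by (simp add: int_vectors_def x_def)
    have x0: "x y - x z \<noteq> 0" using yz(3) by (auto simp: x_def vec_eq_iff fun_eq_iff)
    define v where "v = g *v (x y - x z)"
    have comp: "\<bar>scl t v $ i\<bar> \<le> 4 * \<Gamma>" for i
    proof -
      let ?u = "exp (t $ i) * (g *v x y) $ i / (4 * \<Gamma>)" and ?w = "exp (t $ i) * (g *v x z) $ i / (4 * \<Gamma>)"
      have "\<lfloor>?u\<rfloor> = \<lfloor>?w\<rfloor>" using yz(4) unfolding f_def by (rule fun_cong)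
      then have "\<bar>?u - ?w\<bar> \<le> 1" by linarith
      moreover have "scl t v $ i = (?u - ?w) * (4 * \<Gamma>)"
        using \<Gamma> by (simp add: v_def matrix_vector_mult_diff_distrib left_diff_distrib right_diff_distrib)
      ultimately show ?thesis using \<Gamma> mult_right_mono[of "\<bar>?u - ?w\<bar>" 1 "4 * \<Gamma>"] by (simp add: abs_mult)
    qed
    have "norm (scl t v) \<le> (\<Sum>i\<in>UNIV. \<bar>scl t v $ i\<bar>)" by (rule norm_le_l1_cart)
    also have "\<dots> \<le> (\<Sum>i\<in>(UNIV :: 'n set). 4 * \<Gamma>)" by (intro sum_mono comp)
    finally have "norm (scl t v) \<le> CARD('n) * (4 * \<Gamma>)" by simp
    moreover have "v \<in> Zlattice g" unfolding v_def Zlattice_def using xI by (rule imageI)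
    moreover have "v \<noteq> 0" using x0 g inj_matrix_vector_mult[OF g] unfolding v_def
      by (metis injD matrix_vector_mult_0_right)
    ultimately show ?thesis by blast
  qed
  show thesis by (rule that[OF short])
qed

section \<open>Well-rounded lattices\<close>

text \<open>A weak form of Hadamard's inequality: no height exceeds the length of its
  vector.\<close>

lemma gram_det_le_power:
  assumes "\<And>v. v \<in> set vs \<Longrightarrow> norm v \<le> M"
  shows "gram_det vs \<le> M ^ (2 * length vs)"
proof -
  have "gram_det vs \<le> (\<Prod>i<length vs. M\<^sup>2)"
    unfolding gram_det_eq_prod_infdist
  proof (intro prod_mono conjI power_mono infdist_nonneg)
    fix i assume "i \<in> {..<length vs}"
    then have "norm (vs ! i) \<le> M" using assms by simp
    moreover have "infdist (vs ! i) (span (set (take i vs))) \<le> dist (vs ! i) 0"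
      by (rule infdist_le) (rule span_zero)
    ultimately show "infdist (vs ! i) (span (set (take i vs))) \<le> M" by simp
  qed auto
  then show ?thesis by (simp add: power_mult)
qed

lemma norm_scl_diff: "norm (scl s v - v) \<le> (exp (norm s) - 1) * norm v"
proof -
  have "norm (scl s v - v) \<le> norm ((exp (norm s) - 1) *\<^sub>R v)"
  proof (rule norm_le_componentwise_cart)
    fix i
    have le: "\<bar>s $ i\<bar> \<le> norm s" by (rule component_le_norm_cart)
    have "exp (s $ i) \<le> exp (norm s)" using le by simp
    moreover have "1 - exp (s $ i) \<le> exp (norm s) - 1"
    proof -
      have "1 + s $ i \<le> exp (s $ i)" "1 + norm s \<le> exp (norm s)" by (rule exp_ge_add_one_self)+
      then show ?thesis using le by linarith
    qed
    ultimately have "\<bar>exp (s $ i) - 1\<bar> \<le> exp (norm s) - 1" by linarith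
    then have "\<bar>exp (s $ i) - 1\<bar> * \<bar>v $ i\<bar> \<le> (exp (norm s) - 1) * \<bar>v $ i\<bar>" by (rule mult_right_mono) simp
    moreover have "(scl s v - v) $ i = (exp (s $ i) - 1) * v $ i" by (simp add: algebra_simps)
    ultimately show "norm ((scl s v - v) $ i) \<le> norm (((exp (norm s) - 1) *\<^sub>R v) $ i)" by (simp add: abs_mult)
  qed
  then show ?thesis by simp
qed

text \<open>Exchanging \<open>s\<close> and \<open>t\<close> squeezes \<open>F s\<close> between
  \<open>F t / k s\<close> and \<open>k s * F t\<close>, with \<open>k s\<close> tending to 1. The
  factor in \<open>N_scl_ratio\<close> is the same for all vectors, so infima of lengths inherit
  such a bound.\<close>

lemma ratio_continuous:
  fixes F :: "'a::real_normed_vector \<Rightarrow> real"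
  assumes C: "C \<ge> 0" and ratio: "\<And>s t. F s \<le> (1 + C * (exp (norm (s - t)) - 1)) * F t"
  shows "continuous_on UNIV F"
proof -
  have "isCont F t" for t
  proof -
    define k where "k s = 1 + C * (exp (norm (s - t)) - 1)" for s
    have k1: "k s \<ge> 1" for s using C by (simp add: k_def)
    have "(k \<longlongrightarrow> 1 + C * (exp (norm (t - t)) - 1)) (at t)"
      unfolding k_def by (intro tendsto_intros)
    then have k: "(k \<longlongrightarrow> 1) (at t)" by simp
    have "F t / k s \<le> F s" for s
      using ratio[of t s] k1[of s] by (simp add: k_def norm_minus_commute divide_le_eq mult.commute)
    moreover have "F s \<le> k s * F t" for s using ratio[of s t] by (simp add: k_def)
    moreover have "((\<lambda>s. F t / k s) \<longlongrightarrow> F t / 1) (at t)" "((\<lambda>s. k s * F t) \<longlongrightarrow> 1 * F t) (at t)"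
      by (intro tendsto_intros k; simp)+
    ultimately have "(F \<longlongrightarrow> F t) (at t)"
      by (intro tendsto_sandwich[of "\<lambda>s. F t / k s" F "at t" "\<lambda>s. k s * F t"]) auto
    then show ?thesis by (simp add: isCont_def)
  qed
  then show ?thesis by (simp add: continuous_at_imp_continuous_on)
qed

context
  fixes N :: "real^'n \<Rightarrow> real"
  assumes N: "is_norm N"
begin

lemma N_nonneg: "N x \<ge> 0" and N_zero: "N x = 0 \<longleftrightarrow> x = 0"
  and N_scale: "N (c *\<^sub>R x) = \<bar>c\<bar> * N x" and N_triangle: "N (x + y) \<le> N x + N y"
  using N unfolding is_norm_def by blast+

lemma N_sum: "N (sum f A) \<le> (\<Sum>i\<in>A. N (f i))"
proof (induction A rule: infinite_finite_induct)
  case (insert x A)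
  then show ?case using N_triangle[of "f x" "sum f A"] by simp
qed (use N_zero[of 0] in simp_all)

lemma N_equivalent: "\<exists>C\<ge>1. (\<forall>x. N x \<le> C * norm x) \<and> (\<forall>x. norm x \<le> C * N x)"
proof -
  define C1 where "C1 = (\<Sum>i\<in>UNIV. N (axis i 1))"
  have C1: "N x \<le> C1 * norm x" for x
  proof -
    have "N x = N (\<Sum>i\<in>UNIV. (x $ i) *\<^sub>R axis i 1)"
      by (subst basis_expansion[of x, symmetric]) (simp add: scalar_mult_eq_scaleR)
    also have "\<dots> \<le> (\<Sum>i\<in>UNIV. N ((x $ i) *\<^sub>R axis i 1))" by (rule N_sum)
    also have "\<dots> \<le> (\<Sum>i\<in>UNIV. N (axis i 1) * norm x)"
      unfolding N_scale mult.commute[of "N _"]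
      by (intro sum_mono mult_right_mono component_le_norm_cart N_nonneg)
    finally show ?thesis by (simp add: C1_def sum_distrib_right)
  qed
  have lip: "\<bar>N x - N y\<bar> \<le> C1 * norm (x - y)" for x y
  proof -
    have *: "N x - N y \<le> C1 * norm (x - y)" for x y
      using N_triangle[of "x - y" y] C1[of "x - y"] by simp
    show ?thesis using *[of x y] *[of y x] by (simp add: abs_le_iff norm_minus_commute)
  qed
  have "continuous_on (sphere 0 1) N"
    using lipschitz_continuous[OF lip] continuous_on_subset by blast
  moreover have "sphere (0 :: real^'n) 1 \<noteq> {}" by simp
  ultimately obtain u where u: "u \<in> sphere 0 1" "\<And>x. x \<in> sphere 0 1 \<Longrightarrow> N u \<le> N x"
    using continuous_attains_inf[OF compact_sphere] by metis
  have "N u > 0" using u(1) N_nonneg[of u] N_zero[of u] by (auto simp: less_le)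
  have C2: "norm x \<le> (1 / N u) * N x" for x
  proof (cases "x = 0")
    case False
    then have "N u \<le> N ((1 / norm x) *\<^sub>R x)" by (intro u(2)) simp
    then have "N u * norm x \<le> N x" using False by (simp add: N_scale pos_le_divide_eq)
    then show ?thesis using \<open>N u > 0\<close> by (simp add: pos_le_divide_eq mult.commute)
  qed (simp add: N_nonneg)
  show ?thesis
  proof (intro exI[of _ "max 1 (max C1 (1 / N u))"] conjI allI)
    fix x
    show "N x \<le> max 1 (max C1 (1 / N u)) * norm x"
      by (rule order_trans[OF C1]) (intro mult_right_mono, auto)
    show "norm x \<le> max 1 (max C1 (1 / N u)) * N x"
      by (rule order_trans[OF C2]) (intro mult_right_mono N_nonneg, auto)
  qed simp
qed

text \<open>The displacement is small relative to \<open>u\<close> in the Euclidean norm; passing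
  from \<open>N\<close> to it and back costs \<open>C * C\<close>.\<close>

lemma N_scl_ratio:
  assumes C: "C \<ge> 1" "\<And>x. N x \<le> C * norm x" "\<And>x. norm x \<le> C * N x"
  shows "N (scl s v) \<le> (1 + (C * C) * (exp (norm (s - t)) - 1)) * N (scl t v)"
proof -
  define u where "u = scl t v"
  have e: "exp (norm (s - t)) - 1 \<ge> 0" by simp
  have "scl s v = u + (scl (s - t) u - u)" by (simp add: u_def scl_scl)
  then have "N (scl s v) \<le> N u + N (scl (s - t) u - u)" by (metis N_triangle)
  also have "N (scl (s - t) u - u) \<le> C * ((exp (norm (s - t)) - 1) * norm u)"
    using C(1) norm_scl_diff[of "s - t" u] by (intro order_trans[OF C(2)] mult_left_mono) auto
  also have "\<dots> \<le> C * ((exp (norm (s - t)) - 1) * (C * N u))"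
    using C(1) e by (intro mult_left_mono C(3)) auto
  finally show ?thesis by (simp add: u_def algebra_simps)
qed

definition outer_min :: "(real^'n) set \<Rightarrow> (real^'n) set \<Rightarrow> real^'n \<Rightarrow> real" where
  "outer_min L V t = (INF v\<in>L - V. N (scl t v))"

text \<open>The last successive minimum of the scaled L \<inter> V. When it is below
  \<open>outer_min\<close>, the vectors up to this length span exactly \<open>V\<close>.\<close>

definition inner_max :: "(real^'n) set \<Rightarrow> (real^'n) set \<Rightarrow> real^'n \<Rightarrow> real" where
  "inner_max L V t = Inf {r. r \<ge> 0 \<and> span {v\<in>L \<inter> V. N (scl t v) \<le> r} = V}"

lemma outer_min_le: "v \<in> L \<Longrightarrow> v \<notin> V \<Longrightarrow> outer_min L V t \<le> N (scl t v)"
  unfolding outer_min_def by (intro cINF_lower bdd_belowI2[of _ 0]) (auto simp: N_nonneg)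

lemma outer_min_continuous:
  assumes "L - V \<noteq> {}"
  shows "continuous_on UNIV (outer_min L V)"
proof -
  obtain C where C: "C \<ge> 1" "\<And>x. N x \<le> C * norm x" "\<And>x. norm x \<le> C * N x" using N_equivalent by blast
  show ?thesis
  proof (rule ratio_continuous)
    show "C * C \<ge> 0" using C(1) by simp
    fix s t :: "real^'n"
    define k where "k = 1 + (C * C) * (exp (norm (s - t)) - 1)"
    have k: "k > 0" using C(1) by (simp add: k_def add_pos_nonneg)
    have "outer_min L V s / k \<le> outer_min L V t"
      unfolding outer_min_def[of L V t]
    proof (rule cINF_greatest[OF assms])
      fix v assume v: "v \<in> L - V"
      have "outer_min L V s \<le> N (scl s v)" using v by (intro outer_min_le) auto
      also have "\<dots> \<le> k * N (scl t v)" unfolding k_def by (rule N_scl_ratio[OF C])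
      finally show "outer_min L V s / k \<le> N (scl t v)" using k by (simp add: pos_divide_le_eq mult.commute)
    qed
    then show "outer_min L V s \<le> (1 + (C * C) * (exp (norm (s - t)) - 1)) * outer_min L V t"
      using k unfolding k_def[symmetric] by (simp add: pos_divide_le_eq mult.commute)
  qed
qed

lemma inner_max_le: "r \<ge> 0 \<Longrightarrow> span {v\<in>L \<inter> V. N (scl t v) \<le> r} = V \<Longrightarrow> inner_max L V t \<le> r"
  unfolding inner_max_def by (rule cInf_lower) (auto intro: bdd_belowI[of _ 0])

lemma inner_max_set_nonempty:
  assumes L: "discrete_subgroup L" and V: "rational_subspace L V"
  shows "{r. r \<ge> 0 \<and> span {v\<in>L \<inter> V. N (scl t v) \<le> r} = V} \<noteq> {}"
proof -
  let ?b = "Zbas L V"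
  define r where "r = Max (insert 0 ((\<lambda>v. N (scl t v)) ` set ?b))"
  have r: "0 \<le> r" "\<And>v. v \<in> set ?b \<Longrightarrow> N (scl t v) \<le> r" by (auto simp: r_def)
  have b: "set ?b \<subseteq> L" "set ?b \<subseteq> V" using Zbas(1,5)[OF L V] span_superset by auto
  have "span {v\<in>L \<inter> V. N (scl t v) \<le> r} = V"
  proof
    show "span {v\<in>L \<inter> V. N (scl t v) \<le> r} \<subseteq> V"
      using rational_subspace_subspace[OF V] by (intro span_minimal) auto
    have "span (set ?b) \<subseteq> span {v\<in>L \<inter> V. N (scl t v) \<le> r}" using b r by (intro span_mono) auto
    then show "V \<subseteq> span {v\<in>L \<inter> V. N (scl t v) \<le> r}" by (simp add: Zbas(1)[OF L V])
  qed
  then show ?thesis using r(1) by blast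
qed

lemma inner_max_lessD:
  assumes L: "discrete_subgroup L" and V: "rational_subspace L V" and less: "inner_max L V t < R"
  obtains r where "0 \<le> r" "r < R" "span {v\<in>L \<inter> V. N (scl t v) \<le> r} = V"
  using cInf_lessD[OF inner_max_set_nonempty[OF L V] less[unfolded inner_max_def]] by blast

lemma inner_max_continuous:
  assumes L: "discrete_subgroup L" and V: "rational_subspace L V"
  shows "continuous_on UNIV (inner_max L V)"
proof -
  obtain C where C: "C \<ge> 1" "\<And>x. N x \<le> C * norm x" "\<And>x. norm x \<le> C * N x" using N_equivalent by blast
  show ?thesis
  proof (rule ratio_continuous)
    show "C * C \<ge> 0" using C(1) by simp
    fix s t :: "real^'n"
    define k where "k = 1 + (C * C) * (exp (norm (s - t)) - 1)"
    have k: "k > 0" using C(1) by (simp add: k_def add_pos_nonneg)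
    have "inner_max L V s / k \<le> inner_max L V t"
      unfolding inner_max_def[of L V t]
    proof (rule cInf_greatest[OF inner_max_set_nonempty[OF L V]])
      fix r assume "r \<in> {r. r \<ge> 0 \<and> span {v\<in>L \<inter> V. N (scl t v) \<le> r} = V}"
      then have r: "r \<ge> 0" "span {v\<in>L \<inter> V. N (scl t v) \<le> r} = V" by auto
      have "N (scl s v) \<le> k * r" if "N (scl t v) \<le> r" for v
        using N_scl_ratio[OF C, of s v t] mult_left_mono[OF that, of k] k unfolding k_def by linarith
      then have "span {v\<in>L \<inter> V. N (scl t v) \<le> r} \<subseteq> span {v\<in>L \<inter> V. N (scl s v) \<le> k * r}"
        by (intro span_mono) auto
      moreover have "span {v\<in>L \<inter> V. N (scl s v) \<le> k * r} \<subseteq> V"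
        using rational_subspace_subspace[OF V] by (intro span_minimal) auto
      ultimately have "span {v\<in>L \<inter> V. N (scl s v) \<le> k * r} = V" using r(2) by blast
      then have "inner_max L V s \<le> k * r" using r(1) k by (intro inner_max_le) auto
      then show "inner_max L V s / k \<le> r" using k by (simp add: pos_divide_le_eq mult.commute)
    qed
    then show "inner_max L V s \<le> (1 + (C * C) * (exp (norm (s - t)) - 1)) * inner_max L V t"
      using k unfolding k_def[symmetric] by (simp add: pos_divide_le_eq mult.commute)
  qed
qed

text \<open>\<open>V\<close> is spanned by lattice vectors shorter than every lattice vector outside
  \<open>W\<close>.\<close>

lemma inner_max_less_outer_min_nested:
  assumes L: "discrete_subgroup L" and V: "rational_subspace L V" and W: "subspace W"
    and less: "inner_max L V t < outer_min L W t"
  shows "V \<subseteq> W"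
proof -
  obtain r where r: "r < outer_min L W t" "span {v\<in>L \<inter> V. N (scl t v) \<le> r} = V"
    using inner_max_lessD[OF L V less] by metis
  have "{v\<in>L \<inter> V. N (scl t v) \<le> r} \<subseteq> W" using outer_min_le[of _ L W t] r(1) by fastforce
  then have "span {v\<in>L \<inter> V. N (scl t v) \<le> r} \<subseteq> W" using W by (rule span_minimal)
  then show ?thesis using r(2) by simp
qed

text \<open>Hadamard's bound for independent lattice vectors in \<open>V\<close> of scaled length
  below \<open>K\<close>.\<close>

lemma lnvol_le_inner_max:
  fixes L :: "(real^'n) set"
  assumes L: "discrete_subgroup L" and V: "rational_subspace L V" and t: "(\<Sum>j\<in>UNIV. t $ j) = 0"
    and M: "M \<ge> 1" "\<And>x. N x \<le> K \<Longrightarrow> norm x \<le> M" and less: "inner_max L V t < K"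
  shows "lnvol L V t \<le> CARD('n) * ln M"
proof -
  obtain r where r: "r < K" "span {v\<in>L \<inter> V. N (scl t v) \<le> r} = V"
    using inner_max_lessD[OF L V less] by metis
  obtain B where B: "B \<subseteq> {v\<in>L \<inter> V. N (scl t v) \<le> r}" "independent B"
      "{v\<in>L \<inter> V. N (scl t v) \<le> r} \<subseteq> span B"
    by (rule maximal_independent_subset)
  have "span B = V" using B r(2) by (metis span_mono span_span subset_antisym)
  obtain ws where ws: "set ws = B" "distinct ws"
    using finite_distinct_list[OF independent_imp_finite[OF B(2)]] by blast
  have len: "length ws \<le> CARD('n)"
    using independent_card_le[OF B(2)] ws distinct_card[OF ws(2)] by simp
  have pos: "gram_det (map (scl t) ws) > 0" using ws B(2) by (intro gram_det_scl_pos) auto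
  have "gram_det (map (scl t) ws) \<le> M ^ (2 * length (map (scl t) ws))"
    using B(1) ws r(1) by (intro gram_det_le_power M(2)) fastforce
  also have "\<dots> \<le> M ^ (2 * CARD('n))" using M(1) len by (intro power_increasing) auto
  finally have "ln (gram_det (map (scl t) ws)) \<le> ln (M ^ (2 * CARD('n)))"
    using pos M(1) by (intro ln_mono) auto
  also have "\<dots> = 2 * CARD('n) * ln M" using M(1) by (simp add: ln_realpow)
  finally show ?thesis
    using lnvol_le[OF L, of ws t] ws B t \<open>span B = V\<close> by (auto simp: subset_iff)
qed

text \<open>The strict inequality in \<open>succ_min\<close> makes the admissible radii an open ray:
  at radius \<mu> only 0 is available, beyond it everything is spanned. The infimum is \<mu> for
  every index.\<close>

lemma succ_min_eq:
  assumes lam: "\<mu> > 0" "span {v\<in>L. N v \<le> \<mu>} = UNIV" "\<And>v. v \<in> L \<Longrightarrow> v \<noteq> 0 \<Longrightarrow> \<mu> \<le> N v"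
    and i: "i \<in> {1..CARD('n)}"
  shows "succ_min N L i = \<mu>"
proof -
  have "{r. r > 0 \<and> dim (span {v\<in>L. N v < r}) \<ge> i} = {\<mu><..}"
  proof (intro Set.set_eqI iffI)
    fix r assume r: "r \<in> {r. r > 0 \<and> dim (span {v\<in>L. N v < r}) \<ge> i}"
    show "r \<in> {\<mu><..}"
    proof (rule ccontr)
      assume "r \<notin> {\<mu><..}"
      then have "{v\<in>L. N v < r} \<subseteq> {0}" using lam(3) by fastforce
      then have "dim {v\<in>L. N v < r} = 0" unfolding dim_eq_0 .
      then have "dim (span {v\<in>L. N v < r}) = 0" unfolding dim_span .
      then have "i \<le> 0" using r by (simp only: mem_Collect_eq)
      then show False using i by simp
    qed
  next
    fix r assume r: "r \<in> {\<mu><..}"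
    then have "span {v\<in>L. N v \<le> \<mu>} \<subseteq> span {v\<in>L. N v < r}" by (intro span_mono) auto
    then have "span {v\<in>L. N v < r} = UNIV" using lam(2) by auto
    then have "dim (span {v\<in>L. N v < r}) = CARD('n)" by (simp only: dim_UNIV DIM_cart DIM_real mult_1_right)
    then show "r \<in> {r. r > 0 \<and> dim (span {v\<in>L. N v < r}) \<ge> i}" using r lam(1) i by simp
  qed
  then show ?thesis by (simp add: succ_min_def)
qed

text \<open>A lattice that is not well rounded has a gap after its shortest vectors, whose span is then
  active in the following cover.\<close>

lemma well_rounded_orbit_point_exists:
  fixes L :: "(real^'n) set"
  assumes "L \<in> lattices_X"
  shows "\<exists>a\<in>diagA. act a L \<in> WR N"
proof -
  obtain g :: "real^'n^'n" where det: "det g = 1" and Lg: "L = Zlattice g"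
    using assms lattices_X_eq by blast
  have g: "invertible g" using det by (simp add: invertible_det_nz)
  have L: "discrete_subgroup L" unfolding Lg by (rule discrete_subgroup_Zlattice[OF g])
  obtain C where C: "C \<ge> 1" "\<And>x. N x \<le> C * norm x" "\<And>x. norm x \<le> C * N x" using N_equivalent by blast
  obtain K0 where K0: "\<And>t. (\<Sum>j\<in>UNIV. t $ j) = 0 \<Longrightarrow> \<exists>v\<in>L. v \<noteq> 0 \<and> norm (scl t v) \<le> K0"
    using short_vector_exists[OF g] unfolding Lg by blast
  have K0_nonneg: "K0 \<ge> 0" using K0[of 0] by (auto intro: order_trans[OF norm_ge_zero])
  \<comment> \<open>At centred points some nonzero lattice vector has length at most
    \<open>C * K0\<close>; the added 1 puts the first minimum strictly below
    \<open>K\<close>.\<close>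
  define K where "K = C * K0 + 1"
  \<comment> \<open>The cap forces \<open>inner_max\<close> below \<open>K\<close> for active
    \<open>V\<close>, hence the uniform bound on \<open>lnvol\<close>. As the first minimum lies
    below \<open>K\<close>, the cap cannot hide the gap after the shortest vectors.\<close>
  define w where "w V t = max 0 (min (outer_min L V (center t)) K - inner_max L V (center t))" for V t
  have cont_center: "continuous_on UNIV (center :: real^'n \<Rightarrow> _)"
    unfolding center_def by (intro continuous_intros continuous_on_vec_lambda) simp_all
  have ex_outer: "L - V \<noteq> {}" if "V \<in> proper_subspaces L" for V
  proof
    assume "L - V = {}"
    then have "span L \<subseteq> V" using that rational_subspace_subspace by (intro span_minimal) auto
    moreover have "span L = UNIV" using lnvol_UNIV_nonneg(1)[OF det] unfolding Lg rational_subspace_def by simp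
    ultimately show False using that by blast
  qed
  have "\<exists>t. \<forall>V\<in>proper_subspaces (Zlattice g). w V t = 0"
  proof (rule no_flag_cover[OF g, where c="CARD('n) * ln (C * K)"], unfold Lg[symmetric])
    fix V assume V: "V \<in> proper_subspaces L"
    then have rV: "rational_subspace L V" by blast
    have "continuous_on UNIV (\<lambda>t. outer_min L V (center t))" "continuous_on UNIV (\<lambda>t. inner_max L V (center t))"
      by (rule continuous_on_compose2[OF outer_min_continuous[OF ex_outer[OF V]] cont_center], simp)
         (rule continuous_on_compose2[OF inner_max_continuous[OF L rV] cont_center], simp)
    then show "continuous_on UNIV (w V)" unfolding w_def by (intro continuous_intros)
    show "w V t \<ge> 0" for t by (simp add: w_def)
    show "lnvol L V t \<le> CARD('n) * ln (C * K)" if "w V t > 0" for t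
    proof -
      have "inner_max L V (center t) < K" using that unfolding w_def by linarith
      moreover have "C * K \<ge> 1"
      proof -
        have "K \<ge> 1" using C(1) K0_nonneg by (simp add: K_def)
        then show ?thesis using C(1) mult_mono[of 1 C 1 K] by simp
      qed
      moreover have "norm x \<le> C * K" if "N x \<le> K" for x
        using C(1) C(3)[of x] mult_left_mono[OF that, of C] by linarith
      ultimately have "lnvol L V (center t) \<le> CARD('n) * ln (C * K)"
        by (intro lnvol_le_inner_max[OF L rV sum_center])
      then show ?thesis unfolding center_def by (simp only: lnvol_shift[OF L rV])
    qed
  next
    fix V W t assume VW: "V \<in> proper_subspaces L" "W \<in> proper_subspaces L" "w V t > 0" "w W t > 0"
    have r: "rational_subspace L V" "rational_subspace L W" "subspace V" "subspace W"
      using VW(1,2) rational_subspace_subspace by blast+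
    have "inner_max L V (center t) < outer_min L V (center t)" "inner_max L W (center t) < outer_min L W (center t)"
      using VW(3,4) unfolding w_def by linarith+
    \<comment> \<open>If both failed, the four numbers would form a strictly increasing
      cycle.\<close>
    then have "inner_max L V (center t) < outer_min L W (center t) \<or> inner_max L W (center t) < outer_min L V (center t)"
      by linarith
    then show "V \<subseteq> W \<or> W \<subseteq> V"
      using inner_max_less_outer_min_nested[OF L r(1,4)] inner_max_less_outer_min_nested[OF L r(2,3)] by blast
  qed
  then obtain t0 where t0: "\<And>V. V \<in> proper_subspaces L \<Longrightarrow> w V t0 = 0" unfolding Lg by blast
  define t where "t = center t0"
  have t_sum: "(\<Sum>j\<in>UNIV. t $ j) = 0" unfolding t_def by (rule sum_center)
  have fin: "finite {v\<in>L. N (scl t v) \<le> r}" for r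
  proof -
    have "invertible (diagmat t ** g)" using det by (simp add: invertible_det_nz det_mul det_diagmat)
    then have "finite {v\<in>scl t ` L. norm v \<le> C * r}"
      unfolding Lg scl_Zlattice using discrete_subgroup_Zlattice discrete_subgroup_finite by blast
    moreover have "scl t ` {v\<in>L. N (scl t v) \<le> r} \<subseteq> {v\<in>scl t ` L. norm v \<le> C * r}"
      using C(1) order_trans[OF C(3) mult_left_mono] by fastforce
    ultimately have "finite (scl t ` {v\<in>L. N (scl t v) \<le> r})" by (rule finite_subset[rotated])
    then show ?thesis by (rule finite_imageD) (rule inj_on_subset[OF inj_scl subset_UNIV])
  qed
  have scl0: "scl t v = 0 \<longleftrightarrow> v = 0" for v
    by (simp add: vec_eq_iff)
  obtain v1 where v1: "v1 \<in> L" "v1 \<noteq> 0" "norm (scl t v1) \<le> K0" using K0[OF t_sum] by blast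
  have v1K: "N (scl t v1) < K"
    using C(1) C(2)[of "scl t v1"] mult_left_mono[OF v1(3), of C] unfolding K_def by linarith
  let ?A = "{v\<in>L. N (scl t v) \<le> K} - {0}"
  have A: "finite ?A" "v1 \<in> ?A" using fin v1 v1K by auto
  define v0 where "v0 = arg_min_on (\<lambda>v. N (scl t v)) ?A"
  have v0: "v0 \<in> ?A" "\<And>v. v \<in> ?A \<Longrightarrow> N (scl t v0) \<le> N (scl t v)"
    using arg_min_if_finite[OF A(1), of "\<lambda>v. N (scl t v)"] A(2) unfolding v0_def not_less[symmetric] by blast+
  define \<mu> where "\<mu> = N (scl t v0)"
  have lamK: "\<mu> < K" using v0(2)[OF A(2)] v1K by (simp add: \<mu>_def)
  have lam0: "\<mu> > 0" using v0(1) N_nonneg[of "scl t v0"] N_zero[of "scl t v0"] scl0 by (auto simp: \<mu>_def less_le)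
  have lam: "\<mu> \<le> N (scl t v)" if "v \<in> L" "v \<noteq> 0" for v
    using v0(2)[of v] that lamK by (cases "N (scl t v) \<le> K") (auto simp: \<mu>_def)
  define V where "V = span {v\<in>L. N (scl t v) \<le> \<mu>}"
  have "V = UNIV"
  proof (rule ccontr)
    assume "V \<noteq> UNIV"
    moreover have "v0 \<in> V" unfolding V_def using v0(1) by (intro span_base) (auto simp: \<mu>_def)
    then have "V \<noteq> {0}" using v0(1) by auto
    moreover have rV: "rational_subspace L V" unfolding V_def by (intro rational_subspace_span) auto
    ultimately have V: "V \<in> proper_subspaces L" by blast
    have "{v\<in>L \<inter> V. N (scl t v) \<le> \<mu>} = {v\<in>L. N (scl t v) \<le> \<mu>}" unfolding V_def by (auto intro: span_base)
    then have "inner_max L V t \<le> \<mu>" using lam0 V_def by (intro inner_max_le) auto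
    moreover have "outer_min L V t > \<mu>"
    proof -
      \<comment> \<open>Only finitely many lattice vectors outside \<open>V\<close> have length at
        most \<mu> + 1 and each exceeds \<mu>, so the infimum over all of them stays strictly above
        \<mu>.\<close>
      let ?B = "{v\<in>L. N (scl t v) \<le> \<mu> + 1} - V"
      define m where "m = Min (insert (\<mu> + 1) ((\<lambda>v. N (scl t v)) ` ?B))"
      have fB: "finite ?B" using fin by auto
      have "N (scl t v) > \<mu>" if "v \<in> L - V" for v
        using that span_base[of v "{v\<in>L. N (scl t v) \<le> \<mu>}"] unfolding V_def by fastforce
      then have "m > \<mu>" unfolding m_def using fB by (subst Min_gr_iff) auto
      moreover have "m \<le> outer_min L V t"
        unfolding outer_min_def
      proof (rule cINF_greatest[OF ex_outer[OF V]])
        fix v assume v: "v \<in> L - V"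
        show "m \<le> N (scl t v)"
        proof (cases "N (scl t v) \<le> \<mu> + 1")
          case True
          then show ?thesis unfolding m_def using v fB by (intro Min_le) auto
        next
          case False
          have "m \<le> \<mu> + 1" unfolding m_def using fB by (intro Min_le) auto
          then show ?thesis using False by linarith
        qed
      qed
      ultimately show ?thesis by linarith
    qed
    ultimately have "w V t0 > 0" using lamK unfolding w_def t_def[symmetric] by linarith
    then show False using t0[OF V] by simp
  qed
  have "succ_min N (scl t ` L) i = \<mu>" if "i \<in> {1..CARD('n)}" for i
  proof (rule succ_min_eq[OF lam0 _ _ that])
    have "{v\<in>scl t ` L. N v \<le> \<mu>} = scl t ` {v\<in>L. N (scl t v) \<le> \<mu>}" by auto
    then have "span {v\<in>scl t ` L. N v \<le> \<mu>} = scl t ` V"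
      unfolding V_def by (simp add: linear_span_image[OF linear_scl])
    also have "\<dots> = UNIV" unfolding \<open>V = UNIV\<close>
      by (rule surjI[of _ "scl (- t)"]) (simp add: scl_scl)
    finally show "span {v\<in>scl t ` L. N v \<le> \<mu>} = UNIV" .
    show "\<mu> \<le> N v" if "v \<in> scl t ` L" "v \<noteq> 0" for v using that lam scl0 by auto
  qed
  then have "act (diagmat t) L \<in> WR N"
    using act_diagmat_lattices_X[OF det t_sum] by (simp add: WR_def Lg act_diagmat)
  then show ?thesis using diagmat_diagA[OF t_sum] by blast
qed

end

theorem mainTheorem1:
  fixes N :: "real^'n \<Rightarrow> real" and L :: "(real^'n) set"
  assumes "CARD('n) \<ge> 2" and "is_norm N" and "L \<in> lattices_X"
  shows "\<exists>a1\<in>diagA. \<exists>a2\<in>diagA. act a1 L \<in> ST \<and> act a2 L \<in> WR N"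
  using stable_orbit_point_exists[OF assms(3)] well_rounded_orbit_point_exists[OF assms(2,3)] by blast

end
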